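(* Consider the Cauchy problem for the Thirring model on $\mathbb{R}^{1+1}$ with mass $m \ge 0$, $$(-i\gamma^\mu \partial_\mu + m)\psi = (\overline{\psi}\gamma^\mu\psi)\gamma_\mu\psi, \qquad \psi|_{t=0} = \psi_0,$$ for $\psi \colon \mathbb{R}^{1+1} \to \mathbb{C}^2$. For every $m \ge 0$ and every $1 \le p < 2$, this Cauchy problem fails to be locally well posed in the data space $X_0 = L^p(\mathbb{R})$. Moreover, in the massless case $m=0$, it also fails to be locally well posed in $X_0 = H^s(\mathbb{R})$ for every $s < 0$. Here local well-posedness in $X_0$ means the following: for every $\psi_0 \in X_0$ there exist a neighbourhood $\Omega$ of $\psi_0$ in $X_0$, a time $T>0$, and a continuous map $S \colon \Omega \to C([0,T];X_0)$ which on $\Omega \cap L^2(\mathbb{R})$ agrees (on the time interval $[0,T]$) with the global $L^2$ data-to-solution map of the Thirring model.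
   Context: Coordinates on $\mathbb{R}^{1+1}$ are $x^0=t$, $x^1=x$, with $\partial_0=\partial_t$, $\partial_1=\partial_x$ and metric $(g^{\mu\nu}) = \mathrm{diag}(1,-1)$; repeated indices $\mu=0,1$ are summed and indices are lowered with the metric ($\gamma_0=\gamma^0$, $\gamma_1=-\gamma^1$). The $2\times 2$ Dirac matrices $\gamma^0,\gamma^1$ satisfy $\gamma^\mu\gamma^\nu+\gamma^\nu\gamma^\mu = 2g^{\mu\nu}I$, $(\gamma^0)^*=\gamma^0$, $(\gamma^1)^*=-\gamma^1$. The spinor $\psi$ is a column vector, $\psi^*$ is its conjugate transpose, and $\overline{\psi}=\psi^*\gamma^0$. With the representation $\gamma^0=\begin{pmatrix}0&1\\1&0\end{pmatrix}$, $\gamma^1=\begin{pmatrix}0&-1\\1&0\end{pmatrix}$ and $\psi=(u,v)^\intercal$, the equation becomes $$(\partial_t+\partial_x)u = -imv+2i|v|^2u, \qquad (\partial_t-\partial_x)v = -imu+2i|u|^2v.$$ Function spaces of spinors consist of $\mathbb{C}^2$-valued functions (or distributions) on $\mathbb{R}$; $H^s(\mathbb{R})=(1-\partial_x^2)^{-s/2}L^2(\mathbb{R})$. The space $C([0,T];X_0)$ carries the norm $\sup_{t\in[0,T]}\|\psi(t)\|_{X_0}$. The global $L^2$ data-to-solution map is the one provided by the following known theorem (Candy): for any $m\ge 0$ and any $\psi_0\in L^2(\mathbb{R})$ there is a global solution $\psi\in C(\mathbb{R};L^2)$ of the Thirring model with data $\psi_0$; for any $T>0$ the map $\psi_0\mapsto\psi$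 is continuous from $L^2(\mathbb{R})$ into $C([-T,T];L^2(\mathbb{R}))$, and the solution is unique in a subset of that space; if $\psi_0\in H^s(\mathbb{R})$ for some $s>0$, then $\psi\in C(\mathbb{R};H^s)$. (In particular the map is the unique continuous extension to $L^2(\mathbb{R})$ of the map sending $\psi_0\in H^1(\mathbb{R})$ to the unique solution in $C(\mathbb{R};H^1)$.) It is not required that $S(\psi_0')$ satisfy the equation in the sense of distributions for $\psi_0'\in\Omega\setminus L^2(\mathbb{R})$. *)

theory Defs
  imports "HOL-Analysis.Analysis"
begin

type_synonym spinor = "complex ^ 2"
type_synonym field = "real \<Rightarrow> spinor"

text \<open>
  Spinor-valued distributions on the line. Such an object is only ever evaluated on the Schwartz
  functions, so two functionals that agree on \<open>schwartz\<close> stand for the same distribution.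
\<close>
type_synonym distribution = "(real \<Rightarrow> complex) \<Rightarrow> spinor"


subsection \<open>Lebesgue spaces\<close>

text \<open>
  Elements are Borel representatives; \<open>Lp_dist p\<close> is a pseudometric which vanishes exactly on
  pairs of almost everywhere equal functions.
\<close>

definition Lp_space :: "real \<Rightarrow> field set" where
  "Lp_space p = {f \<in> borel_measurable lborel. integrable lborel (\<lambda>x. norm (f x) powr p)}"

definition Lp_norm :: "real \<Rightarrow> field \<Rightarrow> real" where
  "Lp_norm p f = (LINT x|lborel. norm (f x) powr p) powr (1 / p)"

definition Lp_dist :: "real \<Rightarrow> field \<Rightarrow> field \<Rightarrow> real" where
  "Lp_dist p f g = Lp_norm p (\<lambda>x. f x - g x)"

definition ae_equal :: "field \<Rightarrow> field \<Rightarrow> bool" where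
  "ae_equal f g \<longleftrightarrow> (AE x in lborel. f x = g x)"


subsection \<open>Sobolev spaces\<close>

definition schwartz :: "(real \<Rightarrow> complex) set" where
  "schwartz = {\<phi>. \<exists>D :: nat \<Rightarrow> real \<Rightarrow> complex. D 0 = \<phi> \<and>
     (\<forall>n x. (D n has_vector_derivative D (Suc n) x) (at x)) \<and>
     (\<forall>n k. bounded (range (\<lambda>x. x ^ k *\<^sub>R D n x)))}"

definition fourier :: "(real \<Rightarrow> complex) \<Rightarrow> real \<Rightarrow> complex" where
  "fourier \<phi> \<xi> = (LINT x|lborel. exp (- \<i> * of_real (x * \<xi>)) * \<phi> x)"

text \<open>The operator \<open>(1 - \<partial>\<^sub>x\<^sup>2)\<close> to the power \<open>\<sigma> / 2\<close> on Schwartz functions, as a Fourier multiplier.\<close>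

definition bessel_op :: "real \<Rightarrow> (real \<Rightarrow> complex) \<Rightarrow> real \<Rightarrow> complex" where
  "bessel_op \<sigma> \<phi> x = of_real (1 / (2 * pi)) *
     (LINT \<xi>|lborel. exp (\<i> * of_real (x * \<xi>)) * of_real ((1 + \<xi>\<^sup>2) powr (\<sigma> / 2)) * fourier \<phi> \<xi>)"

definition regular :: "field \<Rightarrow> distribution" where
  "regular f = (\<lambda>\<phi>. LINT x|lborel. \<phi> x *s f x)"

text \<open>
  The same operator on tempered distributions is defined by duality; its symbol is even, so it is its
  own transpose. Thus \<open>Hs_rep s u f\<close> says that \<open>f\<close> lies in \<open>L\<^sup>2\<close> and that \<open>u\<close> is the image of \<open>f\<close>
  under \<open>(1 - \<partial>\<^sub>x\<^sup>2)\<close> to the power \<open>- s / 2\<close>. Such a \<open>u\<close> is automatically a tempered distribution.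
\<close>

definition Hs_rep :: "real \<Rightarrow> distribution \<Rightarrow> field \<Rightarrow> bool" where
  "Hs_rep s u f \<longleftrightarrow> f \<in> Lp_space 2 \<and> (\<forall>\<phi>\<in>schwartz. u \<phi> = regular f (bessel_op (- s) \<phi>))"

definition Hs_space :: "real \<Rightarrow> distribution set" where
  "Hs_space s = {u. \<exists>f. Hs_rep s u f}"

text \<open>The function \<open>f\<close> below is unique up to null sets, so the infimum is over a one-point set.\<close>

definition Hs_norm :: "real \<Rightarrow> distribution \<Rightarrow> real" where
  "Hs_norm s u = Inf {Lp_norm 2 f | f. Hs_rep s u f}"

definition Hs_dist :: "real \<Rightarrow> distribution \<Rightarrow> distribution \<Rightarrow> real" where
  "Hs_dist s u v = Hs_norm s (\<lambda>\<phi>. u \<phi> - v \<phi>)"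

definition represents :: "field \<Rightarrow> distribution \<Rightarrow> bool" where
  "represents f u \<longleftrightarrow> (\<forall>\<phi>\<in>schwartz. u \<phi> = regular f \<phi>)"


subsection \<open>Curves in a function space and continuous maps into spaces of curves\<close>

text \<open>
  A function space is given by a carrier \<open>X\<close> and a pseudometric \<open>d\<close>; \<open>curves X d I\<close> is \<open>C(I; X)\<close>.
\<close>

definition curves :: "'a set \<Rightarrow> ('a \<Rightarrow> 'a \<Rightarrow> real) \<Rightarrow> real set \<Rightarrow> (real \<Rightarrow> 'a) set" where
  "curves X d I = {c. (\<forall>t\<in>I. c t \<in> X) \<and>
     (\<forall>t\<in>I. \<forall>\<epsilon>>0. \<exists>\<delta>>0. \<forall>r\<in>I. \<bar>r - t\<bar> < \<delta> \<longrightarrow> d (c r) (c t) < \<epsilon>)}"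

text \<open>Continuity of \<open>S : \<Omega> \<rightarrow> C(I; X)\<close> for the uniform distance on \<open>I\<close> (with \<open>I\<close> compact).\<close>

definition continuous_to_curves ::
  "'a set \<Rightarrow> 'a set \<Rightarrow> ('a \<Rightarrow> 'a \<Rightarrow> real) \<Rightarrow> real set \<Rightarrow> ('a \<Rightarrow> real \<Rightarrow> 'a) \<Rightarrow> bool" where
  "continuous_to_curves \<Omega> X d I S \<longleftrightarrow>
     (\<forall>a\<in>\<Omega>. S a \<in> curves X d I) \<and>
     (\<forall>a\<in>\<Omega>. \<forall>\<epsilon>>0. \<exists>\<delta>>0. \<forall>b\<in>\<Omega>. d a b < \<delta> \<longrightarrow> (\<forall>t\<in>I. d (S a t) (S b t) < \<epsilon>))"

definition nbhd_in :: "'a set \<Rightarrow> ('a \<Rightarrow> 'a \<Rightarrow> real) \<Rightarrow> 'a \<Rightarrow> 'a set \<Rightarrow> bool" where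
  "nbhd_in X d a \<Omega> \<longleftrightarrow> \<Omega> \<subseteq> X \<and> (\<exists>r>0. {b \<in> X. d a b < r} \<subseteq> \<Omega>)"


subsection \<open>The Thirring model\<close>

definition minkowski :: "nat \<Rightarrow> nat \<Rightarrow> real" where
  "minkowski \<mu> \<nu> = (if \<mu> \<noteq> \<nu> then 0 else if \<mu> = 0 then 1 else - 1)"

definition conj_transpose :: "complex ^ 2 ^ 2 \<Rightarrow> complex ^ 2 ^ 2" where
  "conj_transpose A = (\<chi> i j. cnj (A $ j $ i))"

text \<open>The family \<open>\<gamma>\<close> is only used at the indices 0 and 1.\<close>

definition dirac_matrices :: "(nat \<Rightarrow> complex ^ 2 ^ 2) \<Rightarrow> bool" where
  "dirac_matrices \<gamma> \<longleftrightarrow>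
     (\<forall>\<mu><2. \<forall>\<nu><2. \<gamma> \<mu> ** \<gamma> \<nu> + \<gamma> \<nu> ** \<gamma> \<mu> = (2 * minkowski \<mu> \<nu>) *\<^sub>R mat 1) \<and>
     conj_transpose (\<gamma> 0) = \<gamma> 0 \<and> conj_transpose (\<gamma> 1) = - \<gamma> 1"

definition gamma_lower :: "(nat \<Rightarrow> complex ^ 2 ^ 2) \<Rightarrow> nat \<Rightarrow> complex ^ 2 ^ 2" where
  "gamma_lower \<gamma> \<mu> = (\<Sum>\<nu><2. minkowski \<mu> \<nu> *\<^sub>R \<gamma> \<nu>)"

definition dirac_adjoint :: "(nat \<Rightarrow> complex ^ 2 ^ 2) \<Rightarrow> spinor \<Rightarrow> spinor" where
  "dirac_adjoint \<gamma> z = (\<chi> i. cnj (z $ i)) v* \<gamma> 0"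

definition current :: "(nat \<Rightarrow> complex ^ 2 ^ 2) \<Rightarrow> spinor \<Rightarrow> nat \<Rightarrow> complex" where
  "current \<gamma> z \<mu> = (\<Sum>i\<in>UNIV. dirac_adjoint \<gamma> z $ i * (\<gamma> \<mu> *v z) $ i)"

definition nonlinearity :: "(nat \<Rightarrow> complex ^ 2 ^ 2) \<Rightarrow> spinor \<Rightarrow> spinor" where
  "nonlinearity \<gamma> z = (\<Sum>\<mu><2. current \<gamma> z \<mu> *s (gamma_lower \<gamma> \<mu> *v z))"

text \<open>Smooth compactly supported functions of \<open>(t, x)\<close>; \<open>D i j\<close> is the derivative of order \<open>i\<close> in
  \<open>t\<close> and \<open>j\<close> in \<open>x\<close>.\<close>

definition test_functions :: "(real \<Rightarrow> real \<Rightarrow> complex) set" where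
  "test_functions = {\<eta>.
     (\<exists>D :: nat \<Rightarrow> nat \<Rightarrow> real \<Rightarrow> real \<Rightarrow> complex. D 0 0 = \<eta> \<and>
        (\<forall>i j. continuous_on UNIV (\<lambda>(t, x). D i j t x)) \<and>
        (\<forall>i j t x. ((\<lambda>\<tau>. D i j \<tau> x) has_vector_derivative D (Suc i) j t x) (at t)) \<and>
        (\<forall>i j t x. ((\<lambda>y. D i j t y) has_vector_derivative D i (Suc j) t x) (at x))) \<and>
     (\<exists>R. \<forall>t x. \<bar>t\<bar> > R \<or> \<bar>x\<bar> > R \<longrightarrow> \<eta> t x = 0)}"

definition partial :: "nat \<Rightarrow> (real \<Rightarrow> real \<Rightarrow> complex) \<Rightarrow> real \<Rightarrow> real \<Rightarrow> complex" where
  "partial \<mu> \<eta> t x =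
     (if \<mu> = 0 then vector_derivative (\<lambda>\<tau>. \<eta> \<tau> x) (at t) else vector_derivative (\<lambda>y. \<eta> t y) (at x))"

text \<open>
  The Thirring equation in the sense of distributions on space-time. The iterated integral is
  deliberate: the inner integral does not depend on the representatives chosen for the \<open>\<psi> t\<close>,
  whereas these need not be jointly measurable in \<open>(t, x)\<close>.
\<close>

definition thirring_equation ::
  "(nat \<Rightarrow> complex ^ 2 ^ 2) \<Rightarrow> real \<Rightarrow> (real \<Rightarrow> field) \<Rightarrow> bool" where
  "thirring_equation \<gamma> m \<psi> \<longleftrightarrow> (\<forall>\<eta>\<in>test_functions.
     (LINT t|lborel. LINT x|lborel.
        (\<Sum>\<mu><2. (\<i> * partial \<mu> \<eta> t x) *s (\<gamma> \<mu> *v \<psi> t x))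
        + (of_real m * \<eta> t x) *s \<psi> t x
        - \<eta> t x *s nonlinearity \<gamma> (\<psi> t x)) = 0)"

text \<open>Solutions in \<open>C(\<real>; H\<^sup>1)\<close> with initial data \<open>\<psi>\<^sub>0\<close>.\<close>

definition H1_solution ::
  "(nat \<Rightarrow> complex ^ 2 ^ 2) \<Rightarrow> real \<Rightarrow> field \<Rightarrow> (real \<Rightarrow> field) \<Rightarrow> bool" where
  "H1_solution \<gamma> m \<psi>\<^sub>0 \<psi> \<longleftrightarrow>
     (\<forall>t. \<psi> t \<in> Lp_space 2) \<and>
     (\<lambda>t. regular (\<psi> t)) \<in> curves (Hs_space 1) (Hs_dist 1) UNIV \<and>
     thirring_equation \<gamma> m \<psi> \<and> ae_equal (\<psi> 0) \<psi>\<^sub>0"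

text \<open>
  The global \<open>L\<^sup>2\<close> data-to-solution map: the continuous extension to \<open>L\<^sup>2\<close> of the map which sends
  \<open>\<psi>\<^sub>0 \<in> H\<^sup>1\<close> to the unique solution in \<open>C(\<real>; H\<^sup>1)\<close>. These properties determine \<open>\<Phi>\<close> up to
  almost everywhere equality because \<open>H\<^sup>1\<close> is dense in \<open>L\<^sup>2\<close>; existence is due to Candy.
\<close>

definition L2_data_to_solution ::
  "(nat \<Rightarrow> complex ^ 2 ^ 2) \<Rightarrow> real \<Rightarrow> (field \<Rightarrow> real \<Rightarrow> field) \<Rightarrow> bool" where
  "L2_data_to_solution \<gamma> m \<Phi> \<longleftrightarrow>
     (\<forall>\<psi>\<^sub>0\<in>Lp_space 2. \<Phi> \<psi>\<^sub>0 \<in> curves (Lp_space 2) (Lp_dist 2) UNIV \<and> ae_equal (\<Phi> \<psi>\<^sub>0 0) \<psi>\<^sub>0) \<and>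
     (\<forall>T>0. continuous_to_curves (Lp_space 2) (Lp_space 2) (Lp_dist 2) {- T..T} \<Phi>) \<and>
     (\<forall>\<psi>\<^sub>0\<in>Lp_space 2. regular \<psi>\<^sub>0 \<in> Hs_space 1 \<longrightarrow>
        H1_solution \<gamma> m \<psi>\<^sub>0 (\<Phi> \<psi>\<^sub>0) \<and>
        (\<forall>\<psi>. H1_solution \<gamma> m \<psi>\<^sub>0 \<psi> \<longrightarrow> (\<forall>t. ae_equal (\<psi> t) (\<Phi> \<psi>\<^sub>0 t))))"


subsection \<open>Local well-posedness\<close>

text \<open>
  \<open>same f a\<close> says that the function \<open>f \<in> L\<^sup>2\<close> and the element \<open>a\<close> of the data space are the same
  distribution; it is used to express membership of \<open>a\<close> in \<open>L\<^sup>2\<close>.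
\<close>

definition locally_well_posed ::
  "(field \<Rightarrow> real \<Rightarrow> field) \<Rightarrow> 'a set \<Rightarrow> ('a \<Rightarrow> 'a \<Rightarrow> real) \<Rightarrow> (field \<Rightarrow> 'a \<Rightarrow> bool) \<Rightarrow> bool" where
  "locally_well_posed \<Phi> X d same \<longleftrightarrow>
     (\<forall>a\<^sub>0\<in>X. \<exists>\<Omega> T S. nbhd_in X d a\<^sub>0 \<Omega> \<and> T > 0 \<and>
        continuous_to_curves \<Omega> X d {0..T} S \<and>
        (\<forall>a\<in>\<Omega>. \<forall>f\<in>Lp_space 2. same f a \<longrightarrow> (\<forall>t\<in>{0..T}. same (\<Phi> f t) (S a t))))"

end

theory Submission
  imports Defs "HOL-Probability.Probability"
begin

text \<open>
  In a chiral basis the Thirring model reads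
  \<open>(\<partial>\<^sub>t + \<partial>\<^sub>x) u = - \<i>mv + 2\<i>\<bar>v\<bar>\<^sup>2u\<close> and \<open>(\<partial>\<^sub>t - \<partial>\<^sub>x) v = - \<i>mu + 2\<i>\<bar>u\<bar>\<^sup>2v\<close>. For \<open>m = 0\<close> the moduli are
  transported, and therefore \<open>u(t, x) = u\<^sub>0(x - t) exp (\<i>\<theta>)\<close>, where \<open>\<theta>\<close> is the integral of \<open>\<bar>v\<^sub>0\<bar>\<^sup>2\<close> over
  \<open>[x - t, x + t]\<close>. The phase is governed by the charge of \<open>v\<^sub>0\<close> on that interval, and neither \<open>L\<^sup>p\<close> with
  \<open>p < 2\<close> nor \<open>H\<^sup>s\<close> with \<open>s < 0\<close> controls the charge: a pulse tends to zero in \<open>L\<^sup>p\<close> when it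
  concentrates at a point with \<open>\<integral>\<bar>v\<^sub>0\<bar>\<^sup>2\<close> fixed, and it tends to zero in \<open>H\<^sup>s\<close> when it is modulated by
  \<open>exp (\<i>nx)\<close>, which leaves \<open>\<bar>v\<^sub>0\<bar>\<^sup>2\<close> unchanged. So the data \<open>(u\<^sub>0, pulse\<^sub>n)\<close> converge to \<open>(u\<^sub>0, 0)\<close>, but the
  solutions keep a phase shift that the solution for \<open>(u\<^sub>0, 0)\<close> does not have, and no continuous
  extension of the \<open>L\<^sup>2\<close> data-to-solution map can exist near \<open>(u\<^sub>0, 0)\<close>.

  For \<open>m > 0\<close> the formula has an error that is governed by the elapsed time and by the \<open>L\<^sup>1\<close> norm of
  the pulse (\<open>scattering_phase\<close>). A concentrating pulse is small in \<open>L\<^sup>1\<close>, so at a small positive time its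
  phase shift of \<open>\<pi>\<close> dominates (\<open>pulse_scattering\<close>).

  All data are Gaussians, so they lie in \<open>H\<^sup>1\<close>. For such data the map \<open>\<Phi>\<close>
  provides a solution in \<open>C(\<real>; H\<^sup>1)\<close> in the sense of distributions, and its properties follow from the
  equation. The Sobolev embedding turns it into a pair of jointly continuous functions
  (\<open>H1_curve_continuous_representative\<close>). Testing the equation with products of bumps adapted to the
  characteristics shows that these functions are differentiable along the characteristics
  (\<open>transport_of_weak\<close>, \<open>H1_solution_characteristic\<close>), where the equations become ordinary
  differential equations (\<open>scattering_phase\<close>, \<open>scattered_wave\<close>).

  As \<open>H\<^sup>s\<close> is defined by duality with Bessel potentials of Schwartz functions, both the membership of
  the data in \<open>H\<^sup>s\<close> and the embedding rest on Parseval's formula and on the Plancherel inequality. Both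
  come from Gaussian regularisation (\<open>parseval\<close>, \<open>plancherel_inequality\<close>, \<open>bessel_op_duality\<close>).
\<close>

section \<open>Spinors in a chiral basis\<close>

definition cinner :: "spinor \<Rightarrow> spinor \<Rightarrow> complex" where
  "cinner e z = (\<Sum>i\<in>UNIV. cnj (e $ i) * z $ i)"

lemma cinner_add_right: "cinner e (y + z) = cinner e y + cinner e z"
  by (simp add: cinner_def distrib_left sum.distrib)
lemma cinner_diff_right: "cinner e (y - z) = cinner e y - cinner e z"
  by (simp add: cinner_def right_diff_distrib sum_subtractf)
lemma cinner_smult_right: "cinner e (c *s z) = c * cinner e z"
  by (simp add: cinner_def sum_distrib_left mult_ac)
lemma cinner_smult_left: "cinner (c *s e) z = cnj c * cinner e z"
  by (simp add: cinner_def sum_distrib_left mult_ac)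
lemma cinner_scaleR_right: "cinner e (c *\<^sub>R z) = c *\<^sub>R cinner e z"
  by (simp add: cinner_def scaleR_sum_right)
lemma cinner_minus_left: "cinner (- e) z = - cinner e z"
  by (simp add: cinner_def sum_negf)
lemma cinner_minus_right: "cinner e (- z) = - cinner e z"
  by (simp add: cinner_def sum_negf)
lemma cinner_cnj: "cnj (cinner y z) = cinner z y"
  by (simp add: cinner_def mult.commute)
lemma cinner_self: "cinner z z = of_real ((norm z)\<^sup>2)"
proof -
  have "(norm z)\<^sup>2 = (\<Sum>i\<in>UNIV. (cmod (z $ i))\<^sup>2)"
    by (simp add: norm_vec_def L2_set_def sum_nonneg)
  then show ?thesis
    by (simp add: cinner_def complex_norm_square[symmetric] mult.commute del: of_real_power)
qed

lemmas cinner_simps = cinner_add_right cinner_diff_right cinner_smult_right cinner_scaleR_right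
  cinner_minus_left cinner_minus_right

lemma norm_cinner_le: "cmod (cinner e z) \<le> norm e * norm z"
proof -
  have "cmod (cinner e z) \<le> (\<Sum>i\<in>UNIV. \<bar>cmod (e $ i)\<bar> * \<bar>cmod (z $ i)\<bar>)"
    unfolding cinner_def by (rule sum_norm_le) (simp add: norm_mult)
  also have "\<dots> \<le> L2_set (\<lambda>i. cmod (e $ i)) UNIV * L2_set (\<lambda>i. cmod (z $ i)) UNIV"
    by (rule L2_set_mult_ineq)
  finally show ?thesis by (simp add: norm_vec_def)
qed

lemma bounded_linear_cinner: "bounded_linear (cinner e)"
  by (rule bounded_linear_intro[where K = "norm e"])
     (simp_all add: cinner_simps norm_cinner_le mult.commute[of "norm _" "norm e"])

lemma cinner_adjoint: "cinner e (A *v z) = cinner (conj_transpose A *v e) z"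
  by (simp add: cinner_def conj_transpose_def matrix_vector_mult_def sum_2 UNIV_2 algebra_simps)

text \<open>\<open>\<gamma>\<^sup>0\<gamma>\<^sup>1\<close> is a Hermitian involution that anticommutes with \<open>\<gamma>\<^sup>0\<close>: a unit eigenvector
  \<open>e\<close> for the eigenvalue \<open>1\<close> and \<open>f = \<gamma>\<^sup>0e\<close> form an orthonormal basis in which any choice of the
  Dirac matrices takes the standard form.\<close>

locale chiral_basis =
  fixes \<gamma> :: "nat \<Rightarrow> complex ^ 2 ^ 2" and e f :: spinor
  assumes dirac: "dirac_matrices \<gamma>"
    and ee: "cinner e e = 1" and ef: "cinner e f = 0" and fe: "cinner f e = 0" and ff: "cinner f f = 1"
    and g0e: "\<gamma> 0 *v e = f" and g0f: "\<gamma> 0 *v f = e"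
    and g1e: "\<gamma> 1 *v e = f" and g1f: "\<gamma> 1 *v f = - e"

lemma minus_matrix_vector_mult: "(- A) *v x = - (A *v (x::spinor))" for A :: "complex^2^2"
  by (simp add: matrix_vector_mult_def vec_eq_iff sum_negf)

lemma dirac_squares:
  assumes "dirac_matrices \<gamma>"
  shows "\<gamma> 0 ** \<gamma> 0 = mat 1" "\<gamma> 1 ** \<gamma> 1 = - mat 1" "\<gamma> 1 ** \<gamma> 0 = - (\<gamma> 0 ** \<gamma> 1)"
proof -
  have *: "\<gamma> \<mu> ** \<gamma> \<nu> + \<gamma> \<nu> ** \<gamma> \<mu> = (2 * minkowski \<mu> \<nu>) *\<^sub>R mat 1" if "\<mu> < 2" "\<nu> < 2" for \<mu> \<nu>
    using assms that by (auto simp: dirac_matrices_def)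
  have "2 *\<^sub>R (\<gamma> 0 ** \<gamma> 0) = 2 *\<^sub>R mat 1" using *[of 0 0] by (simp add: minkowski_def scaleR_2)
  then show "\<gamma> 0 ** \<gamma> 0 = mat 1" by (simp only: real_vector.scale_cancel_left) simp
  have "2 *\<^sub>R (\<gamma> 1 ** \<gamma> 1) = 2 *\<^sub>R (- mat 1)" using *[of 1 1] by (simp add: minkowski_def scaleR_2)
  then show "\<gamma> 1 ** \<gamma> 1 = - mat 1" by (simp only: real_vector.scale_cancel_left) simp
  have "\<gamma> 0 ** \<gamma> 1 + \<gamma> 1 ** \<gamma> 0 = 0" using *[of 0 1] by (simp add: minkowski_def)
  then show "\<gamma> 1 ** \<gamma> 0 = - (\<gamma> 0 ** \<gamma> 1)" by (metis add_eq_0_iff)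
qed

lemma exists_chiral_basis:
  assumes d: "dirac_matrices \<gamma>"
  shows "\<exists>e f. chiral_basis \<gamma> e f"
proof -
  note s = dirac_squares[OF d]
  have h0: "conj_transpose (\<gamma> 0) = \<gamma> 0" and h1: "conj_transpose (\<gamma> 1) = - \<gamma> 1"
    using d by (auto simp: dirac_matrices_def)
  have sv0: "\<gamma> 0 *v (\<gamma> 0 *v x) = x" and sv1: "\<gamma> 1 *v (\<gamma> 1 *v x) = - x"
    and sv01: "\<gamma> 1 *v (\<gamma> 0 *v x) = - (\<gamma> 0 *v (\<gamma> 1 *v x))" for x
    using s by (simp_all add: matrix_vector_mul_assoc minus_matrix_vector_mult)
  define G where "G x = \<gamma> 0 *v (\<gamma> 1 *v x)" for x
  have neg: "A *v (- x) = - (A *v x)" for A :: "complex^2^2" and x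
    by (simp add: vec.neg)
  have GG: "G (G x) = x" for x
    by (simp add: G_def sv01 neg sv0 sv1 del: One_nat_def)
  have "\<exists>w. G w \<noteq> - w"
  proof (rule ccontr)
    assume "\<not> (\<exists>w. G w \<noteq> - w)"
    then have a: "G w = - w" for w by blast
    have "\<gamma> 0 *v w = 0" for w
    proof -
      have "- (\<gamma> 0 *v w) = G (\<gamma> 0 *v w)" by (simp add: a)
      also have "\<dots> = - (\<gamma> 0 *v G w)" by (simp add: G_def sv01 neg del: One_nat_def)
      also have "\<dots> = \<gamma> 0 *v w" by (simp add: a neg)
      finally have "2 *\<^sub>R (\<gamma> 0 *v w) = 0" by (simp add: scaleR_2)
      then show ?thesis by simp
    qed
    then have "w = 0" for w :: spinor by (metis sv0 )
    from this[of "axis 1 1"] show False by (simp add: axis_eq_0_iff)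
  qed
  then obtain w where w: "G w \<noteq> - w" by blast
  define e0 where "e0 = w + G w"
  have "e0 \<noteq> 0" using w by (metis add_eq_0_iff e0_def)
  have Gadd: "G (x + y) = G x + G y" for x y by (simp add: G_def matrix_vector_right_distrib)
  have Ge0: "G e0 = e0" by (simp add: e0_def Gadd GG add.commute)
  define e where "e = of_real (1 / norm e0) *s e0"
  define f where "f = \<gamma> 0 *v e"
  have Ge: "G e = e"
    using Ge0 by (simp add: e_def G_def vector_scalar_commute del: One_nat_def)
  have ee: "cinner e e = 1"
    using \<open>e0 \<noteq> 0\<close> unfolding e_def cinner_smult_left cinner_smult_right
    by (simp add: cinner_self power2_eq_square)
  have g0f: "\<gamma> 0 *v f = e" by (simp add: f_def sv0)
  have ff: "cinner f f = 1"
    using ee by (subst (2) f_def) (simp add: cinner_adjoint h0 g0f)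
  have g1e: "\<gamma> 1 *v e = f"
    using Ge sv0 by (metis G_def f_def)
  have g1f: "\<gamma> 1 *v f = - e"
    by (metis g1e sv1)
  have "cinner f e = cinner (\<gamma> 0 *v e) e" by (simp add: f_def)
  also have "\<dots> = cinner e (\<gamma> 0 *v e)" by (simp add: cinner_adjoint h0)
  finally have 1: "cinner f e = cinner e f" by (simp add: f_def)
  have "cinner e f = cinner e (\<gamma> 1 *v e)" by (simp only: g1e)
  also have "\<dots> = - cinner f e" by (subst cinner_adjoint) (simp add: h1 minus_matrix_vector_mult g1e cinner_minus_left del: One_nat_def)
  finally have "2 * cinner e f = 0" using 1 by simp
  then have "cinner e f = 0" by simp
  with 1 have "chiral_basis \<gamma> e f"
    by unfold_locales (use d ee ff g0f g1e g1f in \<open>auto simp: f_def\<close>)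
  then show ?thesis by blast
qed

context chiral_basis begin

lemma norm_e: "norm e = 1" and norm_f: "norm f = 1"
proof -
  have "complex_of_real ((norm e)\<^sup>2) = 1" using ee by (simp only: cinner_self)
  then have "(norm e)\<^sup>2 = 1" by (simp only: of_real_eq_1_iff)
  then show "norm e = 1" by (simp add: power2_eq_1_iff) (smt (verit) norm_ge_zero)
  have "complex_of_real ((norm f)\<^sup>2) = 1" using ff by (simp only: cinner_self)
  then have "(norm f)\<^sup>2 = 1" by (simp only: of_real_eq_1_iff)
  then show "norm f = 1" by (simp add: power2_eq_1_iff) (smt (verit) norm_ge_zero)
qed

lemma g0_adj: "cinner x (\<gamma> 0 *v z) = cinner (\<gamma> 0 *v x) z"
  using dirac by (simp add: cinner_adjoint dirac_matrices_def)
lemma g1_adj: "cinner x (\<gamma> 1 *v z) = - cinner (\<gamma> 1 *v x) z"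
  using dirac by (simp add: cinner_adjoint dirac_matrices_def minus_matrix_vector_mult cinner_minus_left)

text \<open>For the matrix \<open>U\<close> with columns \<open>e\<close> and \<open>f\<close>, orthonormality says \<open>U\<^sup>*U = 1\<close>, and the expansion is
  \<open>UU\<^sup>* = 1\<close>.\<close>

lemma spinor_expansion: "z = cinner e z *s e + cinner f z *s f"
proof -
  define U :: "complex^2^2" where "U = (\<chi> i j. if j = 1 then e $ i else f $ i)"
  define V :: "complex^2^2" where "V = (\<chi> i j. if i = 1 then cnj (e $ j) else cnj (f $ j))"
  have "V ** U = mat 1"
    using ee ef fe ff
    by (simp add: U_def V_def matrix_matrix_mult_def mat_def vec_eq_iff forall_2 sum_2 cinner_def UNIV_2)
  then have "U ** V = mat 1" by (simp add: matrix_left_right_inverse)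
  then have "z = U *v (V *v z)" by (simp add: matrix_vector_mul_assoc)
  also have "\<dots> = cinner e z *s e + cinner f z *s f"
    by (simp add: U_def V_def matrix_vector_mult_def vec_eq_iff forall_2 sum_2 cinner_def UNIV_2 algebra_simps)
  finally show ?thesis .
qed

lemma current_0: "current \<gamma> z 0 = of_real ((cmod (cinner e z))\<^sup>2 + (cmod (cinner f z))\<^sup>2)"
  and current_1: "current \<gamma> z 1 = of_real ((cmod (cinner e z))\<^sup>2 - (cmod (cinner f z))\<^sup>2)"
proof -
  have h0: "conj_transpose (\<gamma> 0) = \<gamma> 0" using dirac by (auto simp: dirac_matrices_def)
  have cur: "current \<gamma> z \<mu> = cinner z (\<gamma> 0 *v (\<gamma> \<mu> *v z))" for \<mu>
    by (simp add: current_def dirac_adjoint_def cinner_def vector_matrix_mult_def matrix_vector_mult_def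
        sum_2 UNIV_2 algebra_simps)
  have exp: "cinner z w = cnj (cinner e z) * cinner e w + cnj (cinner f z) * cinner f w" for w
    by (subst spinor_expansion[of w]) (simp add: cinner_simps cinner_cnj mult.commute)
  show "current \<gamma> z 0 = of_real ((cmod (cinner e z))\<^sup>2 + (cmod (cinner f z))\<^sup>2)"
    unfolding cur exp[of "\<gamma> 0 *v _"]
    by (simp add: g0_adj g0e g0f complex_norm_square mult.commute
      del: of_real_power)
  show "current \<gamma> z 1 = of_real ((cmod (cinner e z))\<^sup>2 - (cmod (cinner f z))\<^sup>2)"
    unfolding cur exp[of "\<gamma> 0 *v _"]
    by (simp add: g0_adj g1_adj g0e g0f g1e g1f cinner_minus_left complex_norm_square mult.commute
      del: of_real_power One_nat_def)
qed

text \<open>The two currents are the sum and the difference of the squared moduli of the components. In each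
  component of the equation the self-interaction cancels, so that only the modulus of the other
  component is left.\<close>

lemma cinner_nonlinearity:
  "cinner f (nonlinearity \<gamma> z) = 2 * (cmod (cinner f z))\<^sup>2 * cinner e z"
  "cinner e (nonlinearity \<gamma> z) = 2 * (cmod (cinner e z))\<^sup>2 * cinner f z"
proof -
  have lt2: "{..<2::nat} = {0, 1}" by auto
  have N: "nonlinearity \<gamma> z = current \<gamma> z 0 *s (\<gamma> 0 *v z) - current \<gamma> z 1 *s (\<gamma> 1 *v z)"
    by (simp add: nonlinearity_def gamma_lower_def minkowski_def lt2 minus_matrix_vector_mult vec.scale_right_diff_distrib del: One_nat_def)
  show "cinner f (nonlinearity \<gamma> z) = 2 * (cmod (cinner f z))\<^sup>2 * cinner e z"
    unfolding N current_0 current_1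
    by (simp add: cinner_simps g0_adj g1_adj g0e g0f g1e g1f algebra_simps del: One_nat_def)
  show "cinner e (nonlinearity \<gamma> z) = 2 * (cmod (cinner e z))\<^sup>2 * cinner f z"
    unfolding N current_0 current_1
    by (simp add: cinner_simps g0_adj g1_adj g0e g0f g1e g1f algebra_simps del: One_nat_def)
qed

text \<open>The integrand of the weak equation in the chiral basis; \<open>c 0\<close>, \<open>c 1\<close> and \<open>h\<close> stand for
  \<open>\<partial>\<^sub>t\<eta>\<close>, \<open>\<partial>\<^sub>x\<eta>\<close> and \<open>\<eta>\<close>.\<close>

lemma cinner_weak_integrand:
  fixes c :: "nat \<Rightarrow> complex" and h :: complex and m :: real and z :: spinor
  defines "V \<equiv> (\<Sum>\<mu><2. (\<i> * c \<mu>) *s (\<gamma> \<mu> *v z)) + (of_real m * h) *s z - h *s nonlinearity \<gamma> z"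
  shows "cinner f V = \<i> * ((c 0 + c 1) * cinner e z
           + h * (- \<i> * m * cinner f z + 2 * \<i> * (cmod (cinner f z))\<^sup>2 * cinner e z))"
    and "cinner e V = \<i> * ((c 0 - c 1) * cinner f z
           + h * (- \<i> * m * cinner e z + 2 * \<i> * (cmod (cinner e z))\<^sup>2 * cinner f z))"
proof -
  have lt2: "{..<2::nat} = {0, 1}" by auto
  show "cinner f V = \<i> * ((c 0 + c 1) * cinner e z
           + h * (- \<i> * m * cinner f z + 2 * \<i> * (cmod (cinner f z))\<^sup>2 * cinner e z))"
    unfolding V_def lt2
    by (simp add: cinner_simps cinner_nonlinearity g0_adj g1_adj g0e g0f g1e g1f algebra_simps del: One_nat_def)
  show "cinner e V = \<i> * ((c 0 - c 1) * cinner f z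
           + h * (- \<i> * m * cinner e z + 2 * \<i> * (cmod (cinner e z))\<^sup>2 * cinner f z))"
    unfolding V_def lt2
    by (simp add: cinner_simps cinner_nonlinearity g0_adj g1_adj g0e g0f g1e g1f algebra_simps del: One_nat_def)
qed

end

section \<open>Smooth bump functions\<close>

definition smooth_family :: "(nat \<Rightarrow> real \<Rightarrow> real) \<Rightarrow> bool" where
  "smooth_family D \<longleftrightarrow> (\<forall>n x. (D n has_real_derivative D (Suc n) x) (at x))"

definition compactly_supported :: "(real \<Rightarrow> real) \<Rightarrow> bool" where
  "compactly_supported f \<longleftrightarrow> (\<exists>R. \<forall>x. \<bar>x\<bar> > R \<longrightarrow> f x = 0)"

lemma smooth_familyD: "smooth_family D \<Longrightarrow> (D n has_real_derivative D (Suc n) x) (at x)"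
  by (simp add: smooth_family_def)

lemma smooth_family_continuous: "smooth_family D \<Longrightarrow> continuous_on S (D n)"
  by (meson DERIV_isCont continuous_at_imp_continuous_on smooth_familyD)

lemma leibniz_rule_family:
  fixes p q :: "nat \<Rightarrow> real \<Rightarrow> real"
  assumes p: "\<And>n. (p n has_real_derivative p (Suc n) x) (at x)"
    and q: "\<And>n. (q n has_real_derivative q (Suc n) x) (at x)"
  shows "((\<lambda>x. \<Sum>k\<le>n. real (n choose k) * p k x * q (n - k) x) has_real_derivative
          (\<Sum>k\<le>Suc n. real (Suc n choose k) * p k x * q (Suc n - k) x)) (at x)"
proof -
  have "((\<lambda>x. \<Sum>k\<le>n. real (n choose k) * p k x * q (n - k) x) has_real_derivative
     (\<Sum>k\<le>n. real (n choose k) * (p (Suc k) x * q (n - k) x + p k x * q (Suc (n - k)) x))) (at x)"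
    by (rule DERIV_sum) (auto intro!: derivative_eq_intros p q simp: algebra_simps)
  also have "(\<Sum>k\<le>n. real (n choose k) * (p (Suc k) x * q (n - k) x + p k x * q (Suc (n - k)) x))
     = (\<Sum>k\<le>n. real (n choose k) * p (Suc k) x * q (n - k) x) + (\<Sum>k\<le>n. real (n choose k) * p k x * q (Suc n - k) x)"
    by (simp add: sum.distrib[symmetric] distrib_left mult.assoc Suc_diff_le)
  also have "(\<Sum>k\<le>n. real (n choose k) * p k x * q (Suc n - k) x)
     = (\<Sum>k\<le>Suc n. real (n choose k) * p k x * q (Suc n - k) x)"
    by (simp add: binomial_eq_0)
  also have "\<dots> = p 0 x * q (Suc n) x + (\<Sum>k\<le>n. real (n choose Suc k) * p (Suc k) x * q (n - k) x)"
    by (subst sum.atMost_Suc_shift) simp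
  also have "(\<Sum>k\<le>n. real (n choose k) * p (Suc k) x * q (n - k) x) +
      (p 0 x * q (Suc n) x + (\<Sum>k\<le>n. real (n choose Suc k) * p (Suc k) x * q (n - k) x))
    = (\<Sum>k\<le>Suc n. real (Suc n choose k) * p k x * q (Suc n - k) x)"
    by (simp only: sum.atMost_Suc_shift[of _ n]) (simp add: sum.distrib[symmetric] algebra_simps)
  finally show ?thesis .
qed

text \<open>The derivatives of \<open>exp (- 1 / x)\<close> are polynomials in \<open>1 / x\<close> times the function itself.\<close>

primrec flat_poly :: "nat \<Rightarrow> real poly" where
  "flat_poly 0 = 1"
| "flat_poly (Suc n) = [:0, 0, 1:] * (flat_poly n - pderiv (flat_poly n))"

definition exp_flat :: "nat \<Rightarrow> real \<Rightarrow> real" where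
  "exp_flat n x = (if x > 0 then poly (flat_poly n) (1 / x) * exp (- (1 / x)) else 0)"

lemma poly_times_exp_minus_tendsto_0: "((\<lambda>y. poly p y * exp (- y)) \<longlongrightarrow> (0::real)) at_top"
proof -
  have "((\<lambda>y. \<Sum>i\<le>degree p. coeff p i * (y ^ i / exp y)) \<longlongrightarrow> (\<Sum>i\<le>degree p. coeff p i * 0)) at_top"
    by (intro tendsto_intros tendsto_power_div_exp_0)
  then show ?thesis
    by (simp add: poly_altdef sum_distrib_left exp_minus field_class.field_divide_inverse mult_ac)
qed

lemma smooth_family_exp_flat: "smooth_family exp_flat"
  unfolding smooth_family_def
proof safe
  fix n :: nat and x :: real
  consider "x > 0" | "x < 0" | "x = 0" by linarith
  then show "(exp_flat n has_real_derivative exp_flat (Suc n) x) (at x)"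
  proof cases
    case 1
    have "((\<lambda>x. poly (flat_poly n) (1 / x) * exp (- (1 / x))) has_real_derivative exp_flat (Suc n) x) (at x)"
      using 1 by (auto intro!: derivative_eq_intros DERIV_chain'[OF _ poly_DERIV]
          simp: exp_flat_def field_simps power2_eq_square)
    then show ?thesis
      by (rule has_field_derivative_transform_within_open[where S = "{0<..}"]) (use 1 in \<open>auto simp: exp_flat_def\<close>)
  next
    case 2
    have "((\<lambda>x. 0) has_real_derivative exp_flat (Suc n) x) (at x)"
      using 2 by (auto simp: exp_flat_def)
    then show ?thesis
      by (rule has_field_derivative_transform_within_open[where S = "{..<0}"]) (use 2 in \<open>auto simp: exp_flat_def\<close>)
  next
    case 3
    have "((\<lambda>h. exp_flat n h / h) \<longlongrightarrow> 0) (at_right 0)"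
    proof -
      have "((\<lambda>h. poly ([:0, 1:] * flat_poly n) (inverse h) * exp (- (inverse h))) \<longlongrightarrow> 0) (at_right 0)"
        by (rule filterlim_compose[OF poly_times_exp_minus_tendsto_0 filterlim_inverse_at_top_right])
      then show ?thesis
        by (rule Lim_transform_eventually)
           (auto simp: eventually_at_right_field exp_flat_def divide_simps intro!: exI[of _ 1])
    qed
    moreover have "((\<lambda>h. exp_flat n h / h) \<longlongrightarrow> 0) (at_left 0)"
      by (rule Lim_transform_eventually[OF tendsto_const])
         (auto simp: eventually_at_left_field exp_flat_def intro!: exI[of _ "-1"])
    ultimately have "((\<lambda>h. exp_flat n h / h) \<longlongrightarrow> 0) (at 0)"
      by (simp add: filterlim_split_at)
    then show ?thesis
      using 3 by (simp add: DERIV_def) (simp add: exp_flat_def)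
  qed
qed

text \<open>The \<open>n\<close>-th derivative of \<open>exp_flat 0 (1 + z) * exp_flat 0 (1 - z)\<close> at \<open>z = (x - y) / \<delta>\<close>, by the Leibniz
  rule.\<close>

definition bump :: "real \<Rightarrow> real \<Rightarrow> nat \<Rightarrow> real \<Rightarrow> real" where
  "bump y \<delta> n x = (1 / \<delta>) ^ n * (\<Sum>k\<le>n. real (n choose k) * exp_flat k (1 + (x - y) / \<delta>) *
     ((- 1) ^ (n - k) * exp_flat (n - k) (1 - (x - y) / \<delta>)))"

lemma smooth_family_bump: "smooth_family (bump y \<delta>)"
  unfolding smooth_family_def
proof safe
  fix n x
  define z where "z = (x - y) / \<delta>"
  define L where "L n z = (\<Sum>k\<le>n. real (n choose k) * exp_flat k (1 + z) * ((- 1) ^ (n - k) * exp_flat (n - k) (1 - z)))" for n z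
  have 1: "((\<lambda>z. exp_flat k (1 + z)) has_real_derivative exp_flat (Suc k) (1 + z)) (at z)" for k
  proof -
    have "((\<lambda>z. 1 + z) has_real_derivative 1) (at z)" by (auto intro!: derivative_eq_intros)
    from DERIV_chain'[OF this smooth_familyD[OF smooth_family_exp_flat]] show ?thesis by simp
  qed
  have 2: "((\<lambda>z. (-1) ^ k * exp_flat k (1 - z)) has_real_derivative (-1) ^ Suc k * exp_flat (Suc k) (1 - z)) (at z)" for k
  proof -
    have "((\<lambda>z. exp_flat k (1 - z)) has_real_derivative exp_flat (Suc k) (1 - z) * (- 1)) (at z)"
    proof -
      have "((\<lambda>z. 1 - z) has_real_derivative - 1) (at z)" by (auto intro!: derivative_eq_intros)
      from DERIV_chain'[OF this smooth_familyD[OF smooth_family_exp_flat]] show ?thesis by simp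
    qed
    from DERIV_cmult[OF this, of "(-1)^k"] show ?thesis by simp
  qed
  have L: "(L n has_real_derivative L (Suc n) z) (at z)"
    unfolding L_def using leibniz_rule_family[of "\<lambda>k z. exp_flat k (1 + z)" z "\<lambda>k z. (-1) ^ k * exp_flat k (1 - z)" n, OF 1 2] .
  have "((\<lambda>x. (x - y) / \<delta>) has_real_derivative 1 / \<delta>) (at x)"
    by (rule DERIV_cdivide) (auto intro!: derivative_eq_intros)
  from DERIV_cmult[OF DERIV_chain'[OF this, of "L n" "L (Suc n) z"], of "(1 / \<delta>) ^ n"] L
  show "(bump y \<delta> n has_real_derivative bump y \<delta> (Suc n) x) (at x)"
    by (cases "\<delta> = 0") (simp_all add: bump_def[abs_def] L_def z_def mult_ac)
qed

lemma bump_pos: "\<delta> > 0 \<Longrightarrow> \<bar>x - y\<bar> < \<delta> \<Longrightarrow> bump y \<delta> 0 x > 0"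
  by (auto simp: bump_def exp_flat_def abs_if field_simps intro!: mult_pos_pos split: if_splits)

lemma bump_zero: "\<delta> > 0 \<Longrightarrow> \<bar>x - y\<bar> \<ge> \<delta> \<Longrightarrow> bump y \<delta> 0 x = 0"
  by (auto simp: bump_def exp_flat_def abs_if field_simps split: if_splits)

lemma bump_nonneg: "\<delta> > 0 \<Longrightarrow> bump y \<delta> 0 x \<ge> 0"
  using bump_pos[of \<delta> x y] bump_zero[of \<delta> x y] by (cases "\<bar>x - y\<bar> < \<delta>") auto

lemma bump_translate: "bump y \<delta> n (x + z) = bump (y - z) \<delta> n x"
  by (simp add: bump_def algebra_simps)

lemma bump_compactly_supported: "\<delta> > 0 \<Longrightarrow> compactly_supported (bump y \<delta> 0)"
  unfolding compactly_supported_def by (rule exI[of _ "\<bar>y\<bar> + \<delta>"]) (auto intro!: bump_zero)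

lemma smooth_family_support:
  assumes D: "smooth_family D" and z: "\<And>x. \<bar>x\<bar> > R \<Longrightarrow> D 0 x = 0"
  shows "\<bar>x\<bar> > R \<Longrightarrow> D n x = 0"
proof (induction n arbitrary: x)
  case 0 then show ?case by (rule z)
next
  case (Suc n)
  have "((\<lambda>x. 0) has_real_derivative D (Suc n) x) (at x)"
  proof (rule has_field_derivative_transform_within_open[OF smooth_familyD[OF D]])
    show "open {x. \<bar>x\<bar> > R}" by (intro open_Collect_less continuous_intros)
  qed (use Suc in auto)
  then show ?case by (rule DERIV_unique[OF _ DERIV_const])
qed

lemma compactly_supported_family:
  assumes "smooth_family A" "compactly_supported (A 0)"
  shows "\<exists>R. \<forall>n x. \<bar>x\<bar> > R \<longrightarrow> A n x = 0"
proof -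
  obtain R where "\<And>x. \<bar>x\<bar> > R \<Longrightarrow> A 0 x = 0" using assms(2) by (auto simp: compactly_supported_def)
  then have "\<bar>x\<bar> > R \<Longrightarrow> A n x = 0" for n x by (rule smooth_family_support[OF assms(1)])
  then show ?thesis by blast
qed

section \<open>Integrals of compactly supported functions\<close>

lemma LINT_eq_integral_of_support:
  fixes f :: "real \<Rightarrow> 'a::euclidean_space"
  assumes c: "continuous_on UNIV f" and z: "\<And>x. \<bar>x\<bar> > R \<Longrightarrow> f x = 0"
  shows "integrable lborel f" "(LINT x|lborel. f x) = integral {-R..R} f"
proof -
  have eq: "(\<lambda>x. indicator {-R..R} x *\<^sub>R f x) = f"
    using z by (auto simp: indicator_def fun_eq_iff abs_if)
  have s: "set_integrable lborel {-R..R} f"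
    by (rule borel_integrable_atLeastAtMost') (rule continuous_on_subset[OF c], simp)
  show "integrable lborel f" using s eq by (simp add: set_integrable_def)
  show "(LINT x|lborel. f x) = integral {-R..R} f"
    using set_borel_integral_eq_integral(2)[OF s] eq by (simp add: set_lebesgue_integral_def)
qed

text \<open>Pairing with \<open>h y\<close> makes the integrand positive near \<open>y\<close> unless \<open>h y = 0\<close>.\<close>

lemma zero_of_bump_integrals:
  fixes h :: "real \<Rightarrow> 'a::euclidean_space"
  assumes c: "continuous_on UNIV h"
    and z: "\<And>\<delta>. \<delta> > 0 \<Longrightarrow> (LINT x|lborel. bump y \<delta> 0 x *\<^sub>R h x) = 0"
  shows "h y = 0"
proof (rule ccontr)
  assume nz: "h y \<noteq> 0"
  define r where "r x = h y \<bullet> h x" for x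
  have "r y > 0" using nz by (simp add: r_def)
  moreover have cr: "continuous_on UNIV r" unfolding r_def using c by (intro continuous_intros)
  then have "isCont r y" by (simp add: continuous_on_eq_continuous_at)
  ultimately have "\<forall>\<^sub>F x in nhds y. r x > 0"
    by (metis isContD order_tendstoD(1) tendsto_at_iff_tendsto_nhds)
  then obtain \<delta> where \<delta>: "\<delta> > 0" "\<And>x. \<bar>x - y\<bar> < \<delta> \<Longrightarrow> r x > 0"
    by (auto simp: eventually_nhds_metric dist_real_def)
  have cf: "continuous_on UNIV (\<lambda>x. bump y \<delta> 0 x *\<^sub>R h x)"
    by (intro continuous_intros c smooth_family_continuous[OF smooth_family_bump])
  have supp: "bump y \<delta> 0 x *\<^sub>R h x = 0" if "\<bar>x\<bar> > \<bar>y\<bar> + \<delta>" for x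
    using that \<delta>(1) by (auto intro!: bump_zero)
  note i = LINT_eq_integral_of_support(1)[OF cf supp]
  have "(LINT x|lborel. h y \<bullet> (bump y \<delta> 0 x *\<^sub>R h x)) = h y \<bullet> (LINT x|lborel. bump y \<delta> 0 x *\<^sub>R h x)"
    using i by (intro integral_inner_right) auto
  then have I0: "(LINT x|lborel. bump y \<delta> 0 x * r x) = 0"
    by (simp add: z[OF \<delta>(1)] r_def)
  have I1: "integrable lborel (\<lambda>x. bump y \<delta> 0 x * r x)"
    using integrable_inner_right[of "h y" lborel, OF i] by (simp add: r_def)
  have nn: "bump y \<delta> 0 x * r x \<ge> 0" for x
    using bump_nonneg[OF \<delta>(1), of y x] bump_zero[OF \<delta>(1), of x y] \<delta>(2)[of x]
    by (cases "\<bar>x - y\<bar> < \<delta>") auto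
  have "AE x in lborel. bump y \<delta> 0 x * r x = 0"
    using I0 integral_nonneg_eq_0_iff_AE[OF I1] nn by auto
  then have "AE x in lborel. x \<notin> {y - \<delta> <..< y + \<delta>}"
  proof eventually_elim
    case (elim x)
    show ?case
    proof
      assume "x \<in> {y - \<delta> <..< y + \<delta>}"
      then have "\<bar>x - y\<bar> < \<delta>" by auto
      then show False using elim bump_pos[OF \<delta>(1)] \<delta>(2) by (metis less_irrefl mult_pos_pos)
    qed
  qed
  then have "emeasure lborel {y - \<delta> <..< y + \<delta>} = 0"
    by (subst (asm) AE_iff_measurable[where N = "{y - \<delta> <..< y + \<delta>}"]) auto
  then show False using \<delta>(1) by simp
qed

lemma continuous_on_compose_2:
  assumes "continuous_on UNIV (\<lambda>(t, x). w t x)" "continuous_on S f" "continuous_on S g"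
  shows "continuous_on S (\<lambda>z. w (f z) (g z))"
proof -
  have "continuous_on S (\<lambda>z. (f z, g z))" using assms by (intro continuous_intros)
  from continuous_on_compose2[OF assms(1) this] show ?thesis by simp
qed

lemma continuous_has_antiderivative:
  fixes f :: "real \<Rightarrow> 'a::euclidean_space"
  assumes "continuous_on UNIV f"
  shows "\<exists>F. \<forall>x. (F has_vector_derivative f x) (at x)"
proof -
  have "\<exists>F. \<forall>x::real. -\<infinity> < ereal x \<longrightarrow> ereal x < \<infinity> \<longrightarrow> (F has_vector_derivative f x) (at x)"
    using einterval_antiderivative[of "-\<infinity>" "\<infinity>" f] assms
    by (auto simp: continuous_on_eq_continuous_at)
  then show ?thesis by simp
qed


section \<open>From the weak transport equation to derivatives along characteristics\<close>

text \<open>The antiderivative of one bump does not return to zero; the difference of two translates has mean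
  zero and therefore has a compactly supported antiderivative.\<close>

lemma bump_antiderivative_difference:
  assumes "\<delta> > 0"
  shows "\<exists>A. smooth_family A \<and> compactly_supported (A 0) \<and> (\<forall>t. A 1 t = bump t1 \<delta> 0 t - bump t2 \<delta> 0 t)"
proof -
  obtain I where I: "\<And>x. (I has_real_derivative bump 0 \<delta> 0 x) (at x)"
    using continuous_has_antiderivative[OF smooth_family_continuous[OF smooth_family_bump, of UNIV 0 \<delta> 0]]
    by (auto simp: has_real_derivative_iff_has_vector_derivative)
  have cI: "continuous_on S I" for S
    using I by (intro DERIV_continuous_on) (auto intro: has_field_derivative_at_within)
  have flat: "(I has_real_derivative 0) (at x)" if "\<bar>x\<bar> \<ge> \<delta>" for x
    using I[of x] bump_zero[OF assms, of x 0] that by simp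
  have right: "I x = I \<delta>" if "x \<ge> \<delta>" for x
  proof (cases "x = \<delta>")
    case False
    with that have "\<delta> < x" by simp
    then show ?thesis
      by (rule DERIV_isconst_end[OF _ cI]) (use assms in \<open>auto intro!: flat\<close>)
  qed simp
  have left: "I x = I (- \<delta>)" if "x \<le> - \<delta>" for x
  proof (cases "x = - \<delta>")
    case False
    with that have "x < - \<delta>" by simp
    then show ?thesis
      by (rule DERIV_isconst_end[OF _ cI, symmetric]) (use assms in \<open>auto intro!: flat\<close>)
  qed simp
  define A where "A = (\<lambda>n t. case n of 0 \<Rightarrow> I (t - t1) - I (t - t2) | Suc n \<Rightarrow> bump t1 \<delta> n t - bump t2 \<delta> n t)"
  have "smooth_family A"
    unfolding smooth_family_def
  proof safe
    fix n t
    show "(A n has_real_derivative A (Suc n) t) (at t)"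
    proof (cases n)
      case 0
      have "((\<lambda>t. I (t - s)) has_real_derivative bump s \<delta> 0 t) (at t)" for s
      proof -
        have "((\<lambda>t. t - s) has_real_derivative 1) (at t)" by (auto intro!: derivative_eq_intros)
        from DERIV_chain'[OF this I] show ?thesis using bump_translate[of 0 \<delta> 0 t "- s"] by simp
      qed
      then show ?thesis unfolding A_def 0 by (auto intro!: derivative_eq_intros)
    next
      case (Suc k)
      show ?thesis unfolding A_def Suc nat.case
        by (intro DERIV_diff smooth_familyD smooth_family_bump)
    qed
  qed
  moreover have "compactly_supported (A 0)"
    unfolding compactly_supported_def
  proof (intro exI allI impI)
    fix t assume t: "\<bar>t\<bar> > \<bar>t1\<bar> + \<bar>t2\<bar> + \<delta>"
    show "A 0 t = 0"
    proof (cases "t > 0")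
      case True
      then have "t - t1 \<ge> \<delta>" "t - t2 \<ge> \<delta>" using t by auto
      then show ?thesis using right[of "t - t1"] right[of "t - t2"] by (simp add: A_def)
    next
      case False
      then have "t - t1 \<le> - \<delta>" "t - t2 \<le> - \<delta>" using t by auto
      then show ?thesis using left[of "t - t1"] left[of "t - t2"] by (simp add: A_def)
    qed
  qed
  ultimately show ?thesis
    by (intro exI[of _ A]) (auto simp: A_def)
qed

text \<open>Subtraction of an antiderivative of \<open>Q\<close> reduces the claim to \<open>Q = 0\<close>. Testing with an antiderivative
  of the difference of two bumps, centred at \<open>t1\<close> and \<open>t2\<close>, then shows that the function takes the same
  value at \<open>t1\<close> and \<open>t2\<close>.\<close>

lemma derivative_of_weak_derivative:
  fixes W Q :: "real \<Rightarrow> complex"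
  assumes cW: "continuous_on UNIV W" and cQ: "continuous_on UNIV Q"
    and weak: "\<And>A. smooth_family A \<Longrightarrow> compactly_supported (A 0) \<Longrightarrow>
       (LINT t|lborel. A 1 t *\<^sub>R W t + A 0 t *\<^sub>R Q t) = 0"
  shows "(W has_vector_derivative Q t) (at t)"
proof -
  obtain Y where Y: "\<And>x. (Y has_vector_derivative Q x) (at x)"
    using continuous_has_antiderivative[OF cQ] by blast
  have cY: "continuous_on UNIV Y"
    using Y by (auto intro!: continuous_at_imp_continuous_on has_vector_derivative_continuous)
  define Z where "Z t = W t - Y t" for t
  have cZ: "continuous_on UNIV Z" unfolding Z_def by (intro continuous_intros cW cY)
  have weakZ: "(LINT t|lborel. A 1 t *\<^sub>R Z t) = 0"
    if A: "smooth_family A" "compactly_supported (A 0)" for A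
  proof -
    obtain R where R: "\<And>n x. \<bar>x\<bar> > R \<Longrightarrow> A n x = 0" using compactly_supported_family[OF A] by blast
    \<comment> \<open>\<open>A\<close> vanishes beyond \<open>R\<close>; with \<open>S > R\<close> it also vanishes at the end points \<open>\<plusminus>S\<close>.\<close>
    define S where "S = \<bar>R\<bar> + 1"
    have S: "A n x = 0" if "\<bar>x\<bar> \<ge> S" for n x using R[of x n] that by (auto simp: S_def)
    have AS: "A 0 S = 0" "A 0 (- S) = 0" by (simp_all add: S)
    note cA = smooth_family_continuous[OF A(1)]
    have c1: "continuous_on UNIV (\<lambda>t. A 1 t *\<^sub>R Z t)" by (intro continuous_intros cA cZ)
    have c2: "continuous_on UNIV (\<lambda>t. A 1 t *\<^sub>R Y t + A 0 t *\<^sub>R Q t)" by (intro continuous_intros cA cY cQ)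
    have z1: "A 1 t *\<^sub>R Z t = 0" if "\<bar>t\<bar> > S" for t using S that by simp
    have z2: "A 1 t *\<^sub>R Y t + A 0 t *\<^sub>R Q t = 0" if "\<bar>t\<bar> > S" for t using S that by simp
    note i1 = LINT_eq_integral_of_support[OF c1 z1] and i2 = LINT_eq_integral_of_support[OF c2 z2]
    have ftc: "((\<lambda>t. A 1 t *\<^sub>R Y t + A 0 t *\<^sub>R Q t) has_integral (A 0 S *\<^sub>R Y S - A 0 (- S) *\<^sub>R Y (- S))) {-S..S}"
    proof (rule fundamental_theorem_of_calculus)
      show "((\<lambda>t. A 0 t *\<^sub>R Y t) has_vector_derivative A 1 t *\<^sub>R Y t + A 0 t *\<^sub>R Q t) (at t within {-S..S})" for t
        using has_vector_derivative_scaleR[OF smooth_familyD[OF A(1), of 0 t] Y[of t]]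
        by (simp add: add.commute has_vector_derivative_at_within)
    qed (simp add: S_def)
    have "(LINT t|lborel. A 1 t *\<^sub>R Y t + A 0 t *\<^sub>R Q t) = 0"
      using i2(2) integral_unique[OF ftc] AS by simp
    moreover have "(LINT t|lborel. A 1 t *\<^sub>R W t + A 0 t *\<^sub>R Q t)
        = (LINT t|lborel. A 1 t *\<^sub>R Z t) + (LINT t|lborel. A 1 t *\<^sub>R Y t + A 0 t *\<^sub>R Q t)"
    proof -
      have eq: "A 1 t *\<^sub>R W t + A 0 t *\<^sub>R Q t = A 1 t *\<^sub>R Z t + (A 1 t *\<^sub>R Y t + A 0 t *\<^sub>R Q t)" for t
        by (simp add: Z_def scaleR_diff_right)
      show ?thesis unfolding eq by (rule Bochner_Integration.integral_add[OF i1(1) i2(1)])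
    qed
    ultimately show ?thesis using weak[OF A] by simp
  qed
  have const: "Z t1 = Z t2" for t1 t2
  proof -
    have c: "continuous_on UNIV (\<lambda>s. Z (s + t))" for t
      by (rule continuous_on_compose2[OF cZ]) (auto intro!: continuous_intros)
    have "Z (0 + t1) - Z (0 + t2) = 0"
    proof (rule zero_of_bump_integrals[where h = "\<lambda>s. Z (s + t1) - Z (s + t2)" and y = 0])
      show "continuous_on UNIV (\<lambda>s. Z (s + t1) - Z (s + t2))" by (intro continuous_intros c)
      fix \<delta> :: real assume d: "\<delta> > 0"
      have i: "integrable lborel (\<lambda>s. bump t' \<delta> 0 s *\<^sub>R Z (s + t))" for t t'
        by (rule LINT_eq_integral_of_support(1)[where R = "\<bar>t'\<bar> + \<delta>"])
           (use d in \<open>auto intro!: continuous_intros c smooth_family_continuous[OF smooth_family_bump] bump_zero\<close>)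
      have sh: "(LINT s|lborel. bump 0 \<delta> 0 s *\<^sub>R Z (s + t)) = (LINT s|lborel. bump t \<delta> 0 s *\<^sub>R Z s)" for t
        using lborel_integral_real_affine[of 1 "\<lambda>s. bump t \<delta> 0 s *\<^sub>R Z s" t]
          bump_translate[of t \<delta> 0 _ t] by (simp add: add.commute)
      obtain A where A: "smooth_family A" "compactly_supported (A 0)" "\<And>t. A 1 t = bump t1 \<delta> 0 t - bump t2 \<delta> 0 t"
        using bump_antiderivative_difference[OF d] by blast
      have "(LINT s|lborel. bump 0 \<delta> 0 s *\<^sub>R (Z (s + t1) - Z (s + t2)))
          = (LINT s|lborel. bump t1 \<delta> 0 s *\<^sub>R Z s) - (LINT s|lborel. bump t2 \<delta> 0 s *\<^sub>R Z s)"
        by (simp add: scaleR_diff_right Bochner_Integration.integral_diff[OF i i] sh)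
      also have "\<dots> = (LINT t|lborel. A 1 t *\<^sub>R Z t)"
        using Bochner_Integration.integral_diff[OF i[of t1 0] i[of t2 0]] by (simp only: A(3) scaleR_diff_left add_0_right)
      finally show "(LINT s|lborel. bump 0 \<delta> 0 s *\<^sub>R (Z (s + t1) - Z (s + t2))) = 0"
        using weakZ[OF A(1,2)] by simp
    qed
    then show ?thesis by simp
  qed
  have "W = (\<lambda>t. Z 0 + Y t)"
    using const[of _ 0] by (auto simp: Z_def fun_eq_iff algebra_simps)
  then show ?thesis
    using has_vector_derivative_add[OF has_vector_derivative_const[of "Z 0"] Y[of t]] by simp
qed

text \<open>In the coordinates \<open>t\<close> and \<open>y = x - \<kappa>t\<close> the equation contains no derivative in \<open>y\<close>, so bumps in \<open>y\<close>
  localise it to single characteristics.\<close>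

lemma transport_of_weak:
  fixes w P :: "real \<Rightarrow> real \<Rightarrow> complex" and \<kappa> :: real
  assumes cw: "continuous_on UNIV (\<lambda>(t, x). w t x)" and cP: "continuous_on UNIV (\<lambda>(t, x). P t x)"
    and weak: "\<And>A B. smooth_family A \<Longrightarrow> smooth_family B \<Longrightarrow> compactly_supported (A 0) \<Longrightarrow> compactly_supported (B 0) \<Longrightarrow>
       (LINT t|lborel. LINT x|lborel. B 0 (x - \<kappa> * t) *\<^sub>R (A 1 t *\<^sub>R w t x + A 0 t *\<^sub>R P t x)) = 0"
  shows "((\<lambda>s. w s (y + \<kappa> * s)) has_vector_derivative P t (y + \<kappa> * t)) (at t)"
proof -
  have cont: "continuous_on UNIV (\<lambda>s. w s (y + \<kappa> * s))" "continuous_on UNIV (\<lambda>s. P s (y + \<kappa> * s))"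
    by (intro continuous_on_compose_2[OF cw] continuous_on_compose_2[OF cP] continuous_intros)+
  have weak_char: "(LINT t|lborel. A 1 t *\<^sub>R w t (y + \<kappa> * t) + A 0 t *\<^sub>R P t (y + \<kappa> * t)) = 0"
    if A: "smooth_family A" "compactly_supported (A 0)" for A
  proof -
  obtain R where R: "\<And>n x. \<bar>x\<bar> > R \<Longrightarrow> A n x = 0" using compactly_supported_family[OF A] by blast
  note cA = smooth_family_continuous[OF A(1)]
  define G where "G t y = A 1 t *\<^sub>R w t (y + \<kappa> * t) + A 0 t *\<^sub>R P t (y + \<kappa> * t)" for t y
  have cG: "continuous_on S (\<lambda>z. G (f z) (g z))" if "continuous_on S f" "continuous_on S g" for S and f g :: "'z::topological_space \<Rightarrow> real"
    unfolding G_def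
    by (intro continuous_intros continuous_on_compose_2[OF cw] continuous_on_compose_2[OF cP] that
          continuous_on_compose2[OF cA[of UNIV]]) auto
  have zG: "G t y = 0" if "\<bar>t\<bar> > R" for t y using R that by (simp add: G_def)
  define H where "H y = integral {-R..R} (\<lambda>t. G t y)" for y
  have HL: "H y = (LINT t|lborel. G t y)" for y
    unfolding H_def
    by (rule LINT_eq_integral_of_support(2)[symmetric, where f = "\<lambda>t. G t y"])
       (use cG[OF continuous_on_id continuous_on_const, of UNIV y] in simp, rule zG)
  have "H y = 0"
  proof (rule zero_of_bump_integrals[where h = H and y = y])
    have "continuous_on UNIV (\<lambda>y. integral (cbox (-R) R) (\<lambda>t. G t y))"
      by (rule integral_continuous_on_param)
         (use cG[OF continuous_on_snd[OF continuous_on_id] continuous_on_fst[OF continuous_on_id]] in \<open>simp add: case_prod_beta'\<close>)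
    then show cH: "continuous_on UNIV H" by (simp add: H_def[abs_def])
    fix \<delta> :: real assume d: "\<delta> > 0"
    define B where "B = bump y \<delta>"
    note cB = smooth_family_continuous[OF smooth_family_bump, of _ y \<delta> 0, folded B_def]
    define r where "r = \<bar>y\<bar> + \<delta>"
    have zB: "B 0 x = 0" if "\<bar>x\<bar> > r" for x using that d by (auto simp: B_def r_def intro!: bump_zero)
    have cBG: "continuous_on S (\<lambda>z. B 0 (g z) *\<^sub>R G (f z) (g z))" if "continuous_on S f" "continuous_on S g" for S and f g :: "'z::topological_space \<Rightarrow> real"
      by (intro continuous_intros cG that continuous_on_compose2[OF cB[of UNIV]]) auto
    have "(LINT x|lborel. B 0 x *\<^sub>R H x) = integral {-r..r} (\<lambda>x. B 0 x *\<^sub>R H x)"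
      by (rule LINT_eq_integral_of_support(2)) (auto intro!: continuous_intros cB cH simp: zB)
    also have "\<dots> = integral {-r..r} (\<lambda>x. integral {-R..R} (\<lambda>t. B 0 x *\<^sub>R G t x))"
      by (simp add: H_def)
    also have "\<dots> = integral {-R..R} (\<lambda>t. integral {-r..r} (\<lambda>x. B 0 x *\<^sub>R G t x))"
      using integral_swap_continuous[of "-r" "-R" r R "\<lambda>x t. B 0 x *\<^sub>R G t x"]
      by (simp add: case_prod_beta' cBG[OF continuous_on_snd[OF continuous_on_id] continuous_on_fst[OF continuous_on_id]])
    also have "\<dots> = (LINT t|lborel. integral {-r..r} (\<lambda>x. B 0 x *\<^sub>R G t x))"
    proof (rule LINT_eq_integral_of_support(2)[symmetric])
      have "continuous_on UNIV (\<lambda>t. integral (cbox (-r) r) (\<lambda>x. B 0 x *\<^sub>R G t x))"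
        by (rule integral_continuous_on_param)
           (use cBG[OF continuous_on_fst[OF continuous_on_id] continuous_on_snd[OF continuous_on_id]] in \<open>simp add: case_prod_beta'\<close>)
      then show "continuous_on UNIV (\<lambda>t. integral {-r..r} (\<lambda>x. B 0 x *\<^sub>R G t x))" by simp
    qed (simp add: zG)
    also have "\<dots> = (LINT t|lborel. LINT x|lborel. B 0 x *\<^sub>R G t x)"
    proof (rule Bochner_Integration.integral_cong[OF refl])
      fix t
      show "integral {-r..r} (\<lambda>x. B 0 x *\<^sub>R G t x) = (LINT x|lborel. B 0 x *\<^sub>R G t x)"
        by (rule LINT_eq_integral_of_support(2)[symmetric, where f = "\<lambda>x. B 0 x *\<^sub>R G t x"])
           (use cBG[OF continuous_on_const continuous_on_id, of UNIV t] in simp, simp add: zB)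
    qed
    also have "\<dots> = (LINT t|lborel. LINT x|lborel. B 0 (x - \<kappa> * t) *\<^sub>R (A 1 t *\<^sub>R w t x + A 0 t *\<^sub>R P t x))"
    proof (rule Bochner_Integration.integral_cong[OF refl])
      fix t
      show "(LINT x|lborel. B 0 x *\<^sub>R G t x) = (LINT x|lborel. B 0 (x - \<kappa> * t) *\<^sub>R (A 1 t *\<^sub>R w t x + A 0 t *\<^sub>R P t x))"
        using lborel_integral_real_affine[of 1 "\<lambda>x. B 0 (x - \<kappa> * t) *\<^sub>R (A 1 t *\<^sub>R w t x + A 0 t *\<^sub>R P t x)" "\<kappa> * t"]
        by (simp add: G_def add.commute)
    qed
    also have "\<dots> = 0"
      using weak[OF A(1) smooth_family_bump A(2) bump_compactly_supported[OF d]] by (simp add: B_def)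
    finally show "(LINT x|lborel. bump y \<delta> 0 x *\<^sub>R H x) = 0" by (simp add: B_def)
  qed
  then show ?thesis
    by (simp add: HL G_def)
  qed
  show ?thesis
    using derivative_of_weak_derivative[OF cont weak_char] .
qed

text \<open>The operator \<open>\<partial>\<^sub>t + \<kappa>\<partial>\<^sub>x\<close> maps \<open>A(t) B(x - \<kappa>t)\<close> to \<open>A'(t) B(x - \<kappa>t)\<close>.\<close>

lemma characteristic_test_function:
  fixes \<kappa> :: real
  assumes A: "smooth_family A" "compactly_supported (A 0)" and B: "smooth_family B" "compactly_supported (B 0)"
  defines "\<eta> \<equiv> \<lambda>t x. complex_of_real (A 0 t * B 0 (x - \<kappa> * t))"
  shows "\<eta> \<in> test_functions"
    and "partial 0 \<eta> t x = of_real (A 1 t * B 0 (x - \<kappa> * t) - \<kappa> * A 0 t * B 1 (x - \<kappa> * t))"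
    and "partial 1 \<eta> t x = of_real (A 0 t * B 1 (x - \<kappa> * t))"
proof -
  define L where "L i j t x = (\<Sum>k\<le>i. real (i choose k) * A k t * ((- \<kappa>) ^ (i - k) * B (i - k + j) (x - \<kappa> * t)))" for i j t x
  define D where "D i j t x = complex_of_real (L i j t x)" for i j t x
  have D0: "D 0 0 = \<eta>" by (simp add: D_def L_def \<eta>_def fun_eq_iff)
  have Bt: "((\<lambda>t. B n (x - \<kappa> * t)) has_real_derivative (- \<kappa>) * B (Suc n) (x - \<kappa> * t)) (at t)" for n x t
  proof -
    have "((\<lambda>t. x - \<kappa> * t) has_real_derivative - \<kappa>) (at t)" by (auto intro!: derivative_eq_intros)
    from DERIV_chain'[OF this smooth_familyD[OF B(1)]] show ?thesis by (simp add: mult.commute)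
  qed
  have Bx: "((\<lambda>x. B n (x - \<kappa> * t)) has_real_derivative B (Suc n) (x - \<kappa> * t)) (at x)" for n x t
  proof -
    have "((\<lambda>x. x - \<kappa> * t) has_real_derivative 1) (at x)" by (auto intro!: derivative_eq_intros)
    from DERIV_chain'[OF this smooth_familyD[OF B(1)]] show ?thesis by simp
  qed
  have Lt: "((\<lambda>t. L i j t x) has_real_derivative L (Suc i) j t x) (at t)" for i j t x
  proof -
    have q: "((\<lambda>t. (- \<kappa>) ^ k * B (k + j) (x - \<kappa> * t)) has_real_derivative
       (- \<kappa>) ^ Suc k * B (Suc k + j) (x - \<kappa> * t)) (at t)" for k
      using DERIV_cmult[OF Bt[of "k + j" x t], of "(- \<kappa>) ^ k"] by (simp add: mult_ac)
    show ?thesis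
      unfolding L_def
      using leibniz_rule_family[of A t "\<lambda>k t. (- \<kappa>) ^ k * B (k + j) (x - \<kappa> * t)" i, OF smooth_familyD[OF A(1)] q] .
  qed
  have Lx: "((\<lambda>x. L i j t x) has_real_derivative L i (Suc j) t x) (at x)" for i j t x
    unfolding L_def by (intro DERIV_sum DERIV_cmult) (use Bx in simp)
  have Dt: "((\<lambda>t. D i j t x) has_vector_derivative D (Suc i) j t x) (at t)" for i j t x
    unfolding D_def using Lt by (intro has_vector_derivative_of_real) (simp add: has_real_derivative_iff_has_vector_derivative)
  have Dx: "((\<lambda>x. D i j t x) has_vector_derivative D i (Suc j) t x) (at x)" for i j t x
    unfolding D_def using Lx by (intro has_vector_derivative_of_real) (simp add: has_real_derivative_iff_has_vector_derivative)
  have Dc: "continuous_on UNIV (\<lambda>(t, x). D i j t x)" for i j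
    unfolding D_def L_def case_prod_beta'
    by (intro continuous_intros continuous_on_compose2[OF smooth_family_continuous[OF A(1), of UNIV]]
         continuous_on_compose2[OF smooth_family_continuous[OF B(1), of UNIV]]) auto
  obtain R where R: "\<And>x. \<bar>x\<bar> > R \<Longrightarrow> A 0 x = 0" using A(2) by (auto simp: compactly_supported_def)
  obtain r where r: "\<And>x. \<bar>x\<bar> > r \<Longrightarrow> B 0 x = 0" using B(2) by (auto simp: compactly_supported_def)
  have supp: "\<eta> t x = 0" if "\<bar>t\<bar> > \<bar>R\<bar> + \<bar>\<kappa>\<bar> * \<bar>R\<bar> + \<bar>r\<bar> \<or> \<bar>x\<bar> > \<bar>R\<bar> + \<bar>\<kappa>\<bar> * \<bar>R\<bar> + \<bar>r\<bar>" for t x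
  proof (cases "\<bar>t\<bar> > R")
    case False
    then have t: "\<bar>t\<bar> \<le> \<bar>R\<bar>" by simp
    have "\<bar>\<kappa> * t\<bar> \<le> \<bar>\<kappa>\<bar> * \<bar>R\<bar>" using t by (simp add: abs_mult mult_left_mono)
    moreover have "0 \<le> \<bar>\<kappa>\<bar> * \<bar>R\<bar>" by simp
    ultimately have "\<bar>x - \<kappa> * t\<bar> > r" using that t by linarith
    then show ?thesis by (simp add: \<eta>_def r)
  qed (simp add: \<eta>_def R)
  have "(\<exists>D. D 0 0 = \<eta> \<and> (\<forall>i j. continuous_on UNIV (\<lambda>(t, x). D i j t x)) \<and>
        (\<forall>i j t x. ((\<lambda>\<tau>. D i j \<tau> x) has_vector_derivative D (Suc i) j t x) (at t)) \<and>
        (\<forall>i j t x. ((\<lambda>y. D i j t y) has_vector_derivative D i (Suc j) t x) (at x)))"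
    using D0 Dc Dt Dx by (intro exI[of _ D]) auto
  with supp show "\<eta> \<in> test_functions" unfolding test_functions_def by blast
  show "partial 0 \<eta> t x = of_real (A 1 t * B 0 (x - \<kappa> * t) - \<kappa> * A 0 t * B 1 (x - \<kappa> * t))"
    using vector_derivative_at[OF Dt[of 0 0 x t]] unfolding D0
    by (simp add: partial_def D_def L_def algebra_simps)
  show "partial 1 \<eta> t x = of_real (A 0 t * B 1 (x - \<kappa> * t))"
    using vector_derivative_at[OF Dx[of 0 0 t x]] unfolding D0
    by (simp add: partial_def D_def L_def algebra_simps)
qed

section \<open>The Fourier transform of integrable functions\<close>

lemma borel_measurable_exp_i [measurable]:
  "f \<in> borel_measurable M \<Longrightarrow> (\<lambda>x. exp (- \<i> * complex_of_real (f x))) \<in> borel_measurable M"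
  by measurable

lemma norm_exp_minus_i [simp]: "cmod (exp (- (\<i> * complex_of_real r))) = 1"
  by (simp add: norm_exp_eq_Re)

lemma integrable_exp_i_mult:
  fixes \<phi> g :: "real \<Rightarrow> _"
  assumes "integrable lborel \<phi>" "g \<in> borel_measurable lborel"
  shows "integrable lborel (\<lambda>x. exp (- \<i> * complex_of_real (g x)) * \<phi> x)"
  by (rule Bochner_Integration.integrable_bound[OF assms(1)])
     (use assms borel_measurable_integrable[OF assms(1)] in \<open>auto simp: norm_mult\<close>)

lemma norm_fourier_le: "integrable lborel \<phi> \<Longrightarrow> cmod (fourier \<phi> \<xi>) \<le> (LINT x|lborel. cmod (\<phi> x))"
  unfolding fourier_def by (rule order_trans[OF integral_norm_bound]) (simp add: norm_mult)

lemma continuous_fourier: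
  assumes "integrable lborel \<phi>"
  shows "continuous_on S (fourier \<phi>)"
proof -
  have [measurable]: "\<phi> \<in> borel_measurable borel" using borel_measurable_integrable[OF assms] by simp
  have "(\<lambda>n. fourier \<phi> (X n)) \<longlonglongrightarrow> fourier \<phi> \<xi>" if "X \<longlonglongrightarrow> \<xi>" for X \<xi>
    unfolding fourier_def
  proof (rule integral_dominated_convergence[where w = "\<lambda>x. cmod (\<phi> x)"])
    show "AE x in lborel. (\<lambda>n. exp (- \<i> * of_real (x * X n)) * \<phi> x) \<longlonglongrightarrow> exp (- \<i> * of_real (x * \<xi>)) * \<phi> x"
      by (intro AE_I2 tendsto_intros that)
  qed (use assms in \<open>auto simp: norm_mult\<close>)
  then show ?thesis unfolding continuous_on_sequentially by (auto simp: comp_def)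
qed

lemma measurable_fourier [measurable]: "integrable lborel \<phi> \<Longrightarrow> fourier \<phi> \<in> borel_measurable borel"
  by (rule borel_measurable_continuous_onI) (rule continuous_fourier)

lemma integrable_bounded_mult:
  fixes f g :: "real \<Rightarrow> complex"
  assumes f: "integrable lborel f" and g: "g \<in> borel_measurable borel" "\<And>x. cmod (g x) \<le> C"
  shows "integrable lborel (\<lambda>x. g x * f x)"
proof (rule Bochner_Integration.integrable_bound)
  show "integrable lborel (\<lambda>x. C * cmod (f x))" using f by auto
  show "(\<lambda>x. g x * f x) \<in> borel_measurable lborel"
    using g(1) borel_measurable_integrable[OF f] by simp
  show "AE x in lborel. cmod (g x * f x) \<le> norm (C * cmod (f x))"
  proof (rule AE_I2)
    fix x
    have "cmod (g x * f x) \<le> C * cmod (f x)" using g(2)[of x] by (simp add: norm_mult mult_right_mono)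
    then show "cmod (g x * f x) \<le> norm (C * cmod (f x))" by simp
  qed
qed

lemma integrable_fourier_mult:
  assumes f: "integrable lborel f" and g: "integrable lborel g"
  shows "integrable lborel (\<lambda>x. fourier f x * g x)"
  by (rule integrable_bounded_mult[OF g _ norm_fourier_le[OF f]]) (use f in measurable)

text \<open>Both sides are the double integral of \<open>exp (- \<i>xy) f(y) g(x)\<close>.\<close>

lemma fourier_multiplication_formula:
  assumes f: "integrable lborel f" and g: "integrable lborel g"
  shows "(LINT x|lborel. fourier f x * g x) = (LINT x|lborel. f x * fourier g x)"
proof -
  have [measurable]: "f \<in> borel_measurable borel" "g \<in> borel_measurable borel"
    using f g by (auto dest: borel_measurable_integrable)
  have "integrable (lborel \<Otimes>\<^sub>M lborel) (\<lambda>(x, y). exp (- \<i> * of_real (x * y)) * f y * g x)"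
  proof (rule lborel_pair.Fubini_integrable)
    show "(\<lambda>(x, y). exp (- \<i> * of_real (x * y)) * f y * g x) \<in> borel_measurable (lborel \<Otimes>\<^sub>M lborel)"
      by measurable
    have "(\<lambda>x. LINT y|lborel. norm (case (x, y) of (x, y) \<Rightarrow> exp (- \<i> * of_real (x * y)) * f y * g x))
       = (\<lambda>x. (LINT y|lborel. cmod (f y)) * cmod (g x))"
      by (simp add: norm_mult)
    then show "integrable lborel (\<lambda>x. LINT y|lborel. norm (case (x, y) of (x, y) \<Rightarrow> exp (- \<i> * of_real (x * y)) * f y * g x))"
      using g by simp
    show "AE x in lborel. integrable lborel (\<lambda>y. case (x, y) of (x, y) \<Rightarrow> exp (- \<i> * of_real (x * y)) * f y * g x)"
    proof (rule AE_I2)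
      fix x
      have "integrable lborel (\<lambda>y. (exp (- \<i> * of_real (x * y)) * f y) * g x)"
        by (intro integrable_mult_left integrable_exp_i_mult[OF f]) simp
      then show "integrable lborel (\<lambda>y. case (x, y) of (x, y) \<Rightarrow> exp (- \<i> * of_real (x * y)) * f y * g x)" by simp
    qed
  qed
  from lborel_pair.Fubini_integral[OF this]
  have swap: "(LINT y|lborel. LINT x|lborel. exp (- \<i> * of_real (x * y)) * f y * g x)
      = (LINT x|lborel. LINT y|lborel. exp (- \<i> * of_real (x * y)) * f y * g x)" .
  have left: "(LINT y|lborel. exp (- \<i> * of_real (x * y)) * f y * g x) = fourier f x * g x" for x
    unfolding fourier_def by (subst integral_mult_left_zero[symmetric]) (simp add: mult_ac)
  have right: "(LINT x|lborel. exp (- \<i> * of_real (x * y)) * f y * g x) = f y * fourier g y" for y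
    unfolding fourier_def by (subst integral_mult_right_zero[symmetric]) (simp add: mult_ac)
  show ?thesis using swap unfolding left right by (rule sym)
qed

section \<open>Gaussian summability: Plancherel and Parseval\<close>

definition gauss :: "real \<Rightarrow> real" where "gauss x = exp (- x\<^sup>2 / 2)"

lemma gauss_std: "gauss x = sqrt (2 * pi) * std_normal_density x"
  by (simp add: gauss_def std_normal_density_def)

lemma measurable_gauss [measurable]: "gauss \<in> borel_measurable borel"
  unfolding gauss_def[abs_def] by measurable

lemma gauss_pos: "gauss x > 0" and gauss_le_1: "gauss x \<le> 1"
  by (simp_all add: gauss_def)

lemma integrable_gauss: "integrable lborel gauss"
  unfolding gauss_std[abs_def] by (simp add: integrable_normal_density)

lemma integral_gauss: "(LINT x|lborel. gauss x) = sqrt (2 * pi)"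
  unfolding gauss_std[abs_def] by (simp add: integral_normal_density)

lemma fourier_gauss: "fourier (\<lambda>x. of_real (gauss x)) \<xi> = of_real (sqrt (2 * pi) * gauss \<xi>)"
proof -
  have "of_real (gauss \<xi>) = char std_normal_distribution (- \<xi>)"
    by (simp add: char_std_normal_distribution gauss_def)
  also have "\<dots> = (LINT x|lborel. std_normal_density x *\<^sub>R iexp (- \<xi> * x))"
    unfolding char_def by (rule integral_density) auto
  finally have "of_real (gauss \<xi>) = (LINT x|lborel. std_normal_density x *\<^sub>R iexp (- \<xi> * x))" .
  moreover have "fourier (\<lambda>x. of_real (gauss x)) \<xi> = (LINT x|lborel. of_real (sqrt (2 * pi)) * (std_normal_density x *\<^sub>R iexp (- \<xi> * x)))"
    unfolding fourier_def gauss_std by (rule Bochner_Integration.integral_cong) (auto simp: scaleR_conv_of_real mult_ac)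
  ultimately show ?thesis by (simp only: integral_mult_right_zero of_real_mult)
qed

lemma fourier_dilation:
  assumes "a \<noteq> 0"
  shows "fourier (\<lambda>x. \<phi> (x / a)) \<xi> = of_real \<bar>a\<bar> * fourier \<phi> (a * \<xi>)"
  unfolding fourier_def
  by (subst lborel_integral_real_affine[of a _ 0]) (use assms in \<open>simp_all add: scaleR_conv_of_real mult_ac\<close>)

lemma fourier_modulation: "fourier (\<lambda>x. exp (- \<i> * of_real (x * \<eta>)) * \<phi> x) \<xi> = fourier \<phi> (\<xi> + \<eta>)"
proof -
  have "exp (- \<i> * of_real (x * \<xi>)) * (exp (- \<i> * of_real (x * \<eta>)) * \<phi> x) = exp (- \<i> * of_real (x * (\<xi> + \<eta>))) * \<phi> x" for x
    by (simp only: mult.assoc[symmetric] exp_add[symmetric]) (simp add: distrib_left)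
  then show ?thesis unfolding fourier_def by (simp only:)
qed

lemma fourier_reflection: "fourier (\<lambda>x. \<phi> (- x)) \<xi> = fourier \<phi> (- \<xi>)"
  using fourier_dilation[of "-1" \<phi> \<xi>] by simp

text \<open>The Fourier transform of \<open>gauss (x / a)\<close> as a function of \<open>x\<close>. Its integral is \<open>2\<pi>\<close>, and it concentrates at the origin as
  \<open>a\<close> grows.\<close>

definition dual_gauss :: "real \<Rightarrow> real \<Rightarrow> real" where
  "dual_gauss a \<xi> = a * sqrt (2 * pi) * gauss (a * \<xi>)"

lemma fourier_gauss_dilated: "a > 0 \<Longrightarrow> fourier (\<lambda>x. of_real (gauss (x / a))) \<xi> = of_real (dual_gauss a \<xi>)"
  using fourier_dilation[of a "\<lambda>x. of_real (gauss x)" \<xi>] by (simp add: fourier_gauss dual_gauss_def)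

lemma integrable_gauss_dilated: "a > 0 \<Longrightarrow> integrable lborel (\<lambda>x. gauss (x / a))"
  using lborel_integrable_real_affine[OF integrable_gauss, of "1/a" 0] by simp

lemma measurable_dual_gauss [measurable]: "dual_gauss a \<in> borel_measurable borel"
  unfolding dual_gauss_def[abs_def] by measurable

lemma dual_gauss_nonneg: "a > 0 \<Longrightarrow> dual_gauss a x \<ge> 0"
  by (simp add: dual_gauss_def gauss_pos less_imp_le)

text \<open>Two applications of the multiplication formula move both transforms onto the Gaussian.\<close>

lemma regularised_parseval:
  assumes h: "integrable lborel h" and k: "integrable lborel k" and a: "a > 0"
  shows "(LINT x|lborel. fourier h x * fourier k x * of_real (gauss (x / a)))
       = (LINT \<xi>|lborel. h \<xi> * (LINT \<eta>|lborel. k \<eta> * of_real (dual_gauss a (\<xi> + \<eta>))))"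
proof -
  have g: "integrable lborel (\<lambda>x. complex_of_real (gauss (x / a)))"
    using integrable_gauss_dilated[OF a] by (rule integrable_of_real)
  have kg: "integrable lborel (\<lambda>x. fourier k x * of_real (gauss (x / a)))"
    by (rule integrable_fourier_mult[OF k g])
  have inner: "fourier (\<lambda>x. fourier k x * of_real (gauss (x / a))) \<xi>
      = (LINT \<eta>|lborel. k \<eta> * of_real (dual_gauss a (\<xi> + \<eta>)))" for \<xi>
  proof -
    have "fourier (\<lambda>x. fourier k x * of_real (gauss (x / a))) \<xi>
       = (LINT x|lborel. fourier k x * (exp (- \<i> * of_real (x * \<xi>)) * of_real (gauss (x / a))))"
      unfolding fourier_def[of "\<lambda>x. fourier k x * of_real (gauss (x / a))"] by (simp add: mult_ac)
    also have "\<dots> = (LINT x|lborel. k x * fourier (\<lambda>x. exp (- \<i> * of_real (x * \<xi>)) * of_real (gauss (x / a))) x)"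
      by (rule fourier_multiplication_formula[OF k integrable_exp_i_mult[OF g]]) simp
    finally show ?thesis
      by (simp only: fourier_modulation fourier_gauss_dilated[OF a] add.commute)
  qed
  have "(LINT x|lborel. fourier h x * fourier k x * of_real (gauss (x / a)))
      = (LINT x|lborel. h x * fourier (\<lambda>x. fourier k x * of_real (gauss (x / a))) x)"
    using fourier_multiplication_formula[OF h kg] by (simp add: mult.assoc)
  then show ?thesis by (simp only: inner)
qed

lemma gauss_dilation_tendsto: "(\<lambda>n. gauss (x / real (Suc n))) \<longlonglongrightarrow> 1"
proof -
  have "(\<lambda>n. x * inverse (real (Suc n))) \<longlonglongrightarrow> x * 0"
    by (intro tendsto_intros LIMSEQ_inverse_real_of_nat)
  then have "(\<lambda>n. exp (- (x / real (Suc n))\<^sup>2 / 2)) \<longlonglongrightarrow> exp (- 0\<^sup>2 / 2)"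
    by (intro tendsto_intros) (simp_all add: field_class.field_divide_inverse)
  then show ?thesis by (simp add: gauss_def)
qed

text \<open>The Gaussian regularisation makes all integrals absolutely convergent; its transform is an
  approximate identity.\<close>

lemma parseval:
  assumes h: "integrable lborel h" and k: "integrable lborel k"
    and kc: "continuous_on UNIV k" and kb: "\<And>x. cmod (k x) \<le> C"
    and prod: "integrable lborel (\<lambda>x. fourier h x * fourier k x)"
  shows "(LINT x|lborel. fourier h x * fourier k x) = of_real (2 * pi) * (LINT \<xi>|lborel. h \<xi> * k (- \<xi>))"
proof (rule LIMSEQ_unique)
  have [measurable]: "h \<in> borel_measurable borel" "k \<in> borel_measurable borel"
    using h k by (auto dest: borel_measurable_integrable)
  note [measurable] = measurable_fourier[OF h] measurable_fourier[OF k]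
  show "(\<lambda>n. LINT x|lborel. fourier h x * fourier k x * of_real (gauss (x / real (Suc n))))
      \<longlonglongrightarrow> (LINT x|lborel. fourier h x * fourier k x)"
  proof (rule integral_dominated_convergence[where w = "\<lambda>x. cmod (fourier h x * fourier k x)"])
    show "AE x in lborel. (\<lambda>n. fourier h x * fourier k x * of_real (gauss (x / real (Suc n)))) \<longlonglongrightarrow> fourier h x * fourier k x"
    proof (rule AE_I2)
      fix x
      have "(\<lambda>n. fourier h x * fourier k x * of_real (gauss (x / real (Suc n)))) \<longlonglongrightarrow> fourier h x * fourier k x * of_real 1"
        by (intro tendsto_intros gauss_dilation_tendsto)
      then show "(\<lambda>n. fourier h x * fourier k x * of_real (gauss (x / real (Suc n)))) \<longlonglongrightarrow> fourier h x * fourier k x"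
        by simp
    qed
    show "AE x in lborel. cmod (fourier h x * fourier k x * of_real (gauss (x / real (Suc n)))) \<le> cmod (fourier h x * fourier k x)" for n
      by (intro AE_I2) (use gauss_pos gauss_le_1 in \<open>auto simp: norm_mult mult_left_le less_imp_le abs_of_pos\<close>)
  qed (use prod in auto)
  define I where "I n \<xi> = (LINT \<eta>|lborel. k \<eta> * of_real (dual_gauss (real (Suc n)) (\<xi> + \<eta>)))" for n \<xi>
  \<comment> \<open>Substitution \<open>\<eta> = z / (n + 1) - \<xi>\<close>.\<close>
  have Ieq: "I n \<xi> = (LINT z|lborel. k (z / real (Suc n) - \<xi>) * of_real (sqrt (2 * pi) * gauss z))" for n \<xi>
    unfolding I_def
    by (subst lborel_integral_real_affine[of "1 / real (Suc n)" _ "- \<xi>"])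
       (auto simp: dual_gauss_def scaleR_conv_of_real integral_mult_right_zero[symmetric] simp del: integral_mult_right_zero of_nat_Suc
         intro!: Bochner_Integration.integral_cong)
  have gi: "integrable lborel (\<lambda>z. C * (sqrt (2 * pi) * gauss z))" using integrable_gauss by auto
  have bnd: "cmod (k y * of_real (sqrt (2 * pi) * gauss z)) \<le> C * (sqrt (2 * pi) * gauss z)" for y z
    using kb[of y] by (auto simp: norm_mult gauss_pos abs_of_pos intro!: mult_right_mono mult_nonneg_nonneg less_imp_le[OF gauss_pos])
  have Ilim: "(\<lambda>n. I n \<xi>) \<longlonglongrightarrow> of_real (2 * pi) * k (- \<xi>)" for \<xi>
  proof -
    have "(\<lambda>n. I n \<xi>) \<longlonglongrightarrow> (LINT z|lborel. k (- \<xi>) * of_real (sqrt (2 * pi) * gauss z))"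
      unfolding Ieq
    proof (rule integral_dominated_convergence[OF _ _ gi])
      show "AE z in lborel. (\<lambda>n. k (z / real (Suc n) - \<xi>) * of_real (sqrt (2 * pi) * gauss z))
          \<longlonglongrightarrow> k (- \<xi>) * of_real (sqrt (2 * pi) * gauss z)"
      proof (intro AE_I2 tendsto_mult_right)
        fix z
        have "(\<lambda>n. z * inverse (real (Suc n)) - \<xi>) \<longlonglongrightarrow> z * 0 - \<xi>"
          by (intro tendsto_intros LIMSEQ_inverse_real_of_nat)
        then have "(\<lambda>n. z / real (Suc n) - \<xi>) \<longlonglongrightarrow> - \<xi>" by (simp add: field_class.field_divide_inverse)
        then show "(\<lambda>n. k (z / real (Suc n) - \<xi>)) \<longlonglongrightarrow> k (- \<xi>)"
          using kc by (metis UNIV_I continuous_on_eq_continuous_at isCont_tendsto_compose open_UNIV)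
      qed
    qed (use bnd in auto)
    also have "(LINT z|lborel. k (- \<xi>) * of_real (sqrt (2 * pi) * gauss z)) = k (- \<xi>) * of_real (LINT z|lborel. sqrt (2 * pi) * gauss z)"
      by (subst integral_mult_right_zero) (simp only: integral_complex_of_real)
    also have "(LINT z|lborel. sqrt (2 * pi) * gauss z) = 2 * pi"
      by (simp add: integral_gauss)
    finally show ?thesis by (simp add: mult.commute)
  qed
  have Ibnd: "cmod (I n \<xi>) \<le> C * (2 * pi)" for n \<xi>
  proof -
    have "cmod (I n \<xi>) \<le> (LINT z|lborel. C * (sqrt (2 * pi) * gauss z))"
      unfolding Ieq
    proof (rule order_trans[OF integral_norm_bound], rule integral_mono'[OF gi])
      show "cmod (k (z / real (Suc n) - \<xi>) * of_real (sqrt (2 * pi) * gauss z)) \<le> C * (sqrt (2 * pi) * gauss z)" for z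
        by (rule bnd)
      show "0 \<le> C * (sqrt (2 * pi) * gauss z)" for z
        using bnd[of 0 z] norm_ge_zero order_trans by blast
    qed
    then show ?thesis by (simp add: integral_gauss)
  qed
  have [measurable]: "I n \<in> borel_measurable borel" for n
    unfolding I_def[abs_def] using lborel.borel_measurable_lebesgue_integral[of
      "\<lambda>\<xi> \<eta>. k \<eta> * of_real (dual_gauss (real (Suc n)) (\<xi> + \<eta>))" borel] by simp
  have reg: "(LINT x|lborel. fourier h x * fourier k x * of_real (gauss (x / real (Suc n))))
      = (LINT \<xi>|lborel. h \<xi> * I n \<xi>)" for n
    unfolding I_def by (rule regularised_parseval[OF h k]) simp
  have "(\<lambda>n. LINT \<xi>|lborel. h \<xi> * I n \<xi>) \<longlonglongrightarrow> (LINT \<xi>|lborel. h \<xi> * (of_real (2 * pi) * k (- \<xi>)))"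
  proof (rule integral_dominated_convergence[where w = "\<lambda>\<xi>. cmod (h \<xi>) * (C * (2 * pi))"])
    show "AE \<xi> in lborel. (\<lambda>n. h \<xi> * I n \<xi>) \<longlonglongrightarrow> h \<xi> * (of_real (2 * pi) * k (- \<xi>))"
      by (intro AE_I2 tendsto_mult_left Ilim)
    show "AE \<xi> in lborel. cmod (h \<xi> * I n \<xi>) \<le> cmod (h \<xi>) * (C * (2 * pi))" for n
      using Ibnd[of n] by (intro AE_I2) (simp add: norm_mult mult_left_mono)
  qed (use h in auto)
  moreover have "(LINT \<xi>|lborel. h \<xi> * (of_real (2 * pi) * k (- \<xi>))) = of_real (2 * pi) * (LINT \<xi>|lborel. h \<xi> * k (- \<xi>))"
    by (subst integral_mult_right_zero[symmetric]) (simp add: mult_ac)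
  ultimately show "(\<lambda>n. LINT x|lborel. fourier h x * fourier k x * of_real (gauss (x / real (Suc n))))
      \<longlonglongrightarrow> of_real (2 * pi) * (LINT \<xi>|lborel. h \<xi> * k (- \<xi>))"
    unfolding reg by simp
qed

lemma nn_integral_dual_gauss: "a > 0 \<Longrightarrow> (\<integral>\<^sup>+ x. ennreal (dual_gauss a (y + x)) \<partial>lborel) = ennreal (2 * pi)"
proof -
  assume a: "a > 0"
  have gi: "integrable lborel (\<lambda>z. sqrt (2 * pi) * gauss z)" by (intro integrable_mult_right integrable_gauss)
  have "(\<integral>\<^sup>+ z. ennreal (sqrt (2 * pi) * gauss z) \<partial>lborel) = ennreal (2 * pi)"
  proof -
    have "(\<integral>\<^sup>+ z. ennreal (sqrt (2 * pi) * gauss z) \<partial>lborel) = ennreal (LINT z|lborel. sqrt (2 * pi) * gauss z)"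
      by (rule nn_integral_eq_integral[OF gi]) (simp add: gauss_def)
    then show ?thesis by (simp add: integral_gauss)
  qed
  moreover have "(\<integral>\<^sup>+ z. ennreal (sqrt (2 * pi) * gauss z) \<partial>lborel) = (\<integral>\<^sup>+ x. ennreal (dual_gauss a (y + x)) \<partial>lborel)"
  proof -
    have "(\<integral>\<^sup>+ z. ennreal (sqrt (2 * pi) * gauss z) \<partial>lborel)
       = ennreal \<bar>a\<bar> * (\<integral>\<^sup>+ x. ennreal (sqrt (2 * pi) * gauss (a * y + a * x)) \<partial>lborel)"
      using a by (intro nn_integral_real_affine) auto
    also have "\<dots> = (\<integral>\<^sup>+ x. ennreal \<bar>a\<bar> * ennreal (sqrt (2 * pi) * gauss (a * y + a * x)) \<partial>lborel)"
      by (rule nn_integral_cmult[symmetric]) measurable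
    also have "\<dots> = (\<integral>\<^sup>+ x. ennreal (dual_gauss a (y + x)) \<partial>lborel)"
      using a by (intro nn_integral_cong)
        (simp add: dual_gauss_def gauss_def ennreal_mult'[symmetric] distrib_left mult.assoc)
    finally show ?thesis .
  qed
  ultimately show ?thesis by simp
qed

text \<open>For \<open>k(\<xi>)\<close> the conjugate of \<open>h(- \<xi>)\<close>, the regularised Parseval formula expresses the integral of
  \<open>\<bar>fourier h\<bar>\<^sup>2\<close> against a Gaussian by a convolution of \<open>h\<close> with \<open>k\<close>, which the inequality
  \<open>ab \<le> (a\<^sup>2 + b\<^sup>2) / 2\<close> and the mass \<open>2\<pi>\<close> of the kernel bound. Fatou's lemma removes the Gaussian.\<close>

theorem plancherel_inequality:
  assumes h: "integrable lborel h" and h2: "integrable lborel (\<lambda>x. (cmod (h x))\<^sup>2)"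
  shows "integrable lborel (\<lambda>x. (cmod (fourier h x))\<^sup>2)"
    and "(LINT x|lborel. (cmod (fourier h x))\<^sup>2) \<le> 2 * pi * (LINT x|lborel. (cmod (h x))\<^sup>2)"
proof -
  have [measurable]: "h \<in> borel_measurable borel"
    using h by (auto dest: borel_measurable_integrable)
  note [measurable] = measurable_fourier[OF h]
  define k where "k x = cnj (h (- x))" for x
  have k: "integrable lborel k"
    unfolding k_def using lborel_integrable_real_affine[OF h, of "-1" 0] by simp
  have fk: "fourier k x = cnj (fourier h x)" for x
  proof -
    have "fourier k x = (LINT y|lborel. exp (- \<i> * of_real (- y * x)) * cnj (h y))"
      unfolding fourier_def k_def by (subst lborel_integral_real_affine[of "-1" _ 0]) simp_all
    also have "\<dots> = (LINT y|lborel. cnj (exp (- \<i> * of_real (y * x)) * h y))"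
      by (simp add: exp_cnj)
    also have "\<dots> = cnj (fourier h x)"
      unfolding fourier_def by (rule Bochner_Integration.integral_cnj)
    finally show ?thesis .
  qed
  have k_nn: "(\<integral>\<^sup>+ \<eta>. ennreal ((cmod (k \<eta>))\<^sup>2) \<partial>lborel) = (\<integral>\<^sup>+ \<xi>. ennreal ((cmod (h \<xi>))\<^sup>2) \<partial>lborel)"
    using nn_integral_real_affine[of "\<lambda>\<xi>. ennreal ((cmod (h \<xi>))\<^sup>2)" "-1" 0] by (simp add: k_def)
  define N where "N = (\<integral>\<^sup>+ \<xi>. ennreal ((cmod (h \<xi>))\<^sup>2) \<partial>lborel)"
  have [measurable]: "k \<in> borel_measurable borel" using k by (auto dest: borel_measurable_integrable)
  have bound: "(\<integral>\<^sup>+ x. ennreal ((cmod (fourier h x))\<^sup>2 * gauss (x / a)) \<partial>lborel) \<le> ennreal (2 * pi) * N" if a: "a > 0" for a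
  proof -
    have gi: "integrable lborel (\<lambda>x. fourier h x * (fourier k x * of_real (gauss (x / a))))"
      by (rule integrable_bounded_mult[OF integrable_fourier_mult[OF k integrable_of_real[OF integrable_gauss_dilated[OF a]]] _ norm_fourier_le[OF h]]) simp
    have eq: "fourier h x * (fourier k x * of_real (gauss (x / a))) = of_real ((cmod (fourier h x))\<^sup>2 * gauss (x / a))" for x
      by (simp only: fk of_real_mult complex_norm_square mult.assoc)
    have i: "integrable lborel (\<lambda>x. (cmod (fourier h x))\<^sup>2 * gauss (x / a))"
      using gi unfolding eq by (simp only: complex_of_real_integrable_eq)
    have "(\<integral>\<^sup>+ x. ennreal ((cmod (fourier h x))\<^sup>2 * gauss (x / a)) \<partial>lborel)
        = ennreal (LINT x|lborel. (cmod (fourier h x))\<^sup>2 * gauss (x / a))"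
      using gauss_pos by (intro nn_integral_eq_integral[OF i]) (auto simp: less_imp_le)
    also have "\<dots> \<le> ennreal (cmod (LINT x|lborel. fourier h x * fourier k x * of_real (gauss (x / a))))"
      by (rule ennreal_leI) (simp only: mult.assoc eq integral_complex_of_real norm_of_real abs_ge_self)
    also have "(LINT x|lborel. fourier h x * fourier k x * of_real (gauss (x / a))) = (LINT \<xi>|lborel. h \<xi> * (LINT \<eta>|lborel. k \<eta> * of_real (dual_gauss a (\<xi> + \<eta>))))"
      by (rule regularised_parseval[OF h k a])
    also have "ennreal (cmod \<dots>) \<le> (\<integral>\<^sup>+ \<xi>. norm (h \<xi> * (LINT \<eta>|lborel. k \<eta> * of_real (dual_gauss a (\<xi> + \<eta>)))) \<partial>lborel)"
    proof (rule integral_norm_bound_ennreal)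
      have dg: "dual_gauss a x \<le> a * sqrt (2 * pi)" for x
        using a gauss_le_1[of "a * x"] by (simp add: dual_gauss_def mult_left_le)
      have "integrable lborel (\<lambda>\<xi>. (LINT \<eta>|lborel. k \<eta> * of_real (dual_gauss a (\<xi> + \<eta>))) * h \<xi>)"
      proof (rule integrable_bounded_mult[OF h])
        show "cmod (LINT \<eta>|lborel. k \<eta> * of_real (dual_gauss a (\<xi> + \<eta>))) \<le> (LINT \<eta>|lborel. cmod (k \<eta>) * (a * sqrt (2 * pi)))" for \<xi>
        proof (rule order_trans[OF integral_norm_bound], rule integral_mono_AE)
          show i2: "integrable lborel (\<lambda>\<eta>. cmod (k \<eta>) * (a * sqrt (2 * pi)))" using k by auto
          have pt: "cmod (k \<eta> * of_real (dual_gauss a (\<xi> + \<eta>))) \<le> cmod (k \<eta>) * (a * sqrt (2 * pi))" for \<eta>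
            using dg dual_gauss_nonneg[OF a] by (auto simp: norm_mult intro!: mult_left_mono)
          then show "AE \<eta> in lborel. cmod (k \<eta> * of_real (dual_gauss a (\<xi> + \<eta>))) \<le> cmod (k \<eta>) * (a * sqrt (2 * pi))"
            by simp
          show "integrable lborel (\<lambda>\<eta>. cmod (k \<eta> * of_real (dual_gauss a (\<xi> + \<eta>))))"
            by (intro Bochner_Integration.integrable_bound[OF i2])
               (use a pt in \<open>auto simp: abs_of_nonneg\<close>)
        qed
      qed measurable
      then show "integrable lborel (\<lambda>\<xi>. h \<xi> * (LINT \<eta>|lborel. k \<eta> * of_real (dual_gauss a (\<xi> + \<eta>))))" by (simp add: mult.commute)
    qed
    also have "\<dots> \<le> (\<integral>\<^sup>+ \<xi>. (\<integral>\<^sup>+ \<eta>. ennreal (cmod (h \<xi>) * cmod (k \<eta>) * dual_gauss a (\<xi> + \<eta>)) \<partial>lborel) \<partial>lborel)"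
    proof (rule nn_integral_mono)
      fix \<xi>
      have "ennreal (norm (h \<xi> * (LINT \<eta>|lborel. k \<eta> * of_real (dual_gauss a (\<xi> + \<eta>)))))
          \<le> ennreal (cmod (h \<xi>)) * (\<integral>\<^sup>+ \<eta>. ennreal (norm (k \<eta> * of_real (dual_gauss a (\<xi> + \<eta>)))) \<partial>lborel)"
        by (cases "integrable lborel (\<lambda>\<eta>. k \<eta> * of_real (dual_gauss a (\<xi> + \<eta>)))")
           (auto simp: norm_mult ennreal_mult not_integrable_integral_eq intro!: mult_left_mono
             order_trans[OF integral_norm_bound_ennreal] nn_integral_mono)
      also have "\<dots> = (\<integral>\<^sup>+ \<eta>. ennreal (cmod (h \<xi>) * cmod (k \<eta>) * dual_gauss a (\<xi> + \<eta>)) \<partial>lborel)"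
        using dual_gauss_nonneg[OF a]
        by (subst nn_integral_cmult[symmetric]) (auto simp: norm_mult ennreal_mult[symmetric] mult.assoc intro!: nn_integral_cong)
      finally show "ennreal (norm (h \<xi> * (LINT \<eta>|lborel. k \<eta> * of_real (dual_gauss a (\<xi> + \<eta>))))) \<le> \<dots>" .
    qed
    also have "\<dots> \<le> (\<integral>\<^sup>+ \<xi>. (\<integral>\<^sup>+ \<eta>. ennreal ((cmod (h \<xi>))\<^sup>2 / 2) * ennreal (dual_gauss a (\<xi> + \<eta>)) + ennreal ((cmod (k \<eta>))\<^sup>2 / 2) * ennreal (dual_gauss a (\<eta> + \<xi>)) \<partial>lborel) \<partial>lborel)"
    proof (intro nn_integral_mono)
      fix \<xi> \<eta>
      have "cmod (h \<xi>) * cmod (k \<eta>) \<le> (cmod (h \<xi>))\<^sup>2 / 2 + (cmod (k \<eta>))\<^sup>2 / 2"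
        using sum_squares_bound[of "cmod (h \<xi>)" "cmod (k \<eta>)"] by simp
      from mult_right_mono[OF this dual_gauss_nonneg[OF a, of "\<xi> + \<eta>"]]
      show "ennreal (cmod (h \<xi>) * cmod (k \<eta>) * dual_gauss a (\<xi> + \<eta>)) \<le> ennreal ((cmod (h \<xi>))\<^sup>2 / 2) * ennreal (dual_gauss a (\<xi> + \<eta>)) + ennreal ((cmod (k \<eta>))\<^sup>2 / 2) * ennreal (dual_gauss a (\<eta> + \<xi>))"
        using dual_gauss_nonneg[OF a, of "\<xi> + \<eta>"]
        by (simp add: ennreal_mult[symmetric] ennreal_plus[symmetric] distrib_right add.commute del: ennreal_plus)
    qed
    also have "\<dots> = (\<integral>\<^sup>+ \<xi>. (\<integral>\<^sup>+ \<eta>. ennreal ((cmod (h \<xi>))\<^sup>2 / 2) * ennreal (dual_gauss a (\<xi> + \<eta>)) \<partial>lborel) \<partial>lborel)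
        + (\<integral>\<^sup>+ \<xi>. (\<integral>\<^sup>+ \<eta>. ennreal ((cmod (k \<eta>))\<^sup>2 / 2) * ennreal (dual_gauss a (\<eta> + \<xi>)) \<partial>lborel) \<partial>lborel)"
      by (subst nn_integral_add[symmetric]) (auto intro!: nn_integral_cong nn_integral_add)
    also have "(\<integral>\<^sup>+ \<xi>. (\<integral>\<^sup>+ \<eta>. ennreal ((cmod (k \<eta>))\<^sup>2 / 2) * ennreal (dual_gauss a (\<eta> + \<xi>)) \<partial>lborel) \<partial>lborel)
       = (\<integral>\<^sup>+ \<eta>. (\<integral>\<^sup>+ \<xi>. ennreal ((cmod (k \<eta>))\<^sup>2 / 2) * ennreal (dual_gauss a (\<eta> + \<xi>)) \<partial>lborel) \<partial>lborel)"
      by (rule lborel_pair.Fubini') measurable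
    also have "(\<integral>\<^sup>+ \<xi>. (\<integral>\<^sup>+ \<eta>. ennreal ((cmod (h \<xi>))\<^sup>2 / 2) * ennreal (dual_gauss a (\<xi> + \<eta>)) \<partial>lborel) \<partial>lborel) = ennreal (2 * pi) * (N / 2)"
      by (simp add: nn_integral_cmult nn_integral_dual_gauss[OF a] N_def nn_integral_multc mult.commute
          divide_ennreal[symmetric] nn_integral_divide flip: ennreal_numeral)
    also have "(\<integral>\<^sup>+ \<eta>. (\<integral>\<^sup>+ \<xi>. ennreal ((cmod (k \<eta>))\<^sup>2 / 2) * ennreal (dual_gauss a (\<eta> + \<xi>)) \<partial>lborel) \<partial>lborel) = ennreal (2 * pi) * (N / 2)"
      by (simp add: nn_integral_cmult nn_integral_dual_gauss[OF a] N_def k_nn[symmetric] nn_integral_multc mult.commute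
          divide_ennreal[symmetric] nn_integral_divide flip: ennreal_numeral)
    also have "ennreal (2 * pi) * (N / 2) + ennreal (2 * pi) * (N / 2) = ennreal (2 * pi) * N"
    proof -
      have "(N + N) / 2 = N" by (simp add: mult_2_right[symmetric] ennreal_mult_divide_eq)
      then show ?thesis by (simp add: distrib_left[symmetric] add_divide_distrib_ennreal[symmetric])
    qed
    finally show ?thesis .
  qed
  have Nfin: "N = ennreal (LINT x|lborel. (cmod (h x))\<^sup>2)"
    unfolding N_def by (rule nn_integral_eq_integral[OF h2]) simp
  have lim: "(\<integral>\<^sup>+ x. ennreal ((cmod (fourier h x))\<^sup>2) \<partial>lborel) \<le> ennreal (2 * pi) * N"
  proof -
    have "(\<integral>\<^sup>+ x. ennreal ((cmod (fourier h x))\<^sup>2) \<partial>lborel)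
        = (\<integral>\<^sup>+ x. liminf (\<lambda>n. ennreal ((cmod (fourier h x))\<^sup>2 * gauss (x / real (Suc n)))) \<partial>lborel)"
    proof (rule nn_integral_cong)
      fix x
      have "(\<lambda>n. (cmod (fourier h x))\<^sup>2 * gauss (x / real (Suc n))) \<longlonglongrightarrow> (cmod (fourier h x))\<^sup>2 * 1"
        by (intro tendsto_intros gauss_dilation_tendsto)
      then have "(\<lambda>n. ennreal ((cmod (fourier h x))\<^sup>2 * gauss (x / real (Suc n)))) \<longlonglongrightarrow> ennreal ((cmod (fourier h x))\<^sup>2)"
        by (simp add: tendsto_ennrealI)
      then show "ennreal ((cmod (fourier h x))\<^sup>2) = liminf (\<lambda>n. ennreal ((cmod (fourier h x))\<^sup>2 * gauss (x / real (Suc n))))"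
        by (simp add: lim_imp_Liminf)
    qed
    also have "\<dots> \<le> liminf (\<lambda>n. (\<integral>\<^sup>+ x. ennreal ((cmod (fourier h x))\<^sup>2 * gauss (x / real (Suc n))) \<partial>lborel))"
      by (rule nn_integral_liminf) measurable
    also have "\<dots> \<le> liminf (\<lambda>n::nat. ennreal (2 * pi) * N)"
      by (intro Liminf_mono always_eventually allI bound) simp
    finally show ?thesis by (simp add: Liminf_const)
  qed
  also have "\<dots> = ennreal (2 * pi * (LINT x|lborel. (cmod (h x))\<^sup>2))"
    by (simp add: Nfin ennreal_mult[symmetric])
  finally have fin: "(\<integral>\<^sup>+ x. ennreal ((cmod (fourier h x))\<^sup>2) \<partial>lborel) \<le> ennreal (2 * pi * (LINT x|lborel. (cmod (h x))\<^sup>2))" .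
  show int: "integrable lborel (\<lambda>x. (cmod (fourier h x))\<^sup>2)"
    by (rule integrableI_bounded) (use fin in \<open>auto simp: less_top[symmetric] top_unique\<close>)
  show "(LINT x|lborel. (cmod (fourier h x))\<^sup>2) \<le> 2 * pi * (LINT x|lborel. (cmod (h x))\<^sup>2)"
    using fin by (subst (asm) nn_integral_eq_integral[OF int]) (auto simp: ennreal_le_iff)
qed

section \<open>Schwartz functions\<close>

lemma integrable_inverse_1_plus_square: "integrable lborel (\<lambda>x::real. 1 / (1 + x\<^sup>2))"
proof -
  have tn: "((arctan \<circ> real_of_ereal) \<longlongrightarrow> - (pi / 2)) (at_right (- \<infinity>))"
    and tp: "((arctan \<circ> real_of_ereal) \<longlongrightarrow> pi / 2) (at_left \<infinity>)"
    unfolding ereal_tendsto_simps by (rule tendsto_arctan_at_bot tendsto_arctan_at_top)+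
  have "set_integrable lborel (einterval (-\<infinity>) \<infinity>) (\<lambda>x. inverse (1 + x\<^sup>2))"
    by (rule interval_integral_FTC_nonneg(1)[OF _ _ _ _ tn tp])
       (auto intro!: DERIV_arctan continuous_intros simp: add_nonneg_eq_0_iff)
  then show ?thesis by (simp add: set_integrable_def inverse_eq_divide)
qed

definition schwartz_family :: "(nat \<Rightarrow> real \<Rightarrow> complex) \<Rightarrow> bool" where
  "schwartz_family D \<longleftrightarrow> (\<forall>n x. (D n has_vector_derivative D (Suc n) x) (at x)) \<and>
     (\<forall>n k. bounded (range (\<lambda>x. x ^ k *\<^sub>R D n x)))"

lemma schwartz_iff: "\<phi> \<in> schwartz \<longleftrightarrow> (\<exists>D. schwartz_family D \<and> D 0 = \<phi>)"
  unfolding schwartz_def schwartz_family_def by blast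

lemma schwartz_family_shift: "schwartz_family D \<Longrightarrow> schwartz_family (\<lambda>n. D (n + k))"
  by (simp add: schwartz_family_def)

lemma schwartz_family_mem: "schwartz_family D \<Longrightarrow> D n \<in> schwartz"
  using schwartz_family_shift[of D n] unfolding schwartz_iff by (intro exI[of _ "\<lambda>k. D (k + n)"]) simp

lemma schwartz_family_combination:
  assumes D: "schwartz_family D" and E: "schwartz_family E"
  shows "schwartz_family (\<lambda>n x. a * D n x + b * E n x)"
  unfolding schwartz_family_def
proof safe
  fix n x
  show "((\<lambda>x. a * D n x + b * E n x) has_vector_derivative a * D (Suc n) x + b * E (Suc n) x) (at x)"
    using D E unfolding schwartz_family_def
    by (intro has_vector_derivative_add has_vector_derivative_mult_right) auto
next
  fix n k
  have "bounded (range (\<lambda>x. a * (x ^ k *\<^sub>R D n x) + b * (x ^ k *\<^sub>R E n x)))"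
  proof -
    have "bounded (range (\<lambda>x. x ^ k *\<^sub>R D n x))" "bounded (range (\<lambda>x. x ^ k *\<^sub>R E n x))"
      using D E by (auto simp: schwartz_family_def)
    then obtain A B where A: "\<And>x. cmod (x ^ k *\<^sub>R D n x) \<le> A" and B: "\<And>x. cmod (x ^ k *\<^sub>R E n x) \<le> B"
      unfolding bounded_iff by blast
    have "cmod (a * (x ^ k *\<^sub>R D n x) + b * (x ^ k *\<^sub>R E n x)) \<le> cmod a * A + cmod b * B" for x
      by (rule order_trans[OF norm_triangle_ineq add_mono]) (simp_all only: norm_mult mult_left_mono A B norm_ge_zero)
    then show ?thesis unfolding bounded_iff by blast
  qed
  then show "bounded (range (\<lambda>x. x ^ k *\<^sub>R (a * D n x + b * E n x)))"
    by (simp add: scaleR_conv_of_real algebra_simps)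
qed

lemma schwartz_combination: "\<phi> \<in> schwartz \<Longrightarrow> \<psi> \<in> schwartz \<Longrightarrow> (\<lambda>x. a * \<phi> x + b * \<psi> x) \<in> schwartz"
  unfolding schwartz_iff using schwartz_family_combination by blast

lemma schwartz_diff: "\<phi> \<in> schwartz \<Longrightarrow> \<psi> \<in> schwartz \<Longrightarrow> (\<lambda>x. \<phi> x - \<psi> x) \<in> schwartz"
  using schwartz_combination[of \<phi> \<psi> 1 "-1"] by simp

lemma schwartz_continuous:
  assumes "\<phi> \<in> schwartz"
  shows "continuous_on S \<phi>"
proof -
  obtain D where D: "schwartz_family D" "D 0 = \<phi>" using assms by (auto simp: schwartz_iff)
  have "(\<phi> has_vector_derivative D 1 x) (at x)" for x using D by (auto simp: schwartz_family_def)
  then show ?thesis by (meson continuous_at_imp_continuous_on has_vector_derivative_continuous)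
qed

lemma schwartz_measurable [measurable_dest]: "\<phi> \<in> schwartz \<Longrightarrow> \<phi> \<in> borel_measurable borel"
  by (rule borel_measurable_continuous_onI) (rule schwartz_continuous)

lemma schwartz_decay:
  assumes "\<phi> \<in> schwartz"
  shows "\<exists>C\<ge>0. \<forall>x. cmod (\<phi> x) \<le> C / (1 + x\<^sup>2)"
proof -
  obtain D where D: "schwartz_family D" "D 0 = \<phi>" using assms by (auto simp: schwartz_iff)
  have "bounded (range (\<lambda>x. x ^ 0 *\<^sub>R \<phi> x))" "bounded (range (\<lambda>x. x ^ 2 *\<^sub>R \<phi> x))"
    using D unfolding schwartz_family_def by blast+
  then obtain A B where A: "\<And>x. cmod (\<phi> x) \<le> A" and B: "\<And>x. cmod (x\<^sup>2 *\<^sub>R \<phi> x) \<le> B"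
    unfolding bounded_iff by auto
  have "cmod (\<phi> x) \<le> (A + B) / (1 + x\<^sup>2)" for x
    using A[of x] B[of x] by (simp add: field_simps add_pos_nonneg)
  moreover have "A + B \<ge> 0" using A[of 0] B[of 0] norm_ge_zero order_trans by (smt (verit))
  ultimately show ?thesis by blast
qed

lemma integrable_of_quadratic_decay:
  fixes f :: "real \<Rightarrow> 'a::{banach, second_countable_topology}"
  assumes "f \<in> borel_measurable borel" "\<And>x. norm (f x) \<le> C / (1 + x\<^sup>2)"
  shows "integrable lborel f"
proof (rule Bochner_Integration.integrable_bound)
  show "integrable lborel (\<lambda>x. C * (1 / (1 + x\<^sup>2)))"
    by (intro integrable_mult_right integrable_inverse_1_plus_square)
  show "AE x in lborel. norm (f x) \<le> norm (C * (1 / (1 + x\<^sup>2)))"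
  proof (rule AE_I2)
    fix x
    have "norm (f x) \<le> C * (1 / (1 + x\<^sup>2))" using assms(2)[of x] by simp
    then show "norm (f x) \<le> norm (C * (1 / (1 + x\<^sup>2)))" unfolding real_norm_def by (rule order_trans[OF _ abs_ge_self])
  qed
qed (use assms in simp)

lemma quadratic_decay_bounded:
  fixes C x :: real
  assumes "C \<ge> 0" shows "C / (1 + x\<^sup>2) \<le> C"
  using assms by (simp add: divide_le_eq mult_left_mono add_pos_nonneg distrib_left)

lemma square_integrable_of_bounded:
  fixes f :: "real \<Rightarrow> complex"
  assumes "integrable lborel f" "f \<in> borel_measurable borel" "\<And>x. cmod (f x) \<le> C"
  shows "integrable lborel (\<lambda>x. (cmod (f x))\<^sup>2)"
  using integrable_norm[OF integrable_bounded_mult[OF assms(1,2,3)]] by (simp add: norm_mult power2_eq_square)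

lemma schwartz_bounded: "\<phi> \<in> schwartz \<Longrightarrow> \<exists>C. \<forall>x. cmod (\<phi> x) \<le> C"
  using schwartz_decay[of \<phi>] quadratic_decay_bounded order_trans by meson

lemma schwartz_integrable: "\<phi> \<in> schwartz \<Longrightarrow> integrable lborel \<phi>"
  using schwartz_decay[of \<phi>] integrable_of_quadratic_decay[OF schwartz_measurable] by blast

lemma schwartz_square_integrable: "\<phi> \<in> schwartz \<Longrightarrow> integrable lborel (\<lambda>x. (cmod (\<phi> x))\<^sup>2)"
  using schwartz_bounded[of \<phi>] square_integrable_of_bounded[OF schwartz_integrable schwartz_measurable] by blast

lemma schwartz_tendsto_0:
  assumes "\<phi> \<in> schwartz" shows "(\<phi> \<longlongrightarrow> 0) at_top" "(\<phi> \<longlongrightarrow> 0) at_bot"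
proof -
  obtain C where C: "\<And>x. cmod (\<phi> x) \<le> C / (1 + x\<^sup>2)" using schwartz_decay[OF assms] by blast
  have t: "((\<lambda>x. C / (1 + x\<^sup>2)) \<longlongrightarrow> 0) at_top" by real_asymp
  have b: "((\<lambda>x. C / (1 + x\<^sup>2)) \<longlongrightarrow> 0) at_bot" by real_asymp
  show "(\<phi> \<longlongrightarrow> 0) at_top" by (rule Lim_null_comparison[OF _ t]) (simp add: C)
  show "(\<phi> \<longlongrightarrow> 0) at_bot" by (rule Lim_null_comparison[OF _ b]) (simp add: C)
qed

text \<open>Integration by parts: the derivative of \<open>exp (- \<i>x\<xi>) D n x\<close> has integral zero.\<close>

lemma fourier_derivative:
  assumes D: "schwartz_family D"
  shows "fourier (D (Suc n)) \<xi> = \<i> * of_real \<xi> * fourier (D n) \<xi>"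
proof -
  define E where "E x = exp (- \<i> * of_real (x * \<xi>)) * D n x" for x
  define E' where "E' x = exp (- \<i> * of_real (x * \<xi>)) * D (Suc n) x - \<i> * of_real \<xi> * (exp (- \<i> * of_real (x * \<xi>)) * D n x)" for x
  note mem = schwartz_family_mem[OF D]
  have i: "integrable lborel (\<lambda>x. exp (- \<i> * of_real (x * \<xi>)) * D n x)" for n
    by (rule integrable_exp_i_mult[OF schwartz_integrable[OF mem]]) simp
  have e: "((\<lambda>x. exp (- \<i> * of_real (x * \<xi>))) has_vector_derivative (- \<i> * of_real \<xi>) * exp (- \<i> * of_real (x * \<xi>))) (at x)" for x
  proof -
    have "((\<lambda>z. exp (- \<i> * (z * of_real \<xi>))) has_field_derivative (- \<i> * of_real \<xi>) * exp (- \<i> * of_real (x * \<xi>))) (at (of_real x))"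
      by (auto intro!: derivative_eq_intros)
    from has_vector_derivative_real_field[OF this] show ?thesis by simp
  qed
  have E: "(E has_vector_derivative E' x) (at x)" for x
  proof -
    have "(D n has_vector_derivative D (Suc n) x) (at x)" using D by (simp add: schwartz_family_def)
    from has_vector_derivative_mult[OF e[of x] this] show ?thesis
      unfolding E_def[abs_def] E'_def by (simp add: algebra_simps)
  qed
  have c: "isCont E' x" for x
    unfolding E'_def[abs_def]
    using schwartz_continuous[OF mem, of UNIV] by (intro continuous_intros) (auto simp: continuous_on_eq_continuous_at)
  have iE': "integrable lborel E'" unfolding E'_def[abs_def]
    by (intro Bochner_Integration.integrable_diff integrable_mult_right i)
  have nE: "cmod (E x) = cmod (D n x)" for x by (simp add: E_def norm_mult)
  have "(LBINT x=-\<infinity>..\<infinity>. E' x) = 0 - 0"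
  proof (rule interval_integral_FTC_integrable)
    show "set_integrable lborel (einterval (-\<infinity>) \<infinity>) E'" using iE' by (simp add: set_integrable_def)
    have "(E \<longlongrightarrow> 0) at_bot" "(E \<longlongrightarrow> 0) at_top"
      using schwartz_tendsto_0[OF mem[of n]] nE by (auto simp: tendsto_norm_zero_iff[symmetric, of E] intro: tendsto_norm_zero)
    then show "((E \<circ> real_of_ereal) \<longlongrightarrow> 0) (at_right (-\<infinity>))" "((E \<circ> real_of_ereal) \<longlongrightarrow> 0) (at_left \<infinity>)"
      by (simp_all add: ereal_tendsto_simps)
  qed (use E c in auto)
  then have "(LINT x|lborel. E' x) = 0"
    by (simp add: interval_lebesgue_integral_def set_lebesgue_integral_def)
  also have "(LINT x|lborel. E' x) = fourier (D (Suc n)) \<xi> - \<i> * of_real \<xi> * fourier (D n) \<xi>"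
    unfolding E'_def fourier_def
    by (subst Bochner_Integration.integral_diff[OF i integrable_mult_right[OF i]]) (simp only: integral_mult_right_zero)
  finally show ?thesis by simp
qed

text \<open>\<open>(1 + \<xi>\<^sup>2) \<phi>^\<close> is the transform of the Schwartz function \<open>\<phi> - \<phi>''\<close>, and transforms of
  integrable functions are bounded.\<close>

lemma fourier_schwartz_decay: "\<phi> \<in> schwartz \<Longrightarrow> \<exists>C. \<forall>\<xi>. (1 + \<xi>\<^sup>2) ^ k * cmod (fourier \<phi> \<xi>) \<le> C"
proof (induction k arbitrary: \<phi>)
  case 0
  then show ?case using norm_fourier_le[OF schwartz_integrable[OF 0]] by auto
next
  case (Suc k)
  obtain D where D: "schwartz_family D" "D 0 = \<phi>" using Suc.prems by (auto simp: schwartz_iff)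
  note mem = schwartz_family_mem[OF D(1)]
  have "(\<lambda>x. D 0 x - D 2 x) \<in> schwartz" by (rule schwartz_diff[OF mem mem])
  from Suc.IH[OF this] obtain C where C: "\<And>\<xi>. (1 + \<xi>\<^sup>2) ^ k * cmod (fourier (\<lambda>x. D 0 x - D 2 x) \<xi>) \<le> C" by blast
  have "fourier (\<lambda>x. D 0 x - D 2 x) \<xi> = of_real (1 + \<xi>\<^sup>2) * fourier \<phi> \<xi>" for \<xi>
  proof -
    have i: "integrable lborel (\<lambda>x. exp (- \<i> * of_real (x * \<xi>)) * D n x)" for n
      by (rule integrable_exp_i_mult[OF schwartz_integrable[OF mem]]) simp
    have "fourier (\<lambda>x. D 0 x - D 2 x) \<xi> = fourier (D 0) \<xi> - fourier (D 2) \<xi>"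
      unfolding fourier_def right_diff_distrib by (rule Bochner_Integration.integral_diff[OF i i])
    also have "fourier (D 2) \<xi> = - (of_real (\<xi>\<^sup>2)) * fourier (D 0) \<xi>"
    proof -
      have "fourier (D 2) \<xi> = \<i> * of_real \<xi> * (\<i> * of_real \<xi> * fourier (D 0) \<xi>)"
        using fourier_derivative[OF D(1), of 1 \<xi>] fourier_derivative[OF D(1), of 0 \<xi>]
        by (simp add: numeral_2_eq_2)
      also have "\<dots> = (\<i> * \<i>) * of_real (\<xi> * \<xi>) * fourier (D 0) \<xi>" by (simp only: of_real_mult mult_ac)
      finally show ?thesis by (simp add: power2_eq_square)
    qed
    finally show ?thesis by (simp add: D(2) algebra_simps)
  qed
  then have eq: "(1 + \<xi>\<^sup>2) ^ Suc k * cmod (fourier \<phi> \<xi>) = (1 + \<xi>\<^sup>2) ^ k * cmod (fourier (\<lambda>x. D 0 x - D 2 x) \<xi>)" for \<xi>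
    by (simp add: norm_mult del: of_real_add of_real_power)
  show ?case by (intro exI[of _ C] allI) (simp only: eq C)
qed

section \<open>Bessel potentials\<close>

definition weight :: "real \<Rightarrow> real \<Rightarrow> real" where "weight \<sigma> \<xi> = (1 + \<xi>\<^sup>2) powr (\<sigma> / 2)"

lemma one_plus_square_neq_0: "1 + x\<^sup>2 \<noteq> (0::real)"
  using zero_le_power2[of x] by linarith

lemma weight_pos: "weight \<sigma> \<xi> > 0"
  by (simp add: weight_def one_plus_square_neq_0)

lemma weight_sq: "(weight \<sigma> \<xi>)\<^sup>2 = (1 + \<xi>\<^sup>2) powr \<sigma>"
  by (simp add: weight_def power2_eq_square powr_add[symmetric])

lemma weight_inverse: "weight (- \<sigma>) \<xi> * weight \<sigma> \<xi> = 1"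
proof -
  have "1 + \<xi>\<^sup>2 \<noteq> 0" by (rule one_plus_square_neq_0)
  then show ?thesis by (simp add: weight_def powr_add[symmetric])
qed

lemma weight_minus: "weight \<sigma> (- \<xi>) = weight \<sigma> \<xi>"
  by (simp add: weight_def)

lemma measurable_weight [measurable]: "weight \<sigma> \<in> borel_measurable borel"
  unfolding weight_def[abs_def] by measurable

lemma continuous_weight: "continuous_on S (weight \<sigma>)"
  unfolding weight_def[abs_def] by (intro continuous_intros) (auto simp: add_nonneg_eq_0_iff)

definition weighted_fourier :: "real \<Rightarrow> (real \<Rightarrow> complex) \<Rightarrow> real \<Rightarrow> complex" where
  "weighted_fourier \<sigma> \<phi> \<xi> = of_real (weight \<sigma> \<xi>) * fourier \<phi> \<xi>"

lemma bessel_op_eq: "bessel_op \<sigma> \<phi> x = of_real (1 / (2 * pi)) * fourier (weighted_fourier \<sigma> \<phi>) (- x)"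
  by (simp add: bessel_op_def fourier_def[of "weighted_fourier \<sigma> \<phi>"] weighted_fourier_def weight_def mult_ac)

lemma weighted_fourier_decay:
  assumes p: "\<phi> \<in> schwartz"
  shows "\<exists>C\<ge>0. \<forall>\<xi>. cmod (weighted_fourier \<sigma> \<phi> \<xi>) \<le> C / (1 + \<xi>\<^sup>2)"
proof -
  \<comment> \<open>One power more than the weight needs, so that \<open>1 / (1 + \<xi>\<^sup>2)\<close> remains.\<close>
  define k where "k = nat \<lceil>\<sigma> / 2\<rceil> + 1"
  obtain C where C: "\<And>\<xi>. (1 + \<xi>\<^sup>2) ^ k * cmod (fourier \<phi> \<xi>) \<le> C"
    using fourier_schwartz_decay[OF p] by blast
  have "cmod (weighted_fourier \<sigma> \<phi> \<xi>) \<le> C / (1 + \<xi>\<^sup>2)" for \<xi>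
  proof -
    define b where "b = 1 + \<xi>\<^sup>2"
    have b: "b \<ge> 1" by (simp add: b_def)
    have "weight \<sigma> \<xi> \<le> b powr (real k - 1)"
      unfolding weight_def b_def[symmetric] by (rule powr_mono[OF _ b]) (simp add: k_def, linarith)
    also have "\<dots> = b ^ k / b" using b by (simp add: powr_diff powr_realpow)
    finally have w: "weight \<sigma> \<xi> \<le> b ^ k / b" .
    have "cmod (weighted_fourier \<sigma> \<phi> \<xi>) = weight \<sigma> \<xi> * cmod (fourier \<phi> \<xi>)"
      using weight_pos[of \<sigma> \<xi>] by (simp add: weighted_fourier_def norm_mult)
    also have "\<dots> \<le> b ^ k / b * cmod (fourier \<phi> \<xi>)" by (rule mult_right_mono[OF w]) simp
    also have "\<dots> \<le> C / b" using C[of \<xi>] b by (simp add: b_def divide_right_mono)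
    finally show ?thesis by (simp add: b_def)
  qed
  moreover have "C \<ge> 0" using C[of 0] by simp (metis norm_ge_zero order_trans)
  ultimately show ?thesis by blast
qed

lemma weighted_fourier_continuous: "\<phi> \<in> schwartz \<Longrightarrow> continuous_on S (weighted_fourier \<sigma> \<phi>)"
  unfolding weighted_fourier_def[abs_def]
  by (intro continuous_intros continuous_weight continuous_fourier schwartz_integrable)

lemma weighted_fourier_measurable: "\<phi> \<in> schwartz \<Longrightarrow> weighted_fourier \<sigma> \<phi> \<in> borel_measurable borel"
  by (rule borel_measurable_continuous_onI) (rule weighted_fourier_continuous)

lemma weighted_fourier_bounded: "\<phi> \<in> schwartz \<Longrightarrow> \<exists>C. \<forall>x. cmod (weighted_fourier \<sigma> \<phi> x) \<le> C"
  using weighted_fourier_decay[of \<phi> \<sigma>] quadratic_decay_bounded order_trans by meson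

lemma weighted_fourier_integrable: "\<phi> \<in> schwartz \<Longrightarrow> integrable lborel (weighted_fourier \<sigma> \<phi>)"
  using weighted_fourier_decay[of \<phi> \<sigma>] integrable_of_quadratic_decay[OF weighted_fourier_measurable] by blast

lemma weighted_fourier_square_integrable:
  "\<phi> \<in> schwartz \<Longrightarrow> integrable lborel (\<lambda>x. (cmod (weighted_fourier \<sigma> \<phi> x))\<^sup>2)"
  using weighted_fourier_bounded[of \<phi> \<sigma>]
    square_integrable_of_bounded[OF weighted_fourier_integrable weighted_fourier_measurable] by blast

lemma bessel_op_measurable: "\<phi> \<in> schwartz \<Longrightarrow> bessel_op \<sigma> \<phi> \<in> borel_measurable borel"
  unfolding bessel_op_eq[abs_def]
  using measurable_compose[OF _ measurable_fourier[OF weighted_fourier_integrable], of uminus borel \<phi> \<sigma>] by simp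

lemma bessel_op_square_integrable:
  assumes p: "\<phi> \<in> schwartz"
  shows "integrable lborel (\<lambda>x. (cmod (bessel_op \<sigma> \<phi> x))\<^sup>2)"
    and "(LINT x|lborel. (cmod (bessel_op \<sigma> \<phi> x))\<^sup>2) \<le> (1 / (2 * pi)) * (LINT \<xi>|lborel. (cmod (weighted_fourier \<sigma> \<phi> \<xi>))\<^sup>2)"
proof -
  define F where "F x = (cmod (fourier (weighted_fourier \<sigma> \<phi>) x))\<^sup>2" for x
  note P = plancherel_inequality[OF weighted_fourier_integrable[OF p, of \<sigma>] weighted_fourier_square_integrable[OF p], folded F_def]
  have eq: "(cmod (bessel_op \<sigma> \<phi> x))\<^sup>2 = (1 / (2 * pi))\<^sup>2 * F (- x)" for x
    by (simp add: bessel_op_eq norm_mult norm_divide power_mult_distrib power_divide F_def)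
  have iF: "integrable lborel (\<lambda>x. F (- x))" using lborel_integrable_real_affine[OF P(1), of "-1" 0] by simp
  have IF: "(LINT x|lborel. F (- x)) = (LINT x|lborel. F x)" using lborel_integral_real_affine[of "-1" F 0] by simp
  show "integrable lborel (\<lambda>x. (cmod (bessel_op \<sigma> \<phi> x))\<^sup>2)" unfolding eq using iF by (rule integrable_mult_right)
  have "(LINT x|lborel. (cmod (bessel_op \<sigma> \<phi> x))\<^sup>2) = (1 / (2 * pi))\<^sup>2 * (LINT x|lborel. F x)"
    unfolding eq by (simp only: integral_mult_right_zero IF)
  also have "\<dots> \<le> (1 / (2 * pi))\<^sup>2 * (2 * pi * (LINT \<xi>|lborel. (cmod (weighted_fourier \<sigma> \<phi> \<xi>))\<^sup>2))"
    by (rule mult_left_mono[OF P(2)]) simp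
  also have "\<dots> = (1 / (2 * pi)) * (LINT \<xi>|lborel. (cmod (weighted_fourier \<sigma> \<phi> \<xi>))\<^sup>2)"
    by (simp add: power2_eq_square)
  finally show "(LINT x|lborel. (cmod (bessel_op \<sigma> \<phi> x))\<^sup>2) \<le> (1 / (2 * pi)) * (LINT \<xi>|lborel. (cmod (weighted_fourier \<sigma> \<phi> \<xi>))\<^sup>2)" .
qed

text \<open>A quadratic polynomial that is nowhere negative has no positive discriminant.\<close>

lemma quadratic_nonneg_imp:
  fixes A B X :: real
  assumes "\<And>t. A - 2 * t * X + t\<^sup>2 * B \<ge> 0" "A \<ge> 0" "B \<ge> 0"
  shows "X\<^sup>2 \<le> A * B"
proof (cases "B = 0")
  case True
  have "X = 0"
  proof (rule ccontr)
    assume "X \<noteq> 0"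
    then show False using assms(1)[of "(A + 1) / (2 * X)"] True by simp
  qed
  then show ?thesis using True by simp
next
  case False
  then have "B > 0" using assms(3) by simp
  have "A - 2 * (X / B) * X + (X / B)\<^sup>2 * B = A - X\<^sup>2 / B"
    using \<open>B > 0\<close> by (simp add: field_simps power2_eq_square)
  then have "X\<^sup>2 / B \<le> A" using assms(1)[of "X / B"] by simp
  then show ?thesis using \<open>B > 0\<close> by (simp add: field_simps)
qed

lemma integral_Cauchy_Schwarz:
  fixes f g :: "real \<Rightarrow> real"
  assumes [measurable]: "f \<in> borel_measurable borel" "g \<in> borel_measurable borel"
    and f2: "integrable lborel (\<lambda>x. (f x)\<^sup>2)" and g2: "integrable lborel (\<lambda>x. (g x)\<^sup>2)"
  shows "integrable lborel (\<lambda>x. f x * g x)"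
    and "(LINT x|lborel. f x * g x) \<le> sqrt (LINT x|lborel. (f x)\<^sup>2) * sqrt (LINT x|lborel. (g x)\<^sup>2)"
proof -
  show fg: "integrable lborel (\<lambda>x. f x * g x)"
  proof (rule Bochner_Integration.integrable_bound)
    show "integrable lborel (\<lambda>x. (f x)\<^sup>2 + (g x)\<^sup>2)" using f2 g2 by simp
    show "AE x in lborel. norm (f x * g x) \<le> norm ((f x)\<^sup>2 + (g x)\<^sup>2)"
    proof (rule AE_I2)
      fix x
      have "2 * (\<bar>f x\<bar> * \<bar>g x\<bar>) \<le> (f x)\<^sup>2 + (g x)\<^sup>2"
        using sum_squares_bound[of "\<bar>f x\<bar>" "\<bar>g x\<bar>"] by simp
      moreover have "0 \<le> \<bar>f x\<bar> * \<bar>g x\<bar>" by simp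
      ultimately have "\<bar>f x\<bar> * \<bar>g x\<bar> \<le> (f x)\<^sup>2 + (g x)\<^sup>2" by linarith
      then show "norm (f x * g x) \<le> norm ((f x)\<^sup>2 + (g x)\<^sup>2)" by (simp add: abs_mult)
    qed
  qed measurable
  define A B X where "A = (LINT x|lborel. (f x)\<^sup>2)" and "B = (LINT x|lborel. (g x)\<^sup>2)" and "X = (LINT x|lborel. f x * g x)"
  have "A - 2 * t * X + t\<^sup>2 * B \<ge> 0" for t
  proof -
    have "0 \<le> (LINT x|lborel. (f x - t * g x)\<^sup>2)" by (rule integral_nonneg_AE) simp
    also have "\<dots> = (LINT x|lborel. ((f x)\<^sup>2 - (2 * t) * (f x * g x)) + t\<^sup>2 * (g x)\<^sup>2)"
      by (rule Bochner_Integration.integral_cong) (auto simp: power2_eq_square algebra_simps)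
    also have "\<dots> = A - (2 * t) * X + t\<^sup>2 * B"
      unfolding A_def B_def X_def using f2 g2 fg
      by (subst Bochner_Integration.integral_add, simp, simp, subst Bochner_Integration.integral_diff) simp_all
    finally show ?thesis by simp
  qed
  then have "X\<^sup>2 \<le> A * B"
    by (rule quadratic_nonneg_imp) (simp_all add: A_def B_def)
  then have "X \<le> sqrt (A * B)" by (rule real_le_rsqrt)
  then show "X \<le> sqrt A * sqrt B" by (simp add: real_sqrt_mult)
qed

lemma integrable_mult_of_squares:
  fixes f g :: "real \<Rightarrow> complex"
  assumes [measurable]: "f \<in> borel_measurable borel" "g \<in> borel_measurable borel"
    and "integrable lborel (\<lambda>x. (cmod (f x))\<^sup>2)" "integrable lborel (\<lambda>x. (cmod (g x))\<^sup>2)"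
  shows "integrable lborel (\<lambda>x. f x * g x)"
  by (rule Bochner_Integration.integrable_bound[OF integral_Cauchy_Schwarz(1)[of "\<lambda>x. cmod (f x)" "\<lambda>x. cmod (g x)"]])
     (use assms in \<open>auto simp: norm_mult\<close>)

text \<open>The operators with exponents \<open>\<sigma>\<close> and \<open>- \<sigma>\<close> are inverse to each other's transposes. Parseval's
  formula is used once for the potentials and once to return from the transforms to the functions.\<close>

lemma bessel_op_duality:
  assumes p: "\<phi> \<in> schwartz" and f: "f \<in> schwartz"
  shows "(LINT x|lborel. bessel_op (- \<sigma>) \<phi> x * bessel_op \<sigma> f x) = (LINT x|lborel. \<phi> x * f x)"
proof -
  define h where "h = weighted_fourier (- \<sigma>) \<phi>"
  define k where "k = weighted_fourier \<sigma> f"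
  have h: "integrable lborel h" and k: "integrable lborel k" and kc: "continuous_on UNIV k"
    unfolding h_def k_def using p f by (auto intro: weighted_fourier_integrable weighted_fourier_continuous)
  obtain C where C: "\<And>x. cmod (k x) \<le> C" unfolding k_def using weighted_fourier_bounded[OF f] by blast
  obtain B where B: "\<And>x. cmod (f x) \<le> B" using schwartz_bounded[OF f] by blast
  have [measurable]: "fourier h \<in> borel_measurable borel" "fourier k \<in> borel_measurable borel"
    using h k by (auto intro: measurable_fourier)
  have prod: "integrable lborel (\<lambda>x. fourier h x * fourier k x)"
    unfolding h_def k_def
    by (rule integrable_mult_of_squares)
       (use p f in \<open>auto intro!: measurable_fourier weighted_fourier_integrable plancherel_inequality(1) weighted_fourier_square_integrable\<close>)
  have hk: "h \<xi> * k (- \<xi>) = fourier \<phi> \<xi> * fourier (\<lambda>x. f (- x)) \<xi>" for \<xi>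
  proof -
    have "h \<xi> * k (- \<xi>) = of_real (weight (- \<sigma>) \<xi> * weight \<sigma> \<xi>) * (fourier \<phi> \<xi> * fourier f (- \<xi>))"
      by (simp add: h_def k_def weighted_fourier_def weight_minus)
    then show ?thesis by (simp add: weight_inverse fourier_reflection)
  qed
  have "(LINT x|lborel. bessel_op (- \<sigma>) \<phi> x * bessel_op \<sigma> f x)
      = (LINT x|lborel. (of_real (1 / (2 * pi)))\<^sup>2 * (fourier h (- x) * fourier k (- x)))"
    by (simp add: bessel_op_eq h_def k_def power2_eq_square mult_ac)
  also have "\<dots> = (of_real (1 / (2 * pi)))\<^sup>2 * (LINT x|lborel. fourier h x * fourier k x)"
    using lborel_integral_real_affine[of "-1" "\<lambda>x. fourier h x * fourier k x" 0] by simp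
  also have "(LINT x|lborel. fourier h x * fourier k x) = of_real (2 * pi) * (LINT \<xi>|lborel. h \<xi> * k (- \<xi>))"
    by (rule parseval[OF h k kc C prod])
  also have "(LINT \<xi>|lborel. h \<xi> * k (- \<xi>)) = (LINT \<xi>|lborel. fourier \<phi> \<xi> * fourier (\<lambda>x. f (- x)) \<xi>)"
    by (simp only: hk)
  also have "(LINT \<xi>|lborel. fourier \<phi> \<xi> * fourier (\<lambda>x. f (- x)) \<xi>) = of_real (2 * pi) * (LINT x|lborel. \<phi> x * f (- (- x)))"
  proof (rule parseval[where C = B])
    show "integrable lborel \<phi>" by (rule schwartz_integrable[OF p])
    show fr: "integrable lborel (\<lambda>x. f (- x))"
      using lborel_integrable_real_affine[OF schwartz_integrable[OF f], of "-1" 0] by simp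
    show "continuous_on UNIV (\<lambda>x. f (- x))"
      by (rule continuous_on_compose2[OF schwartz_continuous[OF f, of UNIV]]) (auto intro: continuous_intros)
    show "cmod (f (- x)) \<le> B" for x by (rule B)
    have "integrable lborel (\<lambda>x. fourier (\<lambda>x. f (- x)) x * weighted_fourier 0 \<phi> x)"
      by (rule integrable_fourier_mult[OF fr weighted_fourier_integrable[OF p]])
    moreover have "weighted_fourier 0 \<phi> = fourier \<phi>"
    proof
      fix x :: real
      have "1 + x\<^sup>2 \<noteq> 0" by (rule one_plus_square_neq_0)
      then show "weighted_fourier 0 \<phi> x = fourier \<phi> x" by (simp add: weighted_fourier_def weight_def)
    qed
    ultimately show "integrable lborel (\<lambda>x. fourier \<phi> x * fourier (\<lambda>x. f (- x)) x)" by (simp add: mult.commute)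
  qed
  finally show ?thesis by (simp add: power2_eq_square)
qed

section \<open>Square integrable spinor fields\<close>

lemma powr_2_eq: "x \<ge> 0 \<Longrightarrow> x powr 2 = (x::real)\<^sup>2"
  by (cases "x = 0") (auto simp: powr_numeral)

lemma Lp_space_2: "f \<in> Lp_space 2 \<longleftrightarrow> f \<in> borel_measurable borel \<and> integrable lborel (\<lambda>x. (norm (f x))\<^sup>2)"
  by (simp add: Lp_space_def powr_2_eq)

lemma Lp_norm_2: "Lp_norm 2 f = sqrt (LINT x|lborel. (norm (f x))\<^sup>2)"
  by (simp add: Lp_norm_def powr_2_eq powr_half_sqrt)

lemma Lp_norm_nonneg: "Lp_norm p f \<ge> 0"
  by (simp add: Lp_norm_def)

lemma norm_vector_smult: "norm (c *s (z::spinor)) = cmod c * norm z"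
proof -
  have "(norm (c *s z))\<^sup>2 = (cmod c * norm z)\<^sup>2"
    by (simp add: norm_vec_def L2_set_def sum_nonneg norm_mult power_mult_distrib sum_distrib_left)
  then show ?thesis by (simp add: power2_eq_iff_nonneg)
qed

lemma of_real_smult: "complex_of_real r *s (z::spinor) = r *\<^sub>R z"
  by (simp add: vec_eq_iff) (simp add: scaleR_conv_of_real)

lemma smult_scaleR_sum: "c *s (z::spinor) = Re c *\<^sub>R z + Im c *\<^sub>R (\<i> *s z)"
  by (simp add: vec_eq_iff complex_eq_iff)

lemma bounded_linear_smult_right: "bounded_linear (\<lambda>z::spinor. c *s z)"
  by (rule bounded_linear_intro[where K = "cmod c"])
     (simp_all add: vec_eq_iff algebra_simps norm_vector_smult)

lemma bounded_linear_smult_left: "bounded_linear (\<lambda>c. c *s (z::spinor))"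
  by (rule bounded_linear_intro[where K = "norm z"])
     (simp_all add: vec_eq_iff algebra_simps norm_vector_smult)

lemma measurable_smult [measurable]:
  assumes [measurable]: "k \<in> borel_measurable M" "f \<in> borel_measurable M"
  shows "(\<lambda>x. k x *s (f x :: spinor)) \<in> borel_measurable M"
proof -
  have "(\<lambda>z. \<i> *s (z::spinor)) \<in> borel_measurable borel"
    by (intro borel_measurable_continuous_onI linear_continuous_on bounded_linear_smult_right)
  note [measurable] = measurable_compose[OF assms(2) this]
  show ?thesis unfolding smult_scaleR_sum[of "k _"] by measurable
qed

lemma regular_estimate:
  assumes F: "F \<in> Lp_space 2" and [measurable]: "k \<in> borel_measurable borel" and k2: "integrable lborel (\<lambda>x. (cmod (k x))\<^sup>2)"
  shows "integrable lborel (\<lambda>x. k x *s F x)"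
    and "norm (regular F k) \<le> Lp_norm 2 F * sqrt (LINT x|lborel. (cmod (k x))\<^sup>2)"
proof -
  have [measurable]: "F \<in> borel_measurable borel" and F2: "integrable lborel (\<lambda>x. (norm (F x))\<^sup>2)"
    using F by (auto simp: Lp_space_2)
  note CS = integral_Cauchy_Schwarz[of "\<lambda>x. cmod (k x)" "\<lambda>x. norm (F x)", OF _ _ k2 F2]
  show "integrable lborel (\<lambda>x. k x *s F x)"
    by (rule Bochner_Integration.integrable_bound[OF CS(1)]) (auto simp: norm_vector_smult)
  have "norm (regular F k) \<le> (LINT x|lborel. cmod (k x) * norm (F x))"
    unfolding regular_def by (rule order_trans[OF integral_norm_bound]) (simp add: norm_vector_smult)
  also have "\<dots> \<le> Lp_norm 2 F * sqrt (LINT x|lborel. (cmod (k x))\<^sup>2)"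
    using CS(2) by (simp add: Lp_norm_2 mult.commute)
  finally show "norm (regular F k) \<le> Lp_norm 2 F * sqrt (LINT x|lborel. (cmod (k x))\<^sup>2)" .
qed

lemma regular_schwartz_integrable: "w \<in> Lp_space 2 \<Longrightarrow> \<phi> \<in> schwartz \<Longrightarrow> integrable lborel (\<lambda>x. \<phi> x *s w x)"
  by (rule regular_estimate(1)[OF _ schwartz_measurable schwartz_square_integrable])

lemma regular_bessel_integrable: "F \<in> Lp_space 2 \<Longrightarrow> \<phi> \<in> schwartz \<Longrightarrow> integrable lborel (\<lambda>x. bessel_op \<sigma> \<phi> x *s F x)"
  by (rule regular_estimate(1)[OF _ bessel_op_measurable bessel_op_square_integrable(1)])

lemma Lp_space_diff:
  assumes p: "p \<ge> 1" and f: "f \<in> Lp_space p" and g: "g \<in> Lp_space p"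
  shows "(\<lambda>x. f x - g x) \<in> Lp_space p"
proof -
  have [measurable]: "f \<in> borel_measurable borel" "g \<in> borel_measurable borel"
    and i: "integrable lborel (\<lambda>x. norm (f x) powr p)" "integrable lborel (\<lambda>x. norm (g x) powr p)"
    using f g by (auto simp: Lp_space_def)
  have "integrable lborel (\<lambda>x. norm (f x - g x) powr p)"
  proof (rule Bochner_Integration.integrable_bound)
    show "integrable lborel (\<lambda>x. 2 powr p * (norm (f x) powr p + norm (g x) powr p))" using i by simp
    show "AE x in lborel. norm (norm (f x - g x) powr p) \<le> norm (2 powr p * (norm (f x) powr p + norm (g x) powr p))"
    proof (rule AE_I2)
      fix x
      define M where "M = max (norm (f x)) (norm (g x))"
      have "norm (f x - g x) powr p \<le> (2 * M) powr p"
        using p norm_triangle_ineq4[of "f x" "g x"] by (intro powr_mono2) (auto simp: M_def)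
      also have "\<dots> = 2 powr p * M powr p" by (rule powr_mult)
      also have "M powr p \<le> norm (f x) powr p + norm (g x) powr p" by (simp add: M_def max_def)
      finally have "norm (f x - g x) powr p \<le> 2 powr p * (norm (f x) powr p + norm (g x) powr p)" by simp
      then show "norm (norm (f x - g x) powr p) \<le> norm (2 powr p * (norm (f x) powr p + norm (g x) powr p))"
        by simp
    qed
  qed measurable
  then show ?thesis by (simp add: Lp_space_def)
qed

lemma regular_diff_schwartz:
  assumes "f \<in> Lp_space 2" "g \<in> Lp_space 2" "\<phi> \<in> schwartz"
  shows "regular (\<lambda>x. f x - g x) \<phi> = regular f \<phi> - regular g \<phi>"
  unfolding regular_def vec.scale_right_diff_distrib
  by (rule Bochner_Integration.integral_diff) (use assms in \<open>auto intro: regular_schwartz_integrable\<close>)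

lemma Hs_rep_diff:
  assumes "Hs_rep s u F" "Hs_rep s v G"
  shows "Hs_rep s (\<lambda>\<phi>. u \<phi> - v \<phi>) (\<lambda>x. F x - G x)"
  using assms unfolding Hs_rep_def regular_def vec.scale_right_diff_distrib
  by (auto simp: Lp_space_diff Bochner_Integration.integral_diff regular_bessel_integrable)

lemma Hs_dist_less:
  assumes u: "u \<in> Hs_space s" and v: "v \<in> Hs_space s" and d: "Hs_dist s u v < \<epsilon>"
  obtains F where "Hs_rep s (\<lambda>\<phi>. u \<phi> - v \<phi>) F" "Lp_norm 2 F < \<epsilon>"
proof -
  let ?S = "{Lp_norm 2 f | f. Hs_rep s (\<lambda>\<phi>. u \<phi> - v \<phi>) f}"
  obtain F G where "Hs_rep s u F" "Hs_rep s v G" using u v by (auto simp: Hs_space_def)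
  then have "?S \<noteq> {}" using Hs_rep_diff by blast
  moreover have "Inf ?S < \<epsilon>" using d by (simp add: Hs_dist_def Hs_norm_def)
  ultimately have "\<exists>y\<in>?S. y < \<epsilon>" by (rule cInf_lessD)
  then show ?thesis using that by blast
qed

lemma Hs_norm_le: "Hs_rep s u F \<Longrightarrow> Hs_norm s u \<le> Lp_norm 2 F"
  unfolding Hs_norm_def by (rule cInf_lower) (auto intro!: bdd_belowI[of _ 0] Lp_norm_nonneg)

section \<open>Continuous representatives of \<open>H\<^sup>1\<close> functions\<close>

text \<open>The norm of \<open>H\<^sup>-\<^sup>1\<close>, the dual space of \<open>H\<^sup>1\<close>.\<close>

definition dual_norm :: "(real \<Rightarrow> complex) \<Rightarrow> real" where
  "dual_norm \<phi> = sqrt (1 / (2 * pi) * (LINT \<xi>|lborel. (cmod (fourier \<phi> \<xi>))\<^sup>2 / (1 + \<xi>\<^sup>2)))"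

lemma weighted_fourier_minus_1_sq: "(cmod (weighted_fourier (- 1) \<phi> \<xi>))\<^sup>2 = (cmod (fourier \<phi> \<xi>))\<^sup>2 / (1 + \<xi>\<^sup>2)"
proof -
  have "(weight (- 1) \<xi>)\<^sup>2 = 1 / (1 + \<xi>\<^sup>2)"
    unfolding weight_sq using one_plus_square_neq_0[of \<xi>] by (simp add: powr_minus inverse_eq_divide add_nonneg_nonneg)
  then show ?thesis by (simp add: weighted_fourier_def norm_mult power_mult_distrib)
qed

lemma H1_dual_estimate:
  assumes F: "Hs_rep 1 u F" and p: "\<phi> \<in> schwartz"
  shows "norm (u \<phi>) \<le> Lp_norm 2 F * dual_norm \<phi>"
proof -
  have "norm (u \<phi>) = norm (regular F (bessel_op (- 1) \<phi>))" using F p by (simp add: Hs_rep_def)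
  also have "\<dots> \<le> Lp_norm 2 F * sqrt (LINT x|lborel. (cmod (bessel_op (- 1) \<phi> x))\<^sup>2)"
    using F by (intro regular_estimate(2) bessel_op_measurable bessel_op_square_integrable p) (simp add: Hs_rep_def)
  also have "\<dots> \<le> Lp_norm 2 F * dual_norm \<phi>"
    unfolding dual_norm_def using bessel_op_square_integrable(2)[OF p, of "- 1"]
    by (intro mult_left_mono Lp_norm_nonneg real_sqrt_le_mono) (simp add: weighted_fourier_minus_1_sq)
  finally show ?thesis .
qed

lemma schwartz_of_compactly_supported:
  assumes D: "smooth_family D" and c: "compactly_supported (D 0)"
  shows "(\<lambda>x. complex_of_real (D 0 x)) \<in> schwartz"
proof -
  obtain R where R: "\<And>x. \<bar>x\<bar> > R \<Longrightarrow> D 0 x = 0" using c by (auto simp: compactly_supported_def)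
  have "schwartz_family (\<lambda>n x. complex_of_real (D n x))"
    unfolding schwartz_family_def
  proof safe
    fix n x
    show "((\<lambda>x. complex_of_real (D n x)) has_vector_derivative complex_of_real (D (Suc n) x)) (at x)"
      using smooth_familyD[OF D] by (intro has_vector_derivative_of_real) (simp add: has_real_derivative_iff_has_vector_derivative)
  next
    fix n k
    have "compact ((\<lambda>x. x ^ k *\<^sub>R complex_of_real (D n x)) ` {-R..R})"
      by (intro compact_continuous_image continuous_intros smooth_family_continuous[OF D] compact_Icc)
    then have b: "bounded (insert 0 ((\<lambda>x. x ^ k *\<^sub>R complex_of_real (D n x)) ` {-R..R}))"
      by (simp add: compact_imp_bounded)
    show "bounded (range (\<lambda>x. x ^ k *\<^sub>R complex_of_real (D n x)))"
    proof (rule bounded_subset[OF b], safe)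
      fix x
      assume "x ^ k *\<^sub>R complex_of_real (D n x) \<notin> (\<lambda>x. x ^ k *\<^sub>R complex_of_real (D n x)) ` {-R..R}"
      then have "x \<notin> {-R..R}" by blast
      then have "D n x = 0" by (intro smooth_family_support[OF D R]) auto
      then show "x ^ k *\<^sub>R complex_of_real (D n x) = 0" by simp
    qed
  qed
  then show ?thesis unfolding schwartz_iff by (intro exI conjI) auto
qed

lemma bump_eq: "bump x \<delta> 0 y = exp_flat 0 (1 + (y - x) / \<delta>) * exp_flat 0 (1 - (y - x) / \<delta>)"
  by (simp add: bump_def)

lemma bump_sym: "bump x \<delta> 0 y = bump y \<delta> 0 x"
  by (simp add: bump_eq diff_divide_distrib mult.commute algebra_simps)

definition bump_mass :: real where "bump_mass = (LINT x|lborel. bump 0 1 0 x)"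

definition mollifier :: "real \<Rightarrow> real \<Rightarrow> real \<Rightarrow> real" where
  "mollifier \<delta> x y = bump x \<delta> 0 y / (\<delta> * bump_mass)"

lemma bump_integrable: "\<delta> > 0 \<Longrightarrow> integrable lborel (bump x \<delta> 0)"
  by (rule LINT_eq_integral_of_support(1)[where R = "\<bar>x\<bar> + \<delta>"])
     (auto intro!: smooth_family_continuous[OF smooth_family_bump] bump_zero)

lemma bump_mass_pos: "bump_mass > 0"
proof -
  have nn: "bump 0 1 0 x \<ge> 0" for x by (rule bump_nonneg) simp
  have "bump_mass \<ge> 0" unfolding bump_mass_def by (rule integral_nonneg_AE) (simp add: nn)
  moreover have "bump_mass \<noteq> 0"
  proof
    assume 0: "bump_mass = 0"
    have "(1::real) = 0"
    proof (rule zero_of_bump_integrals[where h = "\<lambda>x. 1" and y = 0])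
      fix \<delta> :: real assume "\<delta> > 0"
      have "(LINT x|lborel. bump 0 \<delta> 0 x) = \<delta> * (LINT x|lborel. bump 0 \<delta> 0 (0 + \<delta> * x))"
        using lborel_integral_real_affine[of \<delta> "bump 0 \<delta> 0" 0] \<open>\<delta> > 0\<close> by simp
      also have "(LINT x|lborel. bump 0 \<delta> 0 (0 + \<delta> * x)) = bump_mass"
      proof -
        have "bump 0 \<delta> 0 (0 + \<delta> * x) = bump 0 1 0 x" for x using \<open>\<delta> > 0\<close> by (simp add: bump_eq)
        then show ?thesis by (simp only: bump_mass_def)
      qed
      finally show "(LINT x|lborel. bump 0 \<delta> 0 x *\<^sub>R 1) = (0::real)" using 0 by simp
    qed simp
    then show False by simp
  qed
  ultimately show ?thesis by simp
qed

lemma mollifier_sym: "mollifier \<delta> x y = mollifier \<delta> y x"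
  by (simp add: mollifier_def bump_sym)

lemma mollifier_nonneg: "\<delta> > 0 \<Longrightarrow> mollifier \<delta> x y \<ge> 0"
  unfolding mollifier_def using bump_nonneg bump_mass_pos by (simp add: less_imp_le)

lemma mollifier_zero: "\<delta> > 0 \<Longrightarrow> \<bar>y - x\<bar> \<ge> \<delta> \<Longrightarrow> mollifier \<delta> x y = 0"
  by (simp add: mollifier_def bump_zero)

lemma mollifier_rescale: "\<delta> > 0 \<Longrightarrow> mollifier \<delta> x (x + \<delta> * y) = mollifier 1 0 y / \<delta>"
  by (simp add: mollifier_def bump_eq)

lemma mollifier_integrable: "\<delta> > 0 \<Longrightarrow> integrable lborel (mollifier \<delta> x)"
  unfolding mollifier_def[abs_def] by (rule integrable_divide) (rule bump_integrable)

lemma mollifier_integral: "\<delta> > 0 \<Longrightarrow> (LINT y|lborel. mollifier \<delta> x y) = 1"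
proof -
  assume d: "\<delta> > 0"
  have "(LINT y|lborel. mollifier \<delta> x y) = \<delta> * (LINT y|lborel. mollifier \<delta> x (x + \<delta> * y))"
    using lborel_integral_real_affine[of \<delta> "mollifier \<delta> x" x] d by simp
  also have "\<dots> = (LINT y|lborel. mollifier 1 0 y)" using d by (simp add: mollifier_rescale)
  also have "\<dots> = 1" using bump_mass_pos by (simp add: mollifier_def bump_mass_def)
  finally show ?thesis .
qed

lemma exp_flat_measurable [measurable]: "exp_flat n \<in> borel_measurable borel"
  by (rule borel_measurable_continuous_onI) (rule smooth_family_continuous[OF smooth_family_exp_flat])

lemma mollifier_measurable [measurable]:
  "(\<lambda>(x, y). mollifier \<delta> x y) \<in> borel_measurable (lborel \<Otimes>\<^sub>M lborel)"
  "mollifier \<delta> x \<in> borel_measurable borel"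
  unfolding mollifier_def[abs_def] bump_eq by measurable

lemma mollifier_schwartz: "\<delta> > 0 \<Longrightarrow> (\<lambda>y. complex_of_real (mollifier \<delta> x y)) \<in> schwartz"
proof -
  assume d: "\<delta> > 0"
  have "(\<lambda>y. complex_of_real (bump x \<delta> 0 y)) \<in> schwartz"
    by (rule schwartz_of_compactly_supported[OF smooth_family_bump bump_compactly_supported[OF d]])
  from schwartz_combination[OF this this, of "of_real (1 / (\<delta> * bump_mass))" 0]
  show ?thesis by (simp add: mollifier_def)
qed

definition mollifier_hat :: "real \<Rightarrow> complex" where
  "mollifier_hat = fourier (\<lambda>y. complex_of_real (mollifier 1 0 y))"

text \<open>Translation of the mollifier multiplies its transform by a phase, which makes all estimates uniform
  in the centre \<open>x\<close>.\<close>

lemma fourier_mollifier: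
  assumes d: "\<delta> > 0"
  shows "fourier (\<lambda>y. complex_of_real (mollifier \<delta> x y)) \<xi> = exp (- \<i> * of_real (x * \<xi>)) * mollifier_hat (\<delta> * \<xi>)"
proof -
  have "fourier (\<lambda>y. complex_of_real (mollifier \<delta> x y)) \<xi>
      = of_real \<delta> * (LINT y|lborel. exp (- \<i> * of_real ((x + \<delta> * y) * \<xi>)) * of_real (mollifier \<delta> x (x + \<delta> * y)))"
    unfolding fourier_def using d by (subst lborel_integral_real_affine[of \<delta> _ x]) (simp_all add: scaleR_conv_of_real)
  also have "\<dots> = (LINT y|lborel. of_real \<delta> * (exp (- \<i> * of_real ((x + \<delta> * y) * \<xi>)) * of_real (mollifier \<delta> x (x + \<delta> * y))))"
    by (rule integral_mult_right_zero[symmetric])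
  also have "\<dots> = (LINT y|lborel. exp (- \<i> * of_real (x * \<xi>)) * (exp (- \<i> * of_real (y * (\<delta> * \<xi>))) * of_real (mollifier 1 0 y)))"
  proof (rule Bochner_Integration.integral_cong[OF refl])
    fix y
    have "exp (- \<i> * of_real ((x + \<delta> * y) * \<xi>)) = exp (- \<i> * of_real (x * \<xi>)) * exp (- \<i> * of_real (y * (\<delta> * \<xi>)))"
      by (simp add: exp_add[symmetric] algebra_simps)
    then show "of_real \<delta> * (exp (- \<i> * of_real ((x + \<delta> * y) * \<xi>)) * of_real (mollifier \<delta> x (x + \<delta> * y)))
       = exp (- \<i> * of_real (x * \<xi>)) * (exp (- \<i> * of_real (y * (\<delta> * \<xi>))) * of_real (mollifier 1 0 y))"
      unfolding mollifier_rescale[OF d] using d by simp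
  qed
  also have "\<dots> = exp (- \<i> * of_real (x * \<xi>)) * mollifier_hat (\<delta> * \<xi>)"
    unfolding mollifier_hat_def fourier_def by (rule integral_mult_right_zero)
  finally show ?thesis .
qed

lemma mollifier_hat_0: "mollifier_hat 0 = 1"
  by (simp add: mollifier_hat_def fourier_def mollifier_integral)

lemma mollifier_hat_le_1: "cmod (mollifier_hat \<xi>) \<le> 1"
proof -
  have "cmod (mollifier_hat \<xi>) \<le> (LINT y|lborel. cmod (complex_of_real (mollifier 1 0 y)))"
    unfolding mollifier_hat_def by (rule norm_fourier_le) (intro integrable_of_real mollifier_integrable zero_less_one)
  also have "\<dots> = (LINT y|lborel. mollifier 1 0 y)" by (simp add: mollifier_nonneg)
  finally show ?thesis by (simp add: mollifier_integral)
qed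

lemma continuous_mollifier_hat: "continuous_on S mollifier_hat"
  unfolding mollifier_hat_def by (rule continuous_fourier) (intro integrable_of_real mollifier_integrable zero_less_one)

text \<open>Dominated convergence: point evaluations are bounded on \<open>H\<^sup>1\<close> because \<open>1 / (1 + \<xi>\<^sup>2)\<close> is integrable.\<close>

lemma dual_norm_tendsto_0:
  assumes m: "\<And>n. fourier (\<phi> n) \<in> borel_measurable borel" and b: "\<And>n \<xi>. cmod (fourier (\<phi> n) \<xi>) \<le> 2"
    and l: "\<And>\<xi>. (\<lambda>n. fourier (\<phi> n) \<xi>) \<longlonglongrightarrow> 0"
  shows "(\<lambda>n. dual_norm (\<phi> n)) \<longlonglongrightarrow> 0"
proof -
  have "(\<lambda>n. LINT \<xi>|lborel. (cmod (fourier (\<phi> n) \<xi>))\<^sup>2 / (1 + \<xi>\<^sup>2)) \<longlonglongrightarrow> (LINT \<xi>|(lborel :: real measure). 0)"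
  proof (rule integral_dominated_convergence[where w = "\<lambda>\<xi>. 4 * (1 / (1 + \<xi>\<^sup>2))"])
    show "integrable lborel (\<lambda>\<xi>::real. 4 * (1 / (1 + \<xi>\<^sup>2)))"
      by (intro integrable_mult_right integrable_inverse_1_plus_square)
    show "(\<lambda>\<xi>. (cmod (fourier (\<phi> n) \<xi>))\<^sup>2 / (1 + \<xi>\<^sup>2)) \<in> borel_measurable lborel" for n
      using m[of n] by simp
    show "AE \<xi> in lborel. (\<lambda>n. (cmod (fourier (\<phi> n) \<xi>))\<^sup>2 / (1 + \<xi>\<^sup>2)) \<longlonglongrightarrow> 0"
    proof (rule AE_I2)
      fix \<xi> :: real
      have "(\<lambda>n. (cmod (fourier (\<phi> n) \<xi>))\<^sup>2 / (1 + \<xi>\<^sup>2)) \<longlonglongrightarrow> (cmod 0)\<^sup>2 / (1 + \<xi>\<^sup>2)"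
        by (intro tendsto_intros l) (simp add: one_plus_square_neq_0)
      then show "(\<lambda>n. (cmod (fourier (\<phi> n) \<xi>))\<^sup>2 / (1 + \<xi>\<^sup>2)) \<longlonglongrightarrow> 0" by simp
    qed
    show "AE \<xi> in lborel. norm ((cmod (fourier (\<phi> n) \<xi>))\<^sup>2 / (1 + \<xi>\<^sup>2)) \<le> 4 * (1 / (1 + \<xi>\<^sup>2))" for n
    proof (rule AE_I2)
      fix \<xi> :: real
      have "(cmod (fourier (\<phi> n) \<xi>))\<^sup>2 \<le> 2\<^sup>2" by (rule power_mono[OF b]) simp
      then have "(cmod (fourier (\<phi> n) \<xi>))\<^sup>2 / (1 + \<xi>\<^sup>2) \<le> 4 / (1 + \<xi>\<^sup>2)" by (intro divide_right_mono) (auto simp: add_nonneg_nonneg)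
      then show "norm ((cmod (fourier (\<phi> n) \<xi>))\<^sup>2 / (1 + \<xi>\<^sup>2)) \<le> 4 * (1 / (1 + \<xi>\<^sup>2))" by simp
    qed
  qed simp
  then have "(\<lambda>n. sqrt (1 / (2 * pi) * (LINT \<xi>|lborel. (cmod (fourier (\<phi> n) \<xi>))\<^sup>2 / (1 + \<xi>\<^sup>2)))) \<longlonglongrightarrow> sqrt (1 / (2 * pi) * 0)"
    by (intro tendsto_intros) simp
  then show ?thesis by (simp add: dual_norm_def)
qed

lemma schwartz_integrable_exp: "\<phi> \<in> schwartz \<Longrightarrow> integrable lborel (\<lambda>x. exp (- \<i> * of_real (x * \<xi>)) * \<phi> x)"
  by (rule integrable_exp_i_mult[OF schwartz_integrable]) simp_all

lemma fourier_diff_schwartz: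
  "\<phi> \<in> schwartz \<Longrightarrow> \<psi> \<in> schwartz \<Longrightarrow> fourier (\<lambda>x. \<phi> x - \<psi> x) \<xi> = fourier \<phi> \<xi> - fourier \<psi> \<xi>"
  unfolding fourier_def right_diff_distrib
  by (rule Bochner_Integration.integral_diff) (rule schwartz_integrable_exp, assumption)+

lemma fourier_schwartz_measurable: "\<phi> \<in> schwartz \<Longrightarrow> fourier \<phi> \<in> borel_measurable borel"
  by (intro measurable_fourier schwartz_integrable)

definition mollify :: "real \<Rightarrow> field \<Rightarrow> field" where
  "mollify \<delta> w x = regular w (\<lambda>y. complex_of_real (mollifier \<delta> x y))"

definition sobolev_constant :: real where
  "sobolev_constant = sqrt (1 / (2 * pi) * (LINT \<xi>|lborel. 1 / (1 + \<xi>\<^sup>2)))"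

lemma sobolev_constant_nonneg: "sobolev_constant \<ge> 0"
  unfolding sobolev_constant_def by (intro real_sqrt_ge_zero mult_nonneg_nonneg integral_nonneg_AE) (auto simp: add_nonneg_nonneg)

lemma dual_norm_mollifier_le: "\<delta> > 0 \<Longrightarrow> dual_norm (\<lambda>y. complex_of_real (mollifier \<delta> x y)) \<le> sobolev_constant"
proof -
  assume d: "\<delta> > 0"
  have "(LINT \<xi>|lborel. (cmod (fourier (\<lambda>y. complex_of_real (mollifier \<delta> x y)) \<xi>))\<^sup>2 / (1 + \<xi>\<^sup>2))
     \<le> (LINT \<xi>|lborel. 1 / (1 + \<xi>\<^sup>2))"
  proof (rule integral_mono'[OF integrable_inverse_1_plus_square])
    fix \<xi> :: real
    have "(cmod (fourier (\<lambda>y. complex_of_real (mollifier \<delta> x y)) \<xi>))\<^sup>2 \<le> 1\<^sup>2"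
      using mollifier_hat_le_1 by (intro power_mono) (simp_all add: fourier_mollifier[OF d] norm_mult)
    then show "(cmod (fourier (\<lambda>y. complex_of_real (mollifier \<delta> x y)) \<xi>))\<^sup>2 / (1 + \<xi>\<^sup>2) \<le> 1 / (1 + \<xi>\<^sup>2)"
      by (intro divide_right_mono) (auto simp: add_nonneg_nonneg)
  qed (simp add: add_nonneg_nonneg)
  then show ?thesis unfolding dual_norm_def sobolev_constant_def
    by (intro real_sqrt_le_mono mult_left_mono) auto
qed

context
  fixes w F :: field
  assumes w: "w \<in> Lp_space 2" and F: "Hs_rep 1 (regular w) F"
begin

lemma mollify_diff_le:
  assumes "\<delta> > 0" "\<delta>' > 0"
  shows "norm (mollify \<delta> w x - mollify \<delta>' w x') \<le> Lp_norm 2 F *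
     dual_norm (\<lambda>y. complex_of_real (mollifier \<delta> x y) - complex_of_real (mollifier \<delta>' x' y))"
proof -
  note s = mollifier_schwartz[OF assms(1), of x] mollifier_schwartz[OF assms(2), of x']
  have "mollify \<delta> w x - mollify \<delta>' w x' = regular w (\<lambda>y. complex_of_real (mollifier \<delta> x y) - complex_of_real (mollifier \<delta>' x' y))"
    unfolding mollify_def regular_def vec.scale_left_diff_distrib
    by (rule Bochner_Integration.integral_diff[symmetric]) (auto intro!: regular_schwartz_integrable w s)
  then show ?thesis using H1_dual_estimate[OF F schwartz_diff[OF s]] by simp
qed

lemma mollify_bound: "\<delta> > 0 \<Longrightarrow> norm (mollify \<delta> w x) \<le> Lp_norm 2 F * sobolev_constant"
  unfolding mollify_def
  by (rule order_trans[OF H1_dual_estimate[OF F mollifier_schwartz]])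
     (auto intro!: mult_left_mono dual_norm_mollifier_le Lp_norm_nonneg)

lemma continuous_mollify: 
  assumes d: "\<delta> > 0" shows "continuous_on UNIV (mollify \<delta> w)"
  unfolding continuous_on_sequentially
proof (intro ballI allI impI, elim conjE)
  fix X x assume X: "X \<longlonglongrightarrow> (x::real)"
  define \<phi> where "\<phi> n y = complex_of_real (mollifier \<delta> (X n) y) - complex_of_real (mollifier \<delta> x y)" for n y
  have s: "\<phi> n \<in> schwartz" for n unfolding \<phi>_def[abs_def] by (intro schwartz_diff mollifier_schwartz d)
  have f: "fourier (\<phi> n) \<xi> = (exp (- \<i> * of_real (X n * \<xi>)) - exp (- \<i> * of_real (x * \<xi>))) * mollifier_hat (\<delta> * \<xi>)" for n \<xi>
    unfolding \<phi>_def[abs_def] by (simp only: fourier_diff_schwartz mollifier_schwartz d fourier_mollifier left_diff_distrib)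
  have "(\<lambda>n. dual_norm (\<phi> n)) \<longlonglongrightarrow> 0"
  proof (rule dual_norm_tendsto_0)
    show "fourier (\<phi> n) \<in> borel_measurable borel" for n by (rule fourier_schwartz_measurable[OF s])
    show "cmod (fourier (\<phi> n) \<xi>) \<le> 2" for n \<xi>
    proof -
      have "cmod (exp (- \<i> * of_real (X n * \<xi>)) - exp (- \<i> * of_real (x * \<xi>))) \<le> 1 + 1"
        by (rule order_trans[OF norm_triangle_ineq4]) (simp del: of_real_mult)
      from mult_mono[OF this mollifier_hat_le_1[of "\<delta> * \<xi>"]] show ?thesis by (simp add: f norm_mult)
    qed
    show "(\<lambda>n. fourier (\<phi> n) \<xi>) \<longlonglongrightarrow> 0" for \<xi>
    proof -
      have "(\<lambda>n. (exp (- \<i> * of_real (X n * \<xi>)) - exp (- \<i> * of_real (x * \<xi>))) * mollifier_hat (\<delta> * \<xi>))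
         \<longlonglongrightarrow> (exp (- \<i> * of_real (x * \<xi>)) - exp (- \<i> * of_real (x * \<xi>))) * mollifier_hat (\<delta> * \<xi>)"
        by (intro tendsto_intros X)
      then show ?thesis by (simp only: f diff_self mult_zero_left)
    qed
  qed
  then have "(\<lambda>n. Lp_norm 2 F * dual_norm (\<phi> n)) \<longlonglongrightarrow> Lp_norm 2 F * 0" by (intro tendsto_intros)
  then have "(\<lambda>n. Lp_norm 2 F * dual_norm (\<phi> n)) \<longlonglongrightarrow> 0" by simp
  from Lim_null_comparison[OF always_eventually this, of "\<lambda>n. mollify \<delta> w (X n) - mollify \<delta> w x"]
  have "(\<lambda>n. mollify \<delta> w (X n) - mollify \<delta> w x) \<longlonglongrightarrow> 0"
    using mollify_diff_le[OF d d] by (simp add: \<phi>_def[abs_def])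
  then show "(mollify \<delta> w \<circ> X) \<longlonglongrightarrow> mollify \<delta> w x" by (simp add: comp_def LIM_zero_iff)
qed

text \<open>Mollifiers at small scales are close to each other in the dual norm, uniformly in their centre. If
  the mollifications were not uniformly Cauchy, the centres and scales that violate the condition would
  form a sequence of differences of mollifiers whose dual norms stay away from zero.\<close>

lemma mollify_uniformly_convergent: "uniformly_convergent_on UNIV (\<lambda>n. mollify (1 / real (Suc n)) w)"
proof -
  have "uniformly_Cauchy_on UNIV (\<lambda>n. mollify (1 / real (Suc n)) w)"
    unfolding uniformly_Cauchy_on_def
  proof (intro allI impI)
    fix \<epsilon> :: real assume "\<epsilon> > 0"
    show "\<exists>M. \<forall>x\<in>UNIV. \<forall>n\<ge>M. \<forall>k\<ge>M. dist (mollify (1 / real (Suc n)) w x) (mollify (1 / real (Suc k)) w x) < \<epsilon>"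
    proof (rule ccontr)
      assume "\<not> (\<exists>M. \<forall>x\<in>UNIV. \<forall>n\<ge>M. \<forall>k\<ge>M. dist (mollify (1 / real (Suc n)) w x) (mollify (1 / real (Suc k)) w x) < \<epsilon>)"
      then have "\<forall>M. \<exists>x n k. n \<ge> M \<and> k \<ge> M \<and> dist (mollify (1 / real (Suc n)) w x) (mollify (1 / real (Suc k)) w x) \<ge> \<epsilon>"
        by (meson not_less)
      then obtain x n k where nk: "\<And>M. n M \<ge> M" "\<And>M. k M \<ge> M"
        and large: "\<And>M. dist (mollify (1 / real (Suc (n M))) w (x M)) (mollify (1 / real (Suc (k M))) w (x M)) \<ge> \<epsilon>"
        by metis
      define \<phi> where "\<phi> M y = complex_of_real (mollifier (1 / real (Suc (n M))) (x M) y) - complex_of_real (mollifier (1 / real (Suc (k M))) (x M) y)" for M y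
      have pos: "1 / real (Suc i) > 0" for i by simp
      have s: "\<phi> M \<in> schwartz" for M unfolding \<phi>_def[abs_def] by (intro schwartz_diff mollifier_schwartz pos)
      have f: "fourier (\<phi> M) \<xi> = exp (- \<i> * of_real (x M * \<xi>)) * (mollifier_hat (1 / real (Suc (n M)) * \<xi>) - mollifier_hat (1 / real (Suc (k M)) * \<xi>))" for M \<xi>
        unfolding \<phi>_def[abs_def] by (simp only: fourier_diff_schwartz mollifier_schwartz pos fourier_mollifier right_diff_distrib)
      have nf: "cmod (fourier (\<phi> M) \<xi>) = cmod (mollifier_hat (1 / real (Suc (n M)) * \<xi>) - mollifier_hat (1 / real (Suc (k M)) * \<xi>))" for M \<xi>
        unfolding f norm_mult by (simp del: of_real_mult)
      have lim: "(\<lambda>M. mollifier_hat (1 / real (Suc (j M)) * \<xi>)) \<longlonglongrightarrow> 1" if j: "\<And>M. j M \<ge> M" for j \<xi>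
      proof -
        have "filterlim j sequentially sequentially"
          by (rule filterlim_at_top_mono[OF filterlim_ident]) (simp add: j)
        from filterlim_compose[OF LIMSEQ_inverse_real_of_nat this]
        have "(\<lambda>M. inverse (real (Suc (j M))) * \<xi>) \<longlonglongrightarrow> 0 * \<xi>" by (intro tendsto_intros)
        then have "(\<lambda>M. 1 / real (Suc (j M)) * \<xi>) \<longlonglongrightarrow> 0" by (simp add: inverse_eq_divide)
        then have "(\<lambda>M. mollifier_hat (1 / real (Suc (j M)) * \<xi>)) \<longlonglongrightarrow> mollifier_hat 0"
          using continuous_mollifier_hat[of UNIV] by (metis UNIV_I continuous_on_eq_continuous_at isCont_tendsto_compose open_UNIV)
        then show ?thesis by (simp only: mollifier_hat_0)
      qed
      have "(\<lambda>M. dual_norm (\<phi> M)) \<longlonglongrightarrow> 0"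
      proof (rule dual_norm_tendsto_0)
        show "fourier (\<phi> M) \<in> borel_measurable borel" for M by (rule fourier_schwartz_measurable[OF s])
        show "cmod (fourier (\<phi> M) \<xi>) \<le> 2" for M \<xi>
          unfolding nf using norm_triangle_ineq4[of "mollifier_hat (1 / real (Suc (n M)) * \<xi>)" "mollifier_hat (1 / real (Suc (k M)) * \<xi>)"]
            mollifier_hat_le_1[of "1 / real (Suc (n M)) * \<xi>"] mollifier_hat_le_1[of "1 / real (Suc (k M)) * \<xi>"] by linarith
        show "(\<lambda>M. fourier (\<phi> M) \<xi>) \<longlonglongrightarrow> 0" for \<xi>
        proof -
          have "(\<lambda>M. mollifier_hat (1 / real (Suc (n M)) * \<xi>) - mollifier_hat (1 / real (Suc (k M)) * \<xi>)) \<longlonglongrightarrow> 1 - 1"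
            by (intro tendsto_diff lim nk)
          then have "(\<lambda>M. cmod (fourier (\<phi> M) \<xi>)) \<longlonglongrightarrow> 0" unfolding nf by (intro tendsto_norm_zero) simp
          then show ?thesis by (rule tendsto_norm_zero_cancel)
        qed
      qed
      then have "(\<lambda>M. Lp_norm 2 F * dual_norm (\<phi> M)) \<longlonglongrightarrow> Lp_norm 2 F * 0" by (intro tendsto_intros)
      moreover have "\<epsilon> \<le> Lp_norm 2 F * dual_norm (\<phi> M)" for M
        using large[of M] mollify_diff_le[OF pos pos, of "n M" "x M" "k M" "x M"] by (simp add: dist_norm \<phi>_def[abs_def])
      ultimately have "\<epsilon> \<le> Lp_norm 2 F * 0"
        by (intro LIMSEQ_le_const) auto
      with \<open>\<epsilon> > 0\<close> show False by simp
    qed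
  qed
  then show ?thesis by (simp add: uniformly_convergent_eq_Cauchy)
qed

end

lemma integrable_indicat_Icc [simp, intro]: "integrable lborel (indicat_real {a..b::real})"
  by (rule integrable_real_indicator) (simp_all add: emeasure_lborel_Icc_eq)

text \<open>On each bounded interval the sets over which the integral vanishes form a Dynkin system that
  contains the half-lines, so it contains all Borel sets.\<close>

lemma AE_zero_of_interval_integrals:
  fixes r :: "real \<Rightarrow> 'a::euclidean_space"
  assumes i: "\<And>a b. integrable lborel (\<lambda>x. indicat_real {a..b} x *\<^sub>R r x)"
    and z: "\<And>a b. a < b \<Longrightarrow> (LINT x|lborel. indicat_real {a..b} x *\<^sub>R r x) = 0"
  shows "AE x in lborel. r x = 0"
proof -
  have N: "AE x in lborel. indicat_real {- real n..real n} x *\<^sub>R r x = 0" for n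
  proof (rule sigma_finite_measure.density_zero[OF lborel.sigma_finite_measure_axioms])
    define q where "q x = indicat_real {- real n..real n} x *\<^sub>R r x" for x
    have iq: "integrable lborel q" unfolding q_def by (rule i)
    have iA: "A \<in> sets lborel \<Longrightarrow> set_integrable lborel A q" for A
      unfolding set_integrable_def by (rule integrable_mult_indicator[OF _ iq])
    have zz: "(LINT x|lborel. indicat_real {a..b} x *\<^sub>R r x) = 0" for a b
    proof (cases "a < b")
      case False
      have "AE x in lborel. indicat_real {a..b} x *\<^sub>R r x = 0"
        using AE_lborel_singleton[of a] by eventually_elim (use False in \<open>auto simp: indicator_def\<close>)
      then show ?thesis by (rule integral_eq_zero_AE)
    qed (rule z)
    show "integrable lborel (\<lambda>x. indicat_real {- real n..real n} x *\<^sub>R r x)" by (rule i)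
    have sets_eq: "sets (lborel :: real measure) = sigma_sets UNIV (range atMost)" by (simp add: borel_eq_atMost)
    fix A :: "real set" assume "A \<in> sets lborel"
    then have A: "A \<in> sigma_sets UNIV (range atMost)" by (simp only: sets_eq)
    have stable: "Int_stable (range atMost :: real set set)"
      by (auto simp: Int_stable_def)
    have "(range atMost :: real set set) \<subseteq> Pow UNIV" by simp
    from stable this A have "set_lebesgue_integral lborel A q = 0"
    proof (induction rule: sigma_sets_induct_disjoint)
      case (basic A)
      then obtain c where c: "A = {..c}" by auto
      have "(\<lambda>x. indicat_real A x *\<^sub>R q x) = (\<lambda>x. indicat_real {- real n..min c (real n)} x *\<^sub>R r x)"
        by (auto simp: c q_def indicator_def fun_eq_iff)
      then show ?case by (simp add: set_lebesgue_integral_def zz)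
    next
      case empty then show ?case by (simp add: set_lebesgue_integral_def)
    next
      case (compl A)
      then have A: "A \<in> sets lborel" unfolding sets_eq by blast
      have "set_lebesgue_integral lborel (UNIV - A) q = (LINT x|lborel. q x) - set_lebesgue_integral lborel A q"
        unfolding set_lebesgue_integral_def
        by (subst Bochner_Integration.integral_diff[symmetric, OF iq iA[OF A, unfolded set_integrable_def]])
           (auto intro!: Bochner_Integration.integral_cong simp: indicator_def)
      also have "(LINT x|lborel. q x) = 0" unfolding q_def by (rule zz)
      finally show ?case using compl by simp
    next
      case (union A)
      then have m: "A k \<in> sets lborel" for k unfolding sets_eq by blast
      then have "set_lebesgue_integral lborel (\<Union>k. A k) q = (\<Sum>k. set_lebesgue_integral lborel (A k) q)"
        using union by (intro lebesgue_integral_countable_add iA) (auto simp: disjoint_family_on_def)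
      then show ?case using union by simp
    qed
    then show "set_lebesgue_integral lborel A (\<lambda>x. indicat_real {- real n..real n} x *\<^sub>R r x) = 0"
      by (simp add: q_def[abs_def])
  qed
  have "AE x in lborel. \<forall>n. indicat_real {- real n..real n} x *\<^sub>R r x = 0" unfolding AE_all_countable using N by blast
  then show ?thesis
  proof eventually_elim
    case (elim x)
    obtain n where "\<bar>x\<bar> \<le> real n" using real_arch_simple by blast
    then have "x \<in> {- real n..real n}" by auto
    with elim[rule_format, of n] show "r x = 0" by simp
  qed
qed

lemma Lp_2_locally_integrable:
  assumes w: "w \<in> Lp_space 2"
  shows "integrable lborel (\<lambda>x. indicat_real {a..b} x *\<^sub>R w x)"
proof (rule Bochner_Integration.integrable_bound)
  have [measurable]: "w \<in> borel_measurable borel" using w by (simp add: Lp_space_2)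
  show "integrable lborel (\<lambda>x. indicat_real {a..b} x + (norm (w x))\<^sup>2)"
    using w by (intro Bochner_Integration.integrable_add) (auto simp: Lp_space_2)
  show "AE x in lborel. norm (indicat_real {a..b} x *\<^sub>R w x) \<le> norm (indicat_real {a..b} x + (norm (w x))\<^sup>2)"
  proof (rule AE_I2)
    fix x
    have "2 * norm (w x) \<le> 1 + (norm (w x))\<^sup>2" using sum_squares_bound[of 1 "norm (w x)"] by simp
    moreover have "0 \<le> norm (w x)" by simp
    ultimately have "norm (w x) \<le> 1 + (norm (w x))\<^sup>2" by linarith
    then show "norm (indicat_real {a..b} x *\<^sub>R w x) \<le> norm (indicat_real {a..b} x + (norm (w x))\<^sup>2)"
      by (auto simp: indicator_def)
  qed
  show "(\<lambda>x. indicat_real {a..b} x *\<^sub>R w x) \<in> borel_measurable lborel" by measurable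
qed

lemma mollifier_le: "\<exists>M. \<forall>x y. mollifier \<delta> x y \<le> M" if d: "\<delta> > 0"
proof -
  have c: "continuous_on {-\<delta>..\<delta>} (mollifier \<delta> 0)"
    unfolding mollifier_def[abs_def] using d bump_mass_pos
    by (intro continuous_intros smooth_family_continuous[OF smooth_family_bump]) auto
  have "\<exists>z\<in>{-\<delta>..\<delta>}. \<forall>y\<in>{-\<delta>..\<delta>}. mollifier \<delta> 0 y \<le> mollifier \<delta> 0 z"
    by (rule continuous_attains_sup[OF _ _ c]) (use d in auto)
  then obtain z where z: "\<And>y. y \<in> {-\<delta>..\<delta>} \<Longrightarrow> mollifier \<delta> 0 y \<le> mollifier \<delta> 0 z" by blast
  have "mollifier \<delta> 0 y \<le> mollifier \<delta> 0 z" for y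
  proof (cases "y \<in> {-\<delta>..\<delta>}")
    case False
    then have "\<bar>y - 0\<bar> \<ge> \<delta>" by auto
    then show ?thesis using mollifier_zero[OF d, of y 0] mollifier_nonneg[OF d, of 0 z] by simp
  qed (rule z)
  moreover have "mollifier \<delta> x y = mollifier \<delta> 0 (y - x)" for x y by (simp add: mollifier_def bump_eq)
  ultimately show ?thesis by metis
qed

text \<open>Mollification of \<open>w\<close> and integration over an interval is the same as integration of \<open>w\<close> against this
  function (\<open>integral_mollify\<close>).\<close>

definition mollified_indicator :: "real \<Rightarrow> real \<Rightarrow> real \<Rightarrow> real \<Rightarrow> real" where
  "mollified_indicator \<delta> a b y = (LINT x|lborel. indicat_real {a..b} x * mollifier \<delta> x y)"

lemma mollified_indicator_cases:
  assumes d: "\<delta> > 0"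
  shows "a \<le> y - \<delta> \<Longrightarrow> y + \<delta> \<le> b \<Longrightarrow> mollified_indicator \<delta> a b y = 1"
    and "y + \<delta> \<le> a \<or> b \<le> y - \<delta> \<Longrightarrow> mollified_indicator \<delta> a b y = 0"
    and "0 \<le> mollified_indicator \<delta> a b y" "mollified_indicator \<delta> a b y \<le> 1"
proof -
  assume "a \<le> y - \<delta>" "y + \<delta> \<le> b"
  then have "indicat_real {a..b} x * mollifier \<delta> x y = mollifier \<delta> y x" for x
    using mollifier_zero[OF d, of x y] by (cases "\<bar>x - y\<bar> \<ge> \<delta>") (auto simp: mollifier_sym[of \<delta> x y] indicator_def abs_if split: if_splits)
  then show "mollified_indicator \<delta> a b y = 1"
    unfolding mollified_indicator_def by (simp add: mollifier_integral[OF d])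
next
  assume "y + \<delta> \<le> a \<or> b \<le> y - \<delta>"
  then have eq: "indicat_real {a..b} x * mollifier \<delta> x y = 0" for x
    using mollifier_zero[OF d, of x y] by (cases "\<bar>x - y\<bar> \<ge> \<delta>") (auto simp: mollifier_sym[of \<delta> x y] indicator_def abs_if split: if_splits)
  then show "mollified_indicator \<delta> a b y = 0"
    unfolding mollified_indicator_def eq by simp
next
  show "0 \<le> mollified_indicator \<delta> a b y"
    unfolding mollified_indicator_def by (rule integral_nonneg_AE) (simp add: mollifier_nonneg[OF d])
  have "mollified_indicator \<delta> a b y \<le> (LINT x|lborel. mollifier \<delta> y x)"
    unfolding mollified_indicator_def
    by (rule integral_mono'[OF mollifier_integrable[OF d]])
       (use mollifier_nonneg[OF d] in \<open>auto simp: mollifier_sym[of \<delta> _ y] indicator_def\<close>)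
  then show "mollified_indicator \<delta> a b y \<le> 1" by (simp add: mollifier_integral[OF d])
qed

lemma mollified_indicator_tendsto:
  assumes "y \<noteq> a" "y \<noteq> b" "a < b"
  shows "(\<lambda>n. mollified_indicator (1 / real (Suc n)) a b y) \<longlonglongrightarrow> indicat_real {a..b} y"
proof (rule tendsto_eventually)
  define \<epsilon> where "\<epsilon> = min \<bar>y - a\<bar> \<bar>y - b\<bar>"
  have e: "\<epsilon> > 0" using assms by (simp add: \<epsilon>_def)
  have "(\<lambda>n. 1 / real (Suc n)) \<longlonglongrightarrow> 0" using LIMSEQ_inverse_real_of_nat by (simp add: inverse_eq_divide)
  from order_tendstoD(2)[OF this e]
  show "\<forall>\<^sub>F n in sequentially. mollified_indicator (1 / real (Suc n)) a b y = indicat_real {a..b} y"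
  proof eventually_elim
    case (elim n)
    have d: "1 / real (Suc n) > 0" by simp
    show ?case
    proof (cases "y \<in> {a..b}")
      case True
      then have "mollified_indicator (1 / real (Suc n)) a b y = 1"
        using elim by (intro mollified_indicator_cases(1)[OF d]) (auto simp: \<epsilon>_def abs_if split: if_splits)
      then show ?thesis using True by simp
    next
      case False
      then have "mollified_indicator (1 / real (Suc n)) a b y = 0"
        using elim by (intro mollified_indicator_cases(2)[OF d]) (auto simp: \<epsilon>_def abs_if split: if_splits)
      then show ?thesis using False by simp
    qed
  qed
qed

lemma integral_mollify:
  assumes w: "w \<in> Lp_space 2" and d: "0 < \<delta>" "\<delta> \<le> 1"
  shows "(LINT x|lborel. indicat_real {a..b} x *\<^sub>R mollify \<delta> w x)
       = (LINT y|lborel. mollified_indicator \<delta> a b y *\<^sub>R w y)"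
proof -
  have [measurable]: "w \<in> borel_measurable borel" using w by (simp add: Lp_space_2)
  have eq: "indicat_real {a..b} x *\<^sub>R mollify \<delta> w x = (LINT y|lborel. (indicat_real {a..b} x * mollifier \<delta> x y) *\<^sub>R w y)" for x
    unfolding mollify_def regular_def of_real_smult scaleR_scaleR[symmetric] by (rule integral_scaleR_right[symmetric])
  obtain M where M: "\<And>x y. mollifier \<delta> x y \<le> M" using mollifier_le[OF d(1)] by blast
  have "M \<ge> 0" using M[of 0 0] mollifier_nonneg[OF d(1), of 0 0] by simp
  have int: "integrable (lborel \<Otimes>\<^sub>M lborel) (\<lambda>(x, y). (indicat_real {a..b} x * mollifier \<delta> x y) *\<^sub>R w y)"
  proof (rule Bochner_Integration.integrable_bound)
    show "integrable (lborel \<Otimes>\<^sub>M lborel) (\<lambda>(x, y). indicat_real {a..b} x * (M * norm (indicat_real {a-1..b+1} y *\<^sub>R w y)))"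
    proof (rule lborel_pair.Fubini_integrable)
      have "integrable lborel (\<lambda>y. M * norm (indicat_real {a-1..b+1} y *\<^sub>R w y))"
        by (intro integrable_mult_right integrable_norm Lp_2_locally_integrable w)
      then show "AE x in lborel. integrable lborel (\<lambda>y. case (x, y) of (x, y) \<Rightarrow> indicat_real {a..b} x * (M * norm (indicat_real {a-1..b+1} y *\<^sub>R w y)))"
        by (intro AE_I2) (simp only: prod.case, rule integrable_mult_right)
      have "(\<lambda>x. LINT y|lborel. norm (case (x, y) of (x, y) \<Rightarrow> indicat_real {a..b} x * (M * norm (indicat_real {a-1..b+1} y *\<^sub>R w y))))
         = (\<lambda>x. indicat_real {a..b} x * (LINT y|lborel. M * norm (indicat_real {a-1..b+1} y *\<^sub>R w y)))"
        using \<open>M \<ge> 0\<close> by (auto simp: abs_mult fun_eq_iff simp flip: integral_mult_right_zero)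
      moreover have "integrable lborel (\<lambda>x. indicat_real {a..b} x * (LINT y|lborel. M * norm (indicat_real {a-1..b+1} y *\<^sub>R w y)))"
        by (intro integrable_mult_left) simp
      ultimately show "integrable lborel (\<lambda>x. LINT y|lborel. norm (case (x, y) of (x, y) \<Rightarrow> indicat_real {a..b} x * (M * norm (indicat_real {a-1..b+1} y *\<^sub>R w y))))"
        by simp
    qed measurable
    show "(\<lambda>(x, y). (indicat_real {a..b} x * mollifier \<delta> x y) *\<^sub>R w y) \<in> borel_measurable (lborel \<Otimes>\<^sub>M lborel)"
      by measurable
    show "AE z in lborel \<Otimes>\<^sub>M lborel. norm (case z of (x, y) \<Rightarrow> (indicat_real {a..b} x * mollifier \<delta> x y) *\<^sub>R w y)
        \<le> norm (case z of (x, y) \<Rightarrow> indicat_real {a..b} x * (M * norm (indicat_real {a-1..b+1} y *\<^sub>R w y)))"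
    proof (rule AE_I2, safe)
      fix x y :: real
      show "norm ((indicat_real {a..b} x * mollifier \<delta> x y) *\<^sub>R w y) \<le> norm (indicat_real {a..b} x * (M * norm (indicat_real {a-1..b+1} y *\<^sub>R w y)))"
      proof (cases "x \<in> {a..b} \<and> \<bar>y - x\<bar> < \<delta>")
        case True
        then have "y \<in> {a-1..b+1}" using d by auto
        then show ?thesis using True M[of x y] mollifier_nonneg[OF d(1), of x y] \<open>M \<ge> 0\<close>
          by (simp add: mult_right_mono)
      next
        case False
        then have eq: "indicat_real {a..b} x * mollifier \<delta> x y = 0" using mollifier_zero[OF d(1), of y x] by auto
        show ?thesis by (simp only: eq scaleR_zero_left norm_zero norm_ge_zero)
      qed
    qed
  qed
  have "(LINT x|lborel. indicat_real {a..b} x *\<^sub>R mollify \<delta> w x)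
      = (LINT x|lborel. LINT y|lborel. (indicat_real {a..b} x * mollifier \<delta> x y) *\<^sub>R w y)"
    by (simp only: eq)
  also have "\<dots> = (LINT y|lborel. LINT x|lborel. (indicat_real {a..b} x * mollifier \<delta> x y) *\<^sub>R w y)"
    by (rule lborel_pair.Fubini_integral[OF int, symmetric])
  also have "\<dots> = (LINT y|lborel. mollified_indicator \<delta> a b y *\<^sub>R w y)"
  proof (rule Bochner_Integration.integral_cong[OF refl])
    fix y
    have "integrable lborel (\<lambda>x. indicat_real {a..b} x *\<^sub>R mollifier \<delta> y x)"
      by (rule integrable_mult_indicator[OF _ mollifier_integrable[OF d(1)]]) simp
    then have "integrable lborel (\<lambda>x. indicat_real {a..b} x * mollifier \<delta> x y)"
      by (simp add: mollifier_sym[of \<delta> _ y])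
    then show "(LINT x|lborel. (indicat_real {a..b} x * mollifier \<delta> x y) *\<^sub>R w y) = mollified_indicator \<delta> a b y *\<^sub>R w y"
      unfolding mollified_indicator_def by (rule integral_scaleR_left)
  qed
  finally show ?thesis .
qed

text \<open>The uniform limit of the mollifications is continuous. It agrees with \<open>w\<close> almost everywhere because
  the integrals over intervals agree: the mollified indicators converge away from the end points.\<close>

theorem H1_continuous_representative:
  assumes w: "w \<in> Lp_space 2" and F: "Hs_rep 1 (regular w) F"
  shows "\<exists>v. continuous_on UNIV v \<and> (AE x in lborel. w x = v x) \<and> (\<forall>x. norm (v x) \<le> Lp_norm 2 F * sobolev_constant)"
proof -
  have [measurable]: "w \<in> borel_measurable borel" using w by (simp add: Lp_space_2)
  define W where "W n = mollify (1 / real (Suc n)) w" for n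
  have pos: "1 / real (Suc n) > 0" for n by simp
  obtain v where v: "uniform_limit UNIV W v sequentially"
    using mollify_uniformly_convergent[OF w F] unfolding uniformly_convergent_on_def W_def[abs_def] by blast
  have cW: "continuous_on UNIV (W n)" for n unfolding W_def by (rule continuous_mollify[OF w F pos])
  have cv: "continuous_on UNIV v"
    by (rule uniform_limit_theorem[OF _ v]) (auto intro: always_eventually cW)
  have lim: "(\<lambda>n. W n x) \<longlonglongrightarrow> v x" for x by (rule tendsto_uniform_limitI[OF v]) simp
  define B where "B = Lp_norm 2 F * sobolev_constant"
  have bW: "norm (W n x) \<le> B" for n x unfolding W_def B_def by (rule mollify_bound[OF w F pos])
  have bv: "norm (v x) \<le> B" for x
    by (rule LIMSEQ_le_const2[OF tendsto_norm[OF lim]]) (use bW in blast)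
  have [measurable]: "v \<in> borel_measurable borel" "\<And>n. W n \<in> borel_measurable borel"
    using cv cW by (auto intro: borel_measurable_continuous_onI)
  have iind: "integrable lborel (\<lambda>x. B * indicat_real {a..b} x)" for a b :: real by simp
  have iv: "integrable lborel (\<lambda>x. indicat_real {a..b} x *\<^sub>R v x)" for a b
    by (rule Bochner_Integration.integrable_bound[OF iind[of a b]])
       (use bv in \<open>auto simp: indicator_def intro!: AE_I2 order_trans[OF _ abs_ge_self]\<close>)
  have "AE x in lborel. w x - v x = 0"
  proof (rule AE_zero_of_interval_integrals)
    fix a b :: real
    note iw = Lp_2_locally_integrable[OF w]
    show "integrable lborel (\<lambda>x. indicat_real {a..b} x *\<^sub>R (w x - v x))"
      unfolding scaleR_diff_right by (rule Bochner_Integration.integrable_diff[OF iw iv])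
    assume ab: "a < b"
    have L1: "(\<lambda>n. LINT x|lborel. indicat_real {a..b} x *\<^sub>R W n x) \<longlonglongrightarrow> (LINT x|lborel. indicat_real {a..b} x *\<^sub>R v x)"
      by (rule integral_dominated_convergence[OF _ _ iind[of a b]])
         (use bW in \<open>auto simp: indicator_def intro!: AE_I2 tendsto_intros lim\<close>)
    have L2: "(\<lambda>n. LINT y|lborel. mollified_indicator (1 / real (Suc n)) a b y *\<^sub>R w y) \<longlonglongrightarrow> (LINT x|lborel. indicat_real {a..b} x *\<^sub>R w x)"
    proof (rule integral_dominated_convergence[where w = "\<lambda>y. norm (indicat_real {a-1..b+1} y *\<^sub>R w y)"])
      show "(\<lambda>y. mollified_indicator (1 / real (Suc n)) a b y *\<^sub>R w y) \<in> borel_measurable lborel" for n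
        unfolding mollified_indicator_def by measurable
      show "integrable lborel (\<lambda>y. norm (indicat_real {a-1..b+1} y *\<^sub>R w y))" by (rule integrable_norm[OF iw])
      show "AE y in lborel. (\<lambda>n. mollified_indicator (1 / real (Suc n)) a b y *\<^sub>R w y) \<longlonglongrightarrow> indicat_real {a..b} y *\<^sub>R w y"
        using AE_lborel_singleton[of a] AE_lborel_singleton[of b]
        by eventually_elim (intro tendsto_intros mollified_indicator_tendsto ab)
      show "AE y in lborel. norm (mollified_indicator (1 / real (Suc n)) a b y *\<^sub>R w y) \<le> norm (indicat_real {a-1..b+1} y *\<^sub>R w y)" for n
      proof (rule AE_I2)
        fix y
        show "norm (mollified_indicator (1 / real (Suc n)) a b y *\<^sub>R w y) \<le> norm (indicat_real {a-1..b+1} y *\<^sub>R w y)"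
        proof (cases "y \<in> {a-1..b+1}")
          case True
          then show ?thesis using mollified_indicator_cases(3,4)[OF pos[of n], of a b y] by (simp add: mult_left_le_one_le)
        next
          case False
          have le: "1 / real (Suc n) \<le> 1" by simp
          have "mollified_indicator (1 / real (Suc n)) a b y = 0"
            using False le by (intro mollified_indicator_cases(2)[OF pos]) (simp only: atLeastAtMost_iff, linarith)
          then show ?thesis by simp
        qed
      qed
    qed simp
    have "(LINT x|lborel. indicat_real {a..b} x *\<^sub>R W n x) = (LINT y|lborel. mollified_indicator (1 / real (Suc n)) a b y *\<^sub>R w y)" for n
      unfolding W_def by (rule integral_mollify[OF w pos]) simp
    with L1 have "(\<lambda>n. LINT y|lborel. mollified_indicator (1 / real (Suc n)) a b y *\<^sub>R w y) \<longlonglongrightarrow> (LINT x|lborel. indicat_real {a..b} x *\<^sub>R v x)" by simp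
    from LIMSEQ_unique[OF L2 this]
    show "(LINT x|lborel. indicat_real {a..b} x *\<^sub>R (w x - v x)) = 0"
      unfolding scaleR_diff_right by (simp add: Bochner_Integration.integral_diff[OF iw iv])
  qed
  then show ?thesis using cv bv by (intro exI[of _ v]) (auto simp: B_def elim: AE_mp)
qed

lemma continuous_AE_le:
  fixes f :: "real \<Rightarrow> real"
  assumes "continuous_on UNIV f" and "AE x in lborel. f x \<le> C"
  shows "f x \<le> C"
proof (rule ccontr)
  assume "\<not> f x \<le> C"
  define h where "h y = max 0 (f y - C)" for y
  have ch: "continuous_on UNIV h" unfolding h_def using assms(1) by (intro continuous_intros)
  have "h x = 0"
  proof (rule zero_of_bump_integrals[OF ch])
    fix \<delta> :: real assume "\<delta> > 0"
    have "AE y in lborel. bump x \<delta> 0 y *\<^sub>R h y = 0"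
      using assms(2) by eventually_elim (simp add: h_def)
    then show "(LINT y|lborel. bump x \<delta> 0 y *\<^sub>R h y) = 0" by (rule integral_eq_zero_AE)
  qed
  then show False using \<open>\<not> f x \<le> C\<close> by (simp add: h_def)
qed

text \<open>The bound of the preceding theorem for the differences \<open>\<psi> r - \<psi> t\<close> turns continuity in time with
  values in \<open>H\<^sup>1\<close> into uniform convergence in \<open>x\<close>.\<close>

theorem H1_curve_continuous_representative:
  assumes L2: "\<And>t. \<psi> t \<in> Lp_space 2"
    and curve: "(\<lambda>t. regular (\<psi> t)) \<in> curves (Hs_space 1) (Hs_dist 1) UNIV"
  shows "\<exists>\<Psi>. continuous_on UNIV (\<lambda>(t, x). \<Psi> t x) \<and> (\<forall>t. AE x in lborel. \<psi> t x = \<Psi> t x) \<and>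
     (\<forall>T. \<exists>B. \<forall>t x. \<bar>t\<bar> \<le> T \<longrightarrow> norm (\<Psi> t x) \<le> B)"
proof -
  have Hs: "regular (\<psi> t) \<in> Hs_space 1" for t using curve by (auto simp: curves_def)
  have "\<exists>v B. continuous_on UNIV v \<and> (AE x in lborel. \<psi> t x = v x) \<and> (\<forall>x. norm (v x) \<le> B)" for t
    using Hs[of t] H1_continuous_representative[OF L2] unfolding Hs_space_def by blast
  then obtain \<Psi> B where c: "\<And>t. continuous_on UNIV (\<Psi> t)" and ae: "\<And>t. AE x in lborel. \<psi> t x = \<Psi> t x"
    and B: "\<And>t x. norm (\<Psi> t x) \<le> B t" by metis
  have close: "\<exists>\<delta>>0. \<forall>r. \<bar>r - t\<bar> < \<delta> \<longrightarrow> (\<forall>x. norm (\<Psi> r x - \<Psi> t x) \<le> \<epsilon>)" if e: "\<epsilon> > 0" for t \<epsilon>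
  proof -
    define \<epsilon>' where "\<epsilon>' = \<epsilon> / (1 + sobolev_constant)"
    have e': "\<epsilon>' > 0" using e sobolev_constant_nonneg by (simp add: \<epsilon>'_def)
    have "\<epsilon>' * sobolev_constant \<le> \<epsilon>" using e sobolev_constant_nonneg by (simp add: \<epsilon>'_def divide_le_eq distrib_left)
    obtain \<delta> where d: "\<delta> > 0" "\<And>r. \<bar>r - t\<bar> < \<delta> \<Longrightarrow> Hs_dist 1 (regular (\<psi> r)) (regular (\<psi> t)) < \<epsilon>'"
      using curve e' unfolding curves_def by blast
    have "norm (\<Psi> r x - \<Psi> t x) \<le> \<epsilon>" if r: "\<bar>r - t\<bar> < \<delta>" for r x
    proof -
      obtain F where F: "Hs_rep 1 (\<lambda>\<phi>. regular (\<psi> r) \<phi> - regular (\<psi> t) \<phi>) F" "Lp_norm 2 F < \<epsilon>'"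
        using Hs_dist_less[OF Hs Hs d(2)[OF r]] by blast
      have "Hs_rep 1 (regular (\<lambda>x. \<psi> r x - \<psi> t x)) F"
        using F(1) by (auto simp: Hs_rep_def regular_diff_schwartz L2)
      from H1_continuous_representative[OF Lp_space_diff[OF one_le_numeral L2 L2] this]
      obtain v where v: "AE x in lborel. \<psi> r x - \<psi> t x = v x" "\<And>x. norm (v x) \<le> Lp_norm 2 F * sobolev_constant"
        by blast
      have b: "Lp_norm 2 F * sobolev_constant \<le> \<epsilon>"
        using F(2) sobolev_constant_nonneg \<open>\<epsilon>' * sobolev_constant \<le> \<epsilon>\<close> mult_right_mono[of "Lp_norm 2 F" \<epsilon>' sobolev_constant] by linarith
      have "AE x in lborel. norm (\<Psi> r x - \<Psi> t x) \<le> \<epsilon>"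
        using v(1) ae[of r] ae[of t] by eventually_elim (metis b order_trans v(2))
      moreover have "continuous_on UNIV (\<lambda>x. norm (\<Psi> r x - \<Psi> t x))" by (intro continuous_intros c)
      ultimately show ?thesis by (rule continuous_AE_le[rotated])
    qed
    then show ?thesis using d(1) by blast
  qed
  have joint: "continuous_on UNIV (\<lambda>(t, x). \<Psi> t x)"
    unfolding continuous_on_iff
  proof (intro ballI allI impI)
    fix z :: "real \<times> real" and \<epsilon> :: real assume e: "\<epsilon> > 0"
    obtain t x where z: "z = (t, x)" by (cases z)
    obtain \<delta> where d: "\<delta> > 0" "\<And>r x. \<bar>r - t\<bar> < \<delta> \<Longrightarrow> norm (\<Psi> r x - \<Psi> t x) \<le> \<epsilon> / 3"
      using close[of "\<epsilon> / 3" t] e by auto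
    obtain \<eta> where h: "\<eta> > 0" "\<And>y. dist y x < \<eta> \<Longrightarrow> dist (\<Psi> t y) (\<Psi> t x) < \<epsilon> / 3"
      using c[of t] e unfolding continuous_on_iff by (metis UNIV_I divide_pos_pos zero_less_numeral)
    have "dist (\<Psi> r y) (\<Psi> t x) < \<epsilon>" if "dist (r, y) (t, x) < min \<delta> \<eta>" for r y
    proof -
      have "dist r t < \<delta>" "dist y x < \<eta>"
        using that dist_fst_le[of "(r, y)" "(t, x)"] dist_snd_le[of "(r, y)" "(t, x)"] by auto
      then show ?thesis using d(2)[of r y] h(2)[of y] dist_triangle[of "\<Psi> r y" "\<Psi> t x" "\<Psi> t y"] e
        by (simp add: dist_norm)
    qed
    then show "\<exists>d>0. \<forall>z'\<in>UNIV. dist z' z < d \<longrightarrow> dist (case z' of (t, x) \<Rightarrow> \<Psi> t x) (case z of (t, x) \<Rightarrow> \<Psi> t x) < \<epsilon>"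
      using d(1) h(1) by (intro exI[of _ "min \<delta> \<eta>"]) (auto simp: z)
  qed
  have bdd: "\<exists>B. \<forall>t x. \<bar>t\<bar> \<le> T \<longrightarrow> norm (\<Psi> t x) \<le> B" for T
  proof -
    obtain d where d: "\<And>t. d t > 0" "\<And>t r x. \<bar>r - t\<bar> < d t \<Longrightarrow> norm (\<Psi> r x - \<Psi> t x) \<le> 1"
      using close[of 1] by (metis zero_less_one)
    have "compact {-T..T}" by simp
    moreover have "{-T..T} \<subseteq> (\<Union>t\<in>{-T..T}. ball t (d t))" using d(1) by auto
    ultimately obtain K where K: "K \<subseteq> {-T..T}" "finite K" "{-T..T} \<subseteq> (\<Union>t\<in>K. ball t (d t))"
      using compactE_image[of "{-T..T}" "{-T..T}" "\<lambda>t. ball t (d t)"] by (metis open_ball)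
    have "norm (\<Psi> r x) \<le> (\<Sum>t\<in>K. \<bar>B t\<bar>) + 1" if "\<bar>r\<bar> \<le> T" for r x
    proof -
      have "r \<in> {-T..T}" using that by auto
      then obtain t where t: "t \<in> K" "\<bar>r - t\<bar> < d t" using K(3) by (auto simp: dist_real_def abs_minus_commute)
      have "norm (\<Psi> r x) \<le> norm (\<Psi> t x) + norm (\<Psi> r x - \<Psi> t x)" by (rule norm_triangle_sub)
      also have "\<dots> \<le> \<bar>B t\<bar> + 1" using B[of t x] d(2)[OF t(2), of x] by simp
      also have "\<bar>B t\<bar> \<le> (\<Sum>t\<in>K. \<bar>B t\<bar>)" by (rule member_le_sum[OF t(1)]) (use K in auto)
      finally show ?thesis by simp
    qed
    then show ?thesis by blast
  qed
  show ?thesis using joint ae bdd by blast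
qed

section \<open>The Thirring model along characteristics\<close>

lemma continuous_on_smult [continuous_intros]:
  assumes "continuous_on S c" "continuous_on S g"
  shows "continuous_on S (\<lambda>x. c x *s (g x :: spinor))"
proof -
  have "continuous_on S (\<lambda>x. \<i> *s g x)"
    by (rule bounded_linear.continuous_on[OF bounded_linear_smult_right assms(2)])
  then show ?thesis unfolding smult_scaleR_sum[of "c _"] using assms by (intro continuous_intros)
qed

lemma bounded_linear_matrix_mult: "bounded_linear (\<lambda>z::spinor. (A :: complex^2^2) *v z)"
proof -
  have "A *v (r *\<^sub>R z) = r *\<^sub>R (A *v z)" for r and z :: spinor
    by (simp add: of_real_smult[symmetric] vector_scalar_commute)
  then have "linear (\<lambda>z::spinor. A *v z)"
    by (simp add: linear_iff matrix_vector_right_distrib)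
  then show ?thesis by (simp add: linear_conv_bounded_linear)
qed

lemmas continuous_on_matrix_mult [continuous_intros] = bounded_linear.continuous_on[OF bounded_linear_matrix_mult]
lemmas continuous_on_cinner [continuous_intros] = bounded_linear.continuous_on[OF bounded_linear_cinner]

lemma continuous_on_nonlinearity: "continuous_on UNIV (nonlinearity \<gamma>)"
proof -
  have "continuous_on UNIV (\<lambda>z. current \<gamma> z \<mu>)" for \<mu>
    unfolding current_def dirac_adjoint_def vector_matrix_mult_def matrix_vector_mult_def
    by (simp, intro continuous_intros)
  then show ?thesis
    unfolding nonlinearity_def[abs_def] by (intro continuous_intros)
qed

text \<open>Testing the equation with \<open>A(t) B(x - \<kappa>t)\<close>, in terms of a continuous representative.\<close>

lemma weak_equation_characteristic_test:
  fixes \<gamma> :: "nat \<Rightarrow> complex ^ 2 ^ 2" and \<Psi> :: "real \<Rightarrow> field" and m \<kappa> :: real and l :: "spinor \<Rightarrow> complex"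
  assumes eq: "thirring_equation \<gamma> m \<psi>" and m: "\<And>t. \<psi> t \<in> borel_measurable borel"
    and ae: "\<And>t. AE x in lborel. \<psi> t x = \<Psi> t x"
    and c: "continuous_on UNIV (\<lambda>(t, x). \<Psi> t x)"
    and A: "smooth_family A" "compactly_supported (A 0)" and B: "smooth_family B" "compactly_supported (B 0)"
    and l: "bounded_linear l"
  defines "d0 \<equiv> \<lambda>t x. complex_of_real (A 1 t * B 0 (x - \<kappa> * t) - \<kappa> * A 0 t * B 1 (x - \<kappa> * t))"
    and "d1 \<equiv> \<lambda>t x. complex_of_real (A 0 t * B 1 (x - \<kappa> * t))"
    and "h \<equiv> \<lambda>t x. complex_of_real (A 0 t * B 0 (x - \<kappa> * t))"
  shows "(LINT t|lborel. LINT x|lborel. l ((\<Sum>\<mu><2. (\<i> * (if \<mu> = 0 then d0 t x else d1 t x)) *s (\<gamma> \<mu> *v \<Psi> t x))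
     + (of_real m * h t x) *s \<Psi> t x - h t x *s nonlinearity \<gamma> (\<Psi> t x))) = 0"
proof -
  define V where "V t x z = (\<Sum>\<mu><2. (\<i> * (if \<mu> = 0 then d0 t x else d1 t x)) *s (\<gamma> \<mu> *v z))
     + (of_real m * h t x) *s z - h t x *s nonlinearity \<gamma> z" for t x z
  note T = characteristic_test_function[OF A B, of \<kappa>]
  have p: "partial \<mu> (\<lambda>t x. complex_of_real (A 0 t * B 0 (x - \<kappa> * t))) t x = (if \<mu> = 0 then d0 t x else d1 t x)" if "\<mu> < 2" for \<mu> t x
  proof (cases "\<mu> = 0")
    case False
    then have "\<mu> = 1" using that by simp
    then show ?thesis using T(3)[of t x] by (simp add: d1_def)
  qed (use T(2)[of t x] in \<open>simp add: d0_def\<close>)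
  have "(LINT t|lborel. LINT x|lborel.
        (\<Sum>\<mu><2. (\<i> * partial \<mu> (\<lambda>t x. complex_of_real (A 0 t * B 0 (x - \<kappa> * t))) t x) *s (\<gamma> \<mu> *v \<psi> t x))
        + (of_real m * complex_of_real (A 0 t * B 0 (x - \<kappa> * t))) *s \<psi> t x
        - complex_of_real (A 0 t * B 0 (x - \<kappa> * t)) *s nonlinearity \<gamma> (\<psi> t x)) = 0"
    using eq T(1) unfolding thirring_equation_def by (rule bspec)
  moreover have "(\<Sum>\<mu><2. (\<i> * partial \<mu> (\<lambda>t x. complex_of_real (A 0 t * B 0 (x - \<kappa> * t))) t x) *s z \<mu>)
      = (\<Sum>\<mu><2. (\<i> * (if \<mu> = 0 then d0 t x else d1 t x)) *s z \<mu>)" for z :: "nat \<Rightarrow> spinor" and t x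
    by (rule sum.cong[OF refl]) (simp only: p lessThan_iff)
  ultimately have I0: "(LINT t|lborel. LINT x|lborel. V t x (\<psi> t x)) = 0"
    by (simp only: V_def h_def)
  note cA = smooth_family_continuous[OF A(1)] and cB = smooth_family_continuous[OF B(1)]
  have cd: "continuous_on S (\<lambda>z. d0 (f z) (g z))" "continuous_on S (\<lambda>z. d1 (f z) (g z))" "continuous_on S (\<lambda>z. h (f z) (g z))"
    if "continuous_on S f" "continuous_on S g" for S and f g :: "'z::topological_space \<Rightarrow> real"
    unfolding d0_def d1_def h_def
    by (intro continuous_intros continuous_on_compose2[OF cA[of UNIV]] continuous_on_compose2[OF cB[of UNIV]] that subset_UNIV)+
  have cV: "continuous_on S (\<lambda>z. V (f z) (g z) (k z))"
    if "continuous_on S f" "continuous_on S g" "continuous_on S k" for S and f g :: "'z::topological_space \<Rightarrow> real" and k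
  proof -
    have "continuous_on S (\<lambda>z. if \<mu> = 0 then d0 (f z) (g z) else d1 (f z) (g z))" for \<mu> :: nat
      by (cases "\<mu> = 0") (simp_all add: cd that)
    moreover have "continuous_on S (\<lambda>z. nonlinearity \<gamma> (k z))"
      by (rule continuous_on_compose2[OF continuous_on_nonlinearity that(3)]) simp
    moreover note cd(3)[OF that(1,2)]
    ultimately show ?thesis
      unfolding V_def
      by (intro continuous_on_add continuous_on_diff continuous_on_sum continuous_on_smult continuous_on_mult_left
          continuous_on_matrix_mult that(3))
  qed
  have V_meas: "(\<lambda>x. V t x (w x)) \<in> borel_measurable borel" if w: "w \<in> borel_measurable borel" for t and w :: field
  proof -
    have "continuous_on UNIV (\<lambda>z. V t (fst z) (snd z))"
      by (rule cV[OF continuous_on_const continuous_on_fst[OF continuous_on_id] continuous_on_snd[OF continuous_on_id]])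
    then have "(\<lambda>z. V t (fst z) (snd z)) \<in> borel_measurable borel" by (rule borel_measurable_continuous_onI)
    moreover have "(\<lambda>x. (x, w x)) \<in> borel \<rightarrow>\<^sub>M (borel :: (real \<times> spinor) measure)"
      using w by (simp add: borel_prod[symmetric])
    ultimately have "(\<lambda>x. V t (fst (x, w x)) (snd (x, w x))) \<in> borel_measurable borel"
      by (rule measurable_compose[rotated])
    then show ?thesis by simp
  qed
  have cPsi: "continuous_on S (\<lambda>z. \<Psi> (f z) (g z))"
    if "continuous_on S f" "continuous_on S g" for S and f g :: "'z::topological_space \<Rightarrow> real"
    by (rule continuous_on_compose_2[OF c that])
  have Psi_meas: "\<Psi> t \<in> borel_measurable borel" for t
    using cPsi[OF continuous_on_const continuous_on_id, of UNIV t] by (auto intro: borel_measurable_continuous_onI)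
  have inner: "(LINT x|lborel. V t x (\<psi> t x)) = (LINT x|lborel. V t x (\<Psi> t x))" for t
  proof (rule integral_cong_AE)
    show "AE x in lborel. V t x (\<psi> t x) = V t x (\<Psi> t x)" using ae[of t] by eventually_elim simp
  qed (use V_meas[OF m] V_meas[OF Psi_meas] in auto)
  obtain R where R: "\<And>n x. \<bar>x\<bar> > R \<Longrightarrow> A n x = 0" using compactly_supported_family[OF A] by blast
  obtain r where r: "\<And>n x. \<bar>x\<bar> > r \<Longrightarrow> B n x = 0" using compactly_supported_family[OF B] by blast
  define \<rho> where "\<rho> = \<bar>r\<bar> + \<bar>\<kappa>\<bar> * \<bar>R\<bar>"
  have zV: "V t x z = 0" if "\<bar>t\<bar> > R \<or> \<bar>x\<bar> > \<rho>" for t x z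
  proof (cases "\<bar>t\<bar> > R")
    case True
    then have "d0 t x = 0" "d1 t x = 0" "h t x = 0" by (simp_all add: d0_def d1_def h_def R)
    then show ?thesis by (simp add: V_def cong: if_cong)
  next
    case False
    then have "\<bar>\<kappa> * t\<bar> \<le> \<bar>\<kappa>\<bar> * \<bar>R\<bar>" by (simp add: abs_mult mult_left_mono)
    then have "\<bar>x - \<kappa> * t\<bar> > r" using that False unfolding \<rho>_def by linarith
    then have "d0 t x = 0" "d1 t x = 0" "h t x = 0" by (simp_all add: d0_def d1_def h_def r)
    then show ?thesis by (simp add: V_def cong: if_cong)
  qed
  define G where "G t x = V t x (\<Psi> t x)" for t x
  have cG: "continuous_on UNIV (\<lambda>z. G (fst z) (snd z))"
    unfolding G_def
    by (rule cV[OF continuous_on_fst[OF continuous_on_id] continuous_on_snd[OF continuous_on_id]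
          cPsi[OF continuous_on_fst[OF continuous_on_id] continuous_on_snd[OF continuous_on_id]]])
  have cG': "continuous_on S (\<lambda>z. G (f z) (g z))"
    if "continuous_on S f" "continuous_on S g" for S and f g :: "'z::topological_space \<Rightarrow> real"
    unfolding G_def by (rule cV[OF that cPsi[OF that]])
  have iG: "integrable lborel (\<lambda>x. G t x)" "(LINT x|lborel. G t x) = integral {-\<rho>..\<rho>} (\<lambda>x. G t x)" for t
    using LINT_eq_integral_of_support[of "\<lambda>x. G t x" \<rho>] cG'[OF continuous_on_const continuous_on_id, of UNIV t] zV
    by (auto simp: G_def)
  have "continuous_on UNIV (\<lambda>t. integral (cbox (-\<rho>) \<rho>) (\<lambda>x. G t x))"
    by (rule integral_continuous_on_param)
       (use cG'[OF continuous_on_fst[OF continuous_on_id] continuous_on_snd[OF continuous_on_id]] in \<open>simp add: case_prod_beta'\<close>)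
  then have cI: "continuous_on UNIV (\<lambda>t. LINT x|lborel. G t x)" by (simp add: iG(2))
  have iI: "integrable lborel (\<lambda>t. LINT x|lborel. G t x)"
    by (rule LINT_eq_integral_of_support(1)[OF cI, of R]) (simp add: G_def zV)
  have "(LINT t|lborel. LINT x|lborel. l (G t x)) = (LINT t|lborel. l (LINT x|lborel. G t x))"
    by (rule Bochner_Integration.integral_cong[OF refl]) (rule integral_bounded_linear[OF l iG(1)])
  also have "\<dots> = l (LINT t|lborel. LINT x|lborel. G t x)"
    by (rule integral_bounded_linear[OF l iI])
  also have "(LINT t|lborel. LINT x|lborel. G t x) = 0"
    using I0 by (simp add: inner G_def)
  also have "l 0 = 0" using l by (simp add: linear_simps)
  finally show ?thesis by (simp add: G_def V_def)
qed

text \<open>The Thirring model for chiral components that are continuous and differentiable along their own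
  characteristics.\<close>

definition characteristic_solution :: "real \<Rightarrow> (real \<Rightarrow> real \<Rightarrow> complex) \<Rightarrow> (real \<Rightarrow> real \<Rightarrow> complex) \<Rightarrow> bool" where
  "characteristic_solution m u v \<longleftrightarrow>
     continuous_on UNIV (\<lambda>(t, x). u t x) \<and> continuous_on UNIV (\<lambda>(t, x). v t x) \<and>
     (\<forall>t y. ((\<lambda>s. u s (y + s)) has_vector_derivative
        (- \<i> * m * v t (y + t) + 2 * \<i> * (cmod (v t (y + t)))\<^sup>2 * u t (y + t))) (at t)) \<and>
     (\<forall>t y. ((\<lambda>s. v s (y - s)) has_vector_derivative
        (- \<i> * m * u t (y - t) + 2 * \<i> * (cmod (u t (y - t)))\<^sup>2 * v t (y - t))) (at t))"

text \<open>In the chiral components the weak equation decouples into two transport equations, with speeds \<open>1\<close>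
  and \<open>- 1\<close>, whose right-hand sides are continuous.\<close>

lemma (in chiral_basis) H1_solution_characteristic:
  assumes "H1_solution \<gamma> m \<psi>\<^sub>0 \<psi>"
  shows "\<exists>u v. characteristic_solution m u v \<and>
     (\<forall>t. AE x in lborel. cinner e (\<psi> t x) = u t x \<and> cinner f (\<psi> t x) = v t x) \<and>
     (\<forall>T. \<exists>B. \<forall>t x. \<bar>t\<bar> \<le> T \<longrightarrow> cmod (u t x) \<le> B)"
proof -
  have L2: "\<And>t. \<psi> t \<in> Lp_space 2" and curve: "(\<lambda>t. regular (\<psi> t)) \<in> curves (Hs_space 1) (Hs_dist 1) UNIV"
    and eq: "thirring_equation \<gamma> m \<psi>" using assms by (auto simp: H1_solution_def)
  have meas: "\<And>t. \<psi> t \<in> borel_measurable borel" using L2 by (simp add: Lp_space_2)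
  obtain \<Psi> where c: "continuous_on UNIV (\<lambda>(t, x). \<Psi> t x)" and ae: "\<And>t. AE x in lborel. \<psi> t x = \<Psi> t x"
    and bdd: "\<And>T. \<exists>B. \<forall>t x. \<bar>t\<bar> \<le> T \<longrightarrow> norm (\<Psi> t x) \<le> B"
    using H1_curve_continuous_representative[OF L2 curve] by blast
  define u where "u t x = cinner e (\<Psi> t x)" for t x
  define v where "v t x = cinner f (\<Psi> t x)" for t x
  have cu: "continuous_on UNIV (\<lambda>(t, x). u t x)" and cv: "continuous_on UNIV (\<lambda>(t, x). v t x)"
    using c unfolding u_def v_def case_prod_beta' by (intro continuous_intros; simp)+
  note W = weak_equation_characteristic_test[OF eq meas ae c]
  have du: "((\<lambda>s. u s (y + 1 * s)) has_vector_derivative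
        (- \<i> * m * v t (y + 1 * t) + 2 * \<i> * (cmod (v t (y + 1 * t)))\<^sup>2 * u t (y + 1 * t))) (at t)" for t y
  proof (rule transport_of_weak[OF cu, where P = "\<lambda>t x. - \<i> * m * v t x + 2 * \<i> * (cmod (v t x))\<^sup>2 * u t x"])
    show "continuous_on UNIV (\<lambda>(t, x). - \<i> * m * v t x + 2 * \<i> * (cmod (v t x))\<^sup>2 * u t x)"
      using cu cv unfolding case_prod_beta' by (intro continuous_intros)
    fix A B assume A: "smooth_family A" and B: "smooth_family B" and sA: "compactly_supported (A 0)" and sB: "compactly_supported (B 0)"
    have "(LINT t|lborel. LINT x|lborel. \<i> * (B 0 (x - 1 * t) *\<^sub>R (A 1 t *\<^sub>R u t x + A 0 t *\<^sub>R (- \<i> * m * v t x + 2 * \<i> * (cmod (v t x))\<^sup>2 * u t x)))) = 0"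
      using W[OF A sA B sB bounded_linear_cinner[of f], of 1]
      unfolding cinner_weak_integrand(1) u_def[symmetric] v_def[symmetric]
      by (simp add: scaleR_conv_of_real algebra_simps)
    then show "(LINT t|lborel. LINT x|lborel. B 0 (x - 1 * t) *\<^sub>R (A 1 t *\<^sub>R u t x + A 0 t *\<^sub>R (- \<i> * m * v t x + 2 * \<i> * (cmod (v t x))\<^sup>2 * u t x))) = 0"
      by (simp only: integral_mult_right_zero) simp
  qed
  have dv: "((\<lambda>s. v s (y + (- 1) * s)) has_vector_derivative
        (- \<i> * m * u t (y + (- 1) * t) + 2 * \<i> * (cmod (u t (y + (- 1) * t)))\<^sup>2 * v t (y + (- 1) * t))) (at t)" for t y
  proof (rule transport_of_weak[OF cv, where P = "\<lambda>t x. - \<i> * m * u t x + 2 * \<i> * (cmod (u t x))\<^sup>2 * v t x"])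
    show "continuous_on UNIV (\<lambda>(t, x). - \<i> * m * u t x + 2 * \<i> * (cmod (u t x))\<^sup>2 * v t x)"
      using cu cv unfolding case_prod_beta' by (intro continuous_intros)
    fix A B assume A: "smooth_family A" and B: "smooth_family B" and sA: "compactly_supported (A 0)" and sB: "compactly_supported (B 0)"
    have "(LINT t|lborel. LINT x|lborel. \<i> * (B 0 (x - (- 1) * t) *\<^sub>R (A 1 t *\<^sub>R v t x + A 0 t *\<^sub>R (- \<i> * m * u t x + 2 * \<i> * (cmod (u t x))\<^sup>2 * v t x)))) = 0"
      using W[OF A sA B sB bounded_linear_cinner[of e], of "- 1"]
      unfolding cinner_weak_integrand(2) u_def[symmetric] v_def[symmetric]
      by (simp add: scaleR_conv_of_real algebra_simps)
    then show "(LINT t|lborel. LINT x|lborel. B 0 (x - (- 1) * t) *\<^sub>R (A 1 t *\<^sub>R v t x + A 0 t *\<^sub>R (- \<i> * m * u t x + 2 * \<i> * (cmod (u t x))\<^sup>2 * v t x))) = 0"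
      by (simp only: integral_mult_right_zero) simp
  qed
  have "characteristic_solution m u v"
    unfolding characteristic_solution_def using cu cv du dv by (simp add: mult.assoc)
  moreover have "\<forall>t. AE x in lborel. cinner e (\<psi> t x) = u t x \<and> cinner f (\<psi> t x) = v t x"
  proof
    fix t show "AE x in lborel. cinner e (\<psi> t x) = u t x \<and> cinner f (\<psi> t x) = v t x"
      using ae[of t] by eventually_elim (simp add: u_def v_def)
  qed
  moreover have "\<exists>B. \<forall>t x. \<bar>t\<bar> \<le> T \<longrightarrow> cmod (u t x) \<le> B" for T
  proof -
    obtain B where "\<And>t x. \<bar>t\<bar> \<le> T \<Longrightarrow> norm (\<Psi> t x) \<le> B" using bdd by blast
    then show ?thesis using norm_cinner_le[of e] unfolding u_def norm_e by (metis mult_1 order_trans)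
  qed
  ultimately show ?thesis by blast
qed

section \<open>Scattering of a wave by a pulse\<close>

lemma cmod_exp_i_diff_le: "cmod (exp (\<i> * of_real a) - exp (\<i> * of_real b)) \<le> \<bar>a - b\<bar>"
proof -
  have "exp (\<i> * of_real a) - exp (\<i> * of_real b) = exp (\<i> * of_real b) * (exp (\<i> * of_real (a - b)) - 1)"
    by (simp add: algebra_simps exp_add[symmetric])
  then have "cmod (exp (\<i> * of_real a) - exp (\<i> * of_real b)) = cmod (exp (\<i> * of_real (a - b)) - 1)"
    by (simp only: norm_mult) (simp add: norm_exp_eq_Re)
  also have "\<dots> \<le> \<bar>a - b\<bar>" using iexp_approx1[of "a - b" 0] by simp
  finally show ?thesis .
qed

text \<open>Removing the phase \<open>\<Theta>\<close> generated by the cubic term leaves the mass term only.\<close>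

lemma phase_removed_bound:
  fixes p q :: "real \<Rightarrow> complex" and \<Theta> K K' :: "real \<Rightarrow> real" and m t :: real
  assumes p: "\<And>s. (p has_vector_derivative (- \<i> * m * q s + 2 * \<i> * (cmod (q s))\<^sup>2 * p s)) (at s)"
    and \<Theta>: "\<And>s. (\<Theta> has_real_derivative 2 * (cmod (q s))\<^sup>2) (at s)" "\<Theta> 0 = 0"
    and K: "\<And>s. (K has_real_derivative K' s) (at s)"
    and b: "\<And>s. 0 \<le> s \<Longrightarrow> s \<le> t \<Longrightarrow> \<bar>m\<bar> * cmod (q s) \<le> K' s" and t: "0 \<le> t"
  shows "cmod (p t - exp (\<i> * of_real (\<Theta> t)) * p 0) \<le> K t - K 0"
proof (cases "t = 0")
  case True
  then show ?thesis using \<Theta>(2) by simp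
next
  case False
  define E where "E s = exp (- \<i> * of_real (\<Theta> s)) * p s" for s
  have e: "((\<lambda>s. exp (- \<i> * of_real (\<Theta> s))) has_vector_derivative
      (2 * (cmod (q s))\<^sup>2) *\<^sub>R (- \<i> * exp (- \<i> * of_real (\<Theta> s)))) (at s)" for s
  proof -
    have "(\<Theta> has_vector_derivative 2 * (cmod (q s))\<^sup>2) (at s)"
      using \<Theta>(1) by (simp add: has_real_derivative_iff_has_vector_derivative)
    moreover have "((\<lambda>x. exp (- \<i> * of_real x)) has_vector_derivative - \<i> * exp (- \<i> * of_real (\<Theta> s))) (at (\<Theta> s))"
    proof -
      have "((\<lambda>z. exp (- \<i> * z)) has_field_derivative - \<i> * exp (- \<i> * of_real (\<Theta> s))) (at (of_real (\<Theta> s)))"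
        by (auto intro!: derivative_eq_intros)
      from has_vector_derivative_real_field[OF this] show ?thesis by simp
    qed
    ultimately have "((\<lambda>x. exp (- \<i> * of_real x)) \<circ> \<Theta> has_vector_derivative
       (2 * (cmod (q s))\<^sup>2) *\<^sub>R (- \<i> * exp (- \<i> * of_real (\<Theta> s)))) (at s)"
      by (rule vector_diff_chain_at)
    then show ?thesis by (simp only: comp_def)
  qed
  have E: "(E has_vector_derivative exp (- \<i> * of_real (\<Theta> s)) * (- \<i> * m * q s)) (at s)" for s
    using has_vector_derivative_mult[OF e[of s] p[of s]]
    unfolding E_def[abs_def] by (simp add: scaleR_conv_of_real algebra_simps)
  have cE: "continuous_on S E" for S
    using E by (auto intro!: continuous_at_imp_continuous_on has_vector_derivative_continuous)
  have cK: "continuous_on S K" for S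
    using K by (auto intro!: continuous_at_imp_continuous_on DERIV_isCont)
  have "norm (E t - E 0) \<le> K t - K 0"
  proof (rule differentiable_bound_general[where f' = "\<lambda>s. exp (- \<i> * of_real (\<Theta> s)) * (- \<i> * m * q s)" and \<phi>' = K'])
    show "0 < t" using t False by simp
    show "(K has_vector_derivative K' s) (at s)" for s using K by (simp add: has_real_derivative_iff_has_vector_derivative)
    fix s assume "0 < s" "s < t"
    then show "norm (exp (- \<i> * of_real (\<Theta> s)) * (- \<i> * m * q s)) \<le> K' s"
      using b[of s] by (simp add: norm_mult)
  qed (rule cE cK E)+
  moreover have "cmod (p t - exp (\<i> * of_real (\<Theta> t)) * p 0) = cmod (exp (\<i> * of_real (\<Theta> t)) * (E t - E 0))"
    by (simp add: E_def \<Theta>(2) right_diff_distrib mult.assoc[symmetric] exp_add[symmetric])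
  ultimately show ?thesis by (simp add: norm_mult)
qed

lemma phase_exists:
  fixes q :: "real \<Rightarrow> complex"
  assumes "continuous_on UNIV q"
  shows "\<exists>\<Theta>. (\<forall>s. (\<Theta> has_real_derivative 2 * (cmod (q s))\<^sup>2) (at s)) \<and> \<Theta> 0 = 0"
proof -
  have "continuous_on UNIV (\<lambda>s. 2 * (cmod (q s))\<^sup>2)" using assms by (intro continuous_intros)
  from continuous_has_antiderivative[OF this]
  obtain F where F: "\<And>s. (F has_vector_derivative 2 * (cmod (q s))\<^sup>2) (at s)" by blast
  then show ?thesis
    by (intro exI[of _ "\<lambda>s. F s - F 0"])
       (auto simp: has_real_derivative_iff_has_vector_derivative[symmetric] intro!: derivative_eq_intros)
qed

text \<open>Here \<open>A\<close> bounds \<open>\<bar>u\<bar>\<close> up to time \<open>t\<close>. The first summand is the contribution of the mass term along the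
  characteristic of \<open>u\<close>, the second one is the error in the phase.\<close>

definition scattering_error :: "real \<Rightarrow> real \<Rightarrow> real \<Rightarrow> real \<Rightarrow> real" where
  "scattering_error m t U \<kappa> = (let A = 2 * U + m * \<kappa> in
     (m * \<kappa> / 2 + m\<^sup>2 * t\<^sup>2 * A / 2) + U * (2 * m * t * A * \<kappa> + 2 * m\<^sup>2 * t ^ 3 * A\<^sup>2))"

text \<open>The phase of \<open>u\<close> is \<open>2\<integral>\<bar>v\<bar>\<^sup>2\<close> along its characteristic, on which \<open>v\<close> runs past with relative speed
  \<open>2\<close>; with \<open>v\<close> replaced by its transported initial modulus \<open>k\<close> this is \<open>J (x + t) - J (x - t)\<close>. The mass
  changes \<open>\<bar>v\<bar>\<close> by at most \<open>mtA\<close>, where \<open>A\<close> bounds \<open>\<bar>u\<bar>\<close>, and it changes \<open>u\<close> by at most the integral of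
  \<open>m\<bar>v\<bar>\<close> along the characteristic, in which the pulse counts with its \<open>L\<^sup>1\<close> norm only.\<close>

lemma scattering_phase:
  fixes u v :: "real \<Rightarrow> real \<Rightarrow> complex" and k K J :: "real \<Rightarrow> real" and m t B U \<kappa> x :: real
  assumes sol: "characteristic_solution m u v" and m: "m \<ge> 0" and t: "t > 0" and mt: "m * t \<le> 1"
    and bdd: "\<And>s x. 0 \<le> s \<Longrightarrow> s \<le> t \<Longrightarrow> cmod (u s x) \<le> B"
    and U: "\<And>x. cmod (u 0 x) \<le> U"
    and k: "\<And>x. cmod (v 0 x) = k x"
    and K: "\<And>x. (K has_real_derivative k x) (at x)" "\<And>a b. K b - K a \<le> \<kappa>"
    and J: "\<And>x. (J has_real_derivative (k x)\<^sup>2) (at x)"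
  shows "cmod (u t x - exp (\<i> * of_real (J (x + t) - J (x - t))) * u 0 (x - t)) \<le> scattering_error m t U \<kappa>"
proof -
  have cu: "continuous_on UNIV (\<lambda>(t, x). u t x)" and cv: "continuous_on UNIV (\<lambda>(t, x). v t x)"
    and du: "\<And>t y. ((\<lambda>s. u s (y + s)) has_vector_derivative
        (- \<i> * m * v t (y + t) + 2 * \<i> * (cmod (v t (y + t)))\<^sup>2 * u t (y + t))) (at t)"
    and dv: "\<And>t y. ((\<lambda>s. v s (y - s)) has_vector_derivative
        (- \<i> * m * u t (y - t) + 2 * \<i> * (cmod (u t (y - t)))\<^sup>2 * v t (y - t))) (at t)"
    using sol by (auto simp: characteristic_solution_def)
  have \<kappa>: "\<kappa> \<ge> 0" using K(2)[of 0 0] by simp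
  have k0: "k x \<ge> 0" for x using k[of x, symmetric] by simp
  have "U \<ge> 0" using U[of 0] norm_ge_zero order_trans by blast
  have v_bound: "\<bar>cmod (v s x) - k (x + s)\<bar> \<le> m * s * A"
    if A: "\<And>s x. 0 \<le> s \<Longrightarrow> s \<le> t \<Longrightarrow> cmod (u s x) \<le> A" and s: "0 \<le> s" "s \<le> t" for A s x
  proof -
    have "continuous_on UNIV (\<lambda>r. u r (x + s - r))" by (intro continuous_on_compose_2[OF cu] continuous_intros)
    from phase_exists[OF this] obtain \<Theta> where T: "\<And>r. (\<Theta> has_real_derivative 2 * (cmod (u r (x + s - r)))\<^sup>2) (at r)" "\<Theta> 0 = 0"
      by blast
    have "cmod (v s (x + s - s) - exp (\<i> * of_real (\<Theta> s)) * v 0 (x + s - 0)) \<le> m * A * s - m * A * 0"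
    proof (rule phase_removed_bound[where p = "\<lambda>r. v r (x + s - r)" and q = "\<lambda>r. u r (x + s - r)" and m = m and \<Theta> = \<Theta>
          and K = "\<lambda>r. m * A * r" and K' = "\<lambda>r. m * A"])
      show "\<bar>m\<bar> * cmod (u r (x + s - r)) \<le> m * A" if "0 \<le> r" "r \<le> s" for r
        using A[of r] that s m by (simp add: mult_left_mono)
    qed (use dv T s in \<open>auto intro!: derivative_eq_intros\<close>)
    then have "cmod (v s x - exp (\<i> * of_real (\<Theta> s)) * v 0 (x + s)) \<le> m * A * s" by simp
    moreover have "\<bar>cmod (v s x) - cmod (exp (\<i> * of_real (\<Theta> s)) * v 0 (x + s))\<bar> \<le> cmod (v s x - exp (\<i> * of_real (\<Theta> s)) * v 0 (x + s))"
      by (rule norm_triangle_ineq3)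
    ultimately show ?thesis by (simp add: norm_mult k mult_ac)
  qed
  have speed_two: "((\<lambda>r. F (y + 2 * r)) has_real_derivative 2 * F' (y + 2 * r)) (at r)"
    if F: "\<And>x. (F has_real_derivative F' x) (at x)" for F F' :: "real \<Rightarrow> real" and y r
  proof -
    have "((\<lambda>r. y + 2 * r) has_real_derivative 2) (at r)" by (auto intro!: derivative_eq_intros)
    from DERIV_chain'[OF this F] show ?thesis by (simp add: mult.commute)
  qed
  have u_bound: "\<exists>\<Theta>. (\<forall>r. (\<Theta> has_real_derivative 2 * (cmod (v r (y + r)))\<^sup>2) (at r)) \<and> \<Theta> 0 = 0 \<and>
      cmod (u s (y + s) - exp (\<i> * of_real (\<Theta> s)) * u 0 y) \<le> m * \<kappa> / 2 + m\<^sup>2 * s\<^sup>2 * A / 2"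
    if A: "\<And>s x. 0 \<le> s \<Longrightarrow> s \<le> t \<Longrightarrow> cmod (u s x) \<le> A" and s: "0 \<le> s" "s \<le> t" for A s y
  proof -
    have "continuous_on UNIV (\<lambda>r. v r (y + r))" by (intro continuous_on_compose_2[OF cv] continuous_intros)
    from phase_exists[OF this] obtain \<Theta> where T: "\<And>r. (\<Theta> has_real_derivative 2 * (cmod (v r (y + r)))\<^sup>2) (at r)" "\<Theta> 0 = 0"
      by blast
    define M where "M r = m / 2 * K (y + 2 * r) + m\<^sup>2 * A / 2 * r\<^sup>2" for r
    have dK: "((\<lambda>r. K (y + 2 * r)) has_real_derivative 2 * k (y + 2 * r)) (at r)" for r
      by (rule speed_two[OF K(1)])
    have dM: "(M has_real_derivative m * (k (y + 2 * r) + m * r * A)) (at r)" for r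
    proof -
      have "((\<lambda>r. r\<^sup>2) has_real_derivative 2 * r) (at r)" by (auto intro!: derivative_eq_intros)
      from DERIV_add[OF DERIV_cmult[OF dK, of "m / 2"] DERIV_cmult[OF this, of "m\<^sup>2 * A / 2"]]
      show ?thesis unfolding M_def[abs_def] by (simp add: algebra_simps power2_eq_square)
    qed
    have "cmod (u s (y + s) - exp (\<i> * of_real (\<Theta> s)) * u 0 (y + 0)) \<le> M s - M 0"
    proof (rule phase_removed_bound[where p = "\<lambda>r. u r (y + r)" and q = "\<lambda>r. v r (y + r)" and m = m and \<Theta> = \<Theta> and K = M, OF du T dM])
      fix r assume r: "0 \<le> r" "r \<le> s"
      have "\<bar>cmod (v r (y + r)) - k (y + r + r)\<bar> \<le> m * r * A" using v_bound[OF A, of r "y + r"] r s by simp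
      moreover have "y + r + r = y + 2 * r" by simp
      ultimately have "cmod (v r (y + r)) \<le> k (y + 2 * r) + m * r * A" by (simp only: abs_le_iff) linarith
      then show "\<bar>m\<bar> * cmod (v r (y + r)) \<le> m * (k (y + 2 * r) + m * r * A)" using m by (simp add: mult_left_mono)
    qed (rule s(1))
    also have "M s - M 0 = m * (K (y + 2 * s) - K y) / 2 + m\<^sup>2 * s\<^sup>2 * A / 2"
      by (simp add: M_def field_simps)
    also have "\<dots> \<le> m * \<kappa> / 2 + m\<^sup>2 * s\<^sup>2 * A / 2"
      using mult_left_mono[OF K(2)[of "y + 2 * s" y] m] by simp
    finally show ?thesis using T by (intro exI[of _ \<Theta>]) simp
  qed
  define A where "A = 2 * U + m * \<kappa>"
  have A: "cmod (u s x) \<le> A" if s: "0 \<le> s" "s \<le> t" for s x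
  proof -
    \<comment> \<open>The supremum \<open>A0\<close> of \<open>\<bar>u\<bar>\<close> satisfies \<open>A0 \<le> U + m\<kappa> / 2 + A0 / 2\<close> because \<open>mt \<le> 1\<close>; it is finite, so the last term can be absorbed.\<close>
    define S where "S = {cmod (u s x) | s x. 0 \<le> s \<and> s \<le> t}"
    have "cmod (u 0 0) \<in> S" unfolding S_def using t by (intro CollectI exI[of _ 0]) simp
    then have ne: "S \<noteq> {}" by blast
    have bS: "bdd_above S" by (rule bdd_aboveI[of _ B]) (use bdd in \<open>auto simp: S_def\<close>)
    define A0 where "A0 = Sup S"
    have A0: "cmod (u s x) \<le> A0" if "0 \<le> s" "s \<le> t" for s x
      unfolding A0_def by (rule cSup_upper[OF _ bS]) (unfold S_def, use that in blast)
    have "A0 \<ge> 0" using A0[of 0 0] t norm_ge_zero[of "u 0 0"] by linarith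
    have "z \<le> U + m * \<kappa> / 2 + A0 / 2" if z: "z \<in> S" for z
    proof -
      obtain s x where sx: "z = cmod (u s x)" "0 \<le> s" "s \<le> t" using z by (auto simp: S_def)
      obtain \<Theta> :: "real \<Rightarrow> real" where T: "cmod (u s (x - s + s) - exp (\<i> * of_real (\<Theta> s)) * u 0 (x - s)) \<le> m * \<kappa> / 2 + m\<^sup>2 * s\<^sup>2 * A0 / 2"
        using u_bound[OF A0 sx(2,3), of "x - s"] by blast
      have "m * s \<le> 1" using mt sx m by (meson mult_left_mono order_trans)
      then have "(m * s)\<^sup>2 \<le> 1\<^sup>2" using m sx by (intro power_mono) auto
      then have "m\<^sup>2 * s\<^sup>2 * A0 \<le> A0" using \<open>A0 \<ge> 0\<close> by (simp add: power_mult_distrib mult_left_le_one_le)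
      moreover have "cmod (u s x) \<le> cmod (exp (\<i> * of_real (\<Theta> s)) * u 0 (x - s)) + cmod (u s x - exp (\<i> * of_real (\<Theta> s)) * u 0 (x - s))"
        by (rule norm_triangle_sub)
      moreover have "cmod (exp (\<i> * of_real (\<Theta> s)) * u 0 (x - s)) \<le> U" using U by (simp add: norm_mult)
      ultimately show ?thesis using T sx(1) by simp
    qed
    then have "A0 \<le> U + m * \<kappa> / 2 + A0 / 2" unfolding A0_def[symmetric] using cSup_least[OF ne] by (simp add: A0_def)
    then have "A0 \<le> A" by (simp add: A_def)
    then show ?thesis using A0[OF s, of x] by simp
  qed
  have "A \<ge> 0" using \<open>U \<ge> 0\<close> m \<kappa> by (simp add: A_def)
  define y where "y = x - t"
  obtain \<Theta> :: "real \<Rightarrow> real" where T: "\<And>r. (\<Theta> has_real_derivative 2 * (cmod (v r (y + r)))\<^sup>2) (at r)" "\<Theta> 0 = 0"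
    and Tu: "cmod (u t (y + t) - exp (\<i> * of_real (\<Theta> t)) * u 0 y) \<le> m * \<kappa> / 2 + m\<^sup>2 * t\<^sup>2 * A / 2"
    using u_bound[OF A, of t y] t by auto
  have phase: "\<bar>\<Theta> t - (J (y + 2 * t) - J y)\<bar> \<le> 2 * m * t * A * \<kappa> + 2 * m\<^sup>2 * t ^ 3 * A\<^sup>2"
  proof -
    define D where "D s = \<Theta> s - J (y + 2 * s)" for s
    define M where "M s = 2 * m * t * A * K (y + 2 * s) + 2 * (m * t * A)\<^sup>2 * s" for s
    have dJ: "((\<lambda>r. J (y + 2 * r)) has_real_derivative 2 * (k (y + 2 * r))\<^sup>2) (at r)" for r
      by (rule speed_two[OF J])
    have dK: "((\<lambda>r. K (y + 2 * r)) has_real_derivative 2 * k (y + 2 * r)) (at r)" for r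
      by (rule speed_two[OF K(1)])
    have dD: "(D has_real_derivative 2 * (cmod (v r (y + r)))\<^sup>2 - 2 * (k (y + 2 * r))\<^sup>2) (at r)" for r
      unfolding D_def[abs_def] by (intro DERIV_diff T dJ)
    have dM: "(M has_real_derivative 2 * (m * t * A) * (2 * k (y + 2 * r) + m * t * A)) (at r)" for r
      using DERIV_add[OF DERIV_cmult[OF dK, of "2 * m * t * A"] DERIV_cmult[OF DERIV_ident, of "2 * (m * t * A)\<^sup>2"]]
      unfolding M_def[abs_def] by (simp add: algebra_simps power2_eq_square)
    have "norm (D t - D 0) \<le> M t - M 0"
    proof (rule differentiable_bound_general[where f' = "\<lambda>r. 2 * (cmod (v r (y + r)))\<^sup>2 - 2 * (k (y + 2 * r))\<^sup>2"
          and \<phi>' = "\<lambda>r. 2 * (m * t * A) * (2 * k (y + 2 * r) + m * t * A)", OF t])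
      show "continuous_on {0..t} D" "continuous_on {0..t} M"
        using dD dM by (auto intro!: continuous_at_imp_continuous_on DERIV_isCont)
      fix r assume r: "0 < r" "r < t"
      define a b where "a = cmod (v r (y + r))" and "b = k (y + 2 * r)"
      have "\<bar>cmod (v r (y + r)) - k (y + r + r)\<bar> \<le> m * r * A" using v_bound[OF A, of r "y + r"] r by auto
      also have "\<dots> \<le> m * t * A" using r m \<open>A \<ge> 0\<close> by (intro mult_right_mono mult_left_mono) auto
      finally have "\<bar>cmod (v r (y + r)) - k (y + r + r)\<bar> \<le> m * t * A" .
      moreover have "y + r + r = y + 2 * r" by simp
      ultimately have ab: "\<bar>a - b\<bar> \<le> m * t * A" by (simp only: a_def b_def)
      have "a \<ge> 0" "b \<ge> 0" by (simp_all add: a_def b_def k0)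
      have "\<bar>a\<^sup>2 - b\<^sup>2\<bar> = \<bar>a - b\<bar> * (a + b)"
        using \<open>a \<ge> 0\<close> \<open>b \<ge> 0\<close> by (simp add: power2_eq_square square_diff_square_factored abs_mult mult.commute)
      also have "\<dots> \<le> (m * t * A) * (2 * b + m * t * A)"
        using ab \<open>a \<ge> 0\<close> \<open>b \<ge> 0\<close> by (intro mult_mono) auto
      finally have "\<bar>a\<^sup>2 - b\<^sup>2\<bar> \<le> (m * t * A) * (2 * b + m * t * A)" .
      then have "\<bar>2 * a\<^sup>2 - 2 * b\<^sup>2\<bar> \<le> 2 * (m * t * A) * (2 * b + m * t * A)"
        unfolding mult.assoc[of 2 "m * t * A"] by linarith
      then show "norm (2 * (cmod (v r (y + r)))\<^sup>2 - 2 * (k (y + 2 * r))\<^sup>2) \<le> 2 * (m * t * A) * (2 * k (y + 2 * r) + m * t * A)"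
        unfolding a_def b_def real_norm_def .
    qed (use dD dM in \<open>auto simp: has_real_derivative_iff_has_vector_derivative\<close>)
    also have "M t - M 0 = 2 * m * t * A * (K (y + 2 * t) - K y) + 2 * m\<^sup>2 * t ^ 3 * A\<^sup>2"
      by (simp add: M_def algebra_simps power2_eq_square power3_eq_cube)
    also have "\<dots> \<le> 2 * m * t * A * \<kappa> + 2 * m\<^sup>2 * t ^ 3 * A\<^sup>2"
      using K(2)[of "y + 2 * t" y] m t \<open>A \<ge> 0\<close> by (intro add_right_mono mult_left_mono) auto
    finally show ?thesis using T(2) by (simp add: D_def algebra_simps)
  qed
  define \<theta> where "\<theta> = J (y + 2 * t) - J y"
  have "cmod (exp (\<i> * of_real (\<Theta> t)) * u 0 y - exp (\<i> * of_real \<theta>) * u 0 y)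
      = cmod (exp (\<i> * of_real (\<Theta> t)) - exp (\<i> * of_real \<theta>)) * cmod (u 0 y)"
    by (simp only: left_diff_distrib[symmetric] norm_mult)
  also have "\<dots> \<le> \<bar>\<Theta> t - \<theta>\<bar> * U"
    by (intro mult_mono cmod_exp_i_diff_le U) auto
  also have "\<dots> \<le> (2 * m * t * A * \<kappa> + 2 * m\<^sup>2 * t ^ 3 * A\<^sup>2) * U"
    using phase \<open>U \<ge> 0\<close> by (intro mult_right_mono) (auto simp: \<theta>_def)
  finally have "cmod (exp (\<i> * of_real (\<Theta> t)) * u 0 y - exp (\<i> * of_real \<theta>) * u 0 y) \<le> (2 * m * t * A * \<kappa> + 2 * m\<^sup>2 * t ^ 3 * A\<^sup>2) * U" .
  moreover have "cmod (u t (y + t) - exp (\<i> * of_real \<theta>) * u 0 y) \<le> cmod (u t (y + t) - exp (\<i> * of_real (\<Theta> t)) * u 0 y)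
      + cmod (exp (\<i> * of_real (\<Theta> t)) * u 0 y - exp (\<i> * of_real \<theta>) * u 0 y)"
    using norm_triangle_ineq[of "u t (y + t) - exp (\<i> * of_real (\<Theta> t)) * u 0 y" "exp (\<i> * of_real (\<Theta> t)) * u 0 y - exp (\<i> * of_real \<theta>) * u 0 y"]
    by simp
  moreover have "scattering_error m t U \<kappa> = (m * \<kappa> / 2 + m\<^sup>2 * t\<^sup>2 * A / 2) + (2 * m * t * A * \<kappa> + 2 * m\<^sup>2 * t ^ 3 * A\<^sup>2) * U"
    by (simp only: scattering_error_def Let_def A_def mult.commute[of U])
  ultimately have "cmod (u t (y + t) - exp (\<i> * of_real \<theta>) * u 0 y) \<le> scattering_error m t U \<kappa>"
    using Tu by linarith
  moreover have "y + t = x" "y + 2 * t = x + t" by (simp_all add: y_def)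
  ultimately show ?thesis by (simp only: \<theta>_def) (simp only: y_def)
qed

section \<open>Modulated Gaussians\<close>

definition packet :: "real \<Rightarrow> real \<Rightarrow> real \<Rightarrow> real \<Rightarrow> complex" where
  "packet c a \<omega> x = of_real c * (exp (\<i> * of_real (\<omega> * x)) * of_real (gauss (a * x)))"

lemma cmod_packet: "cmod (packet c a \<omega> x) = \<bar>c\<bar> * gauss (a * x)"
  using gauss_pos[of "a * x"] by (simp add: packet_def norm_mult norm_exp_eq_Re)

text \<open>From \<open>y\<^sup>k / k! \<le> exp y\<close> with \<open>y = (ax)\<^sup>2 / 2\<close>, which bounds the even power \<open>x\<^sup>2\<^sup>k\<close>.\<close>

lemma power_times_gauss_bounded:
  assumes "a > 0"
  shows "\<exists>B. \<forall>x. \<bar>x\<bar> ^ k * gauss (a * x) \<le> B"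
proof -
  define B where "B = fact k * (2 / a\<^sup>2) ^ k"
  have "\<bar>x\<bar> ^ k * gauss (a * x) \<le> 1 + B" for x
  proof -
    define y where "y = (a * x)\<^sup>2 / 2"
    have y: "y \<ge> 0" by (simp add: y_def)
    have "y ^ k / fact k \<le> exp y"
    proof -
      have "(\<Sum>n\<in>{k}. y ^ n /\<^sub>R fact n) \<le> (\<Sum>n. y ^ n /\<^sub>R fact n)"
        by (rule sum_le_suminf[OF summable_exp_generic]) (use y in auto)
      then show ?thesis by (simp add: exp_def divide_inverse mult.commute)
    qed
    then have "y ^ k * exp (- y) \<le> fact k" by (simp add: exp_minus field_simps)
    moreover have "(x\<^sup>2) ^ k = (2 / a\<^sup>2) ^ k * y ^ k"
    proof -
      have "x\<^sup>2 = (2 / a\<^sup>2) * y" using assms by (simp add: y_def power_mult_distrib)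
      then show ?thesis by (simp only: power_mult_distrib)
    qed
    ultimately have "(x\<^sup>2) ^ k * gauss (a * x) \<le> B"
      using mult_left_mono[of "y ^ k * exp (- y)" "fact k" "(2 / a\<^sup>2) ^ k"]
      by (simp add: B_def gauss_def y_def mult_ac)
    moreover have "\<bar>x\<bar> ^ k \<le> 1 + (x\<^sup>2) ^ k"
    proof (cases "\<bar>x\<bar> \<le> 1")
      case True
      then show ?thesis using power_le_one[of "\<bar>x\<bar>" k] by (simp add: add_increasing2)
    next
      case False
      then have "\<bar>x\<bar> ^ k * 1 \<le> \<bar>x\<bar> ^ k * \<bar>x\<bar> ^ k" by (intro mult_left_mono one_le_power) auto
      moreover have "(x\<^sup>2) ^ k = \<bar>x\<bar> ^ k * \<bar>x\<bar> ^ k"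
        by (metis power2_abs power2_eq_square power_mult_distrib)
      ultimately show ?thesis by simp
    qed
    ultimately show ?thesis
      using gauss_pos[of "a * x"] gauss_le_1[of "a * x"] mult_right_mono[of "\<bar>x\<bar> ^ k" "1 + (x\<^sup>2) ^ k" "gauss (a * x)"]
      by (simp add: distrib_right)
  qed
  then show ?thesis by blast
qed

text \<open>Polynomials that multiply the Gaussian in its successive derivatives.\<close>

primrec packet_poly :: "real \<Rightarrow> real \<Rightarrow> real \<Rightarrow> nat \<Rightarrow> complex poly" where
  "packet_poly c a \<omega> 0 = [:of_real c:]"
| "packet_poly c a \<omega> (Suc n) = pderiv (packet_poly c a \<omega> n) + packet_poly c a \<omega> n * [:\<i> * of_real \<omega>, - of_real (a\<^sup>2):]"

lemma poly_packet_bounded: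
  assumes "a > 0"
  shows "\<exists>B. \<forall>x. \<bar>x\<bar> ^ k * cmod (poly p (of_real x)) * gauss (a * x) \<le> B"
proof (induction p arbitrary: k)
  case 0
  then show ?case by auto
next
  case (pCons c p)
  obtain B1 where B1: "\<And>x. \<bar>x\<bar> ^ k * gauss (a * x) \<le> B1" using power_times_gauss_bounded[OF assms] by blast
  obtain B2 where B2: "\<And>x. \<bar>x\<bar> ^ Suc k * cmod (poly p (of_real x)) * gauss (a * x) \<le> B2" using pCons.IH by blast
  have "\<bar>x\<bar> ^ k * cmod (poly (pCons c p) (of_real x)) * gauss (a * x) \<le> cmod c * B1 + B2" for x
  proof -
    have "cmod (poly (pCons c p) (of_real x)) \<le> cmod c + \<bar>x\<bar> * cmod (poly p (of_real x))"
      using norm_triangle_ineq[of c "of_real x * poly p (of_real x)"] by (simp add: norm_mult)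
    then have "\<bar>x\<bar> ^ k * cmod (poly (pCons c p) (of_real x)) * gauss (a * x)
       \<le> \<bar>x\<bar> ^ k * (cmod c + \<bar>x\<bar> * cmod (poly p (of_real x))) * gauss (a * x)"
      by (intro mult_right_mono mult_left_mono) (auto simp: gauss_pos less_imp_le)
    also have "\<dots> = cmod c * (\<bar>x\<bar> ^ k * gauss (a * x)) + \<bar>x\<bar> ^ Suc k * cmod (poly p (of_real x)) * gauss (a * x)"
      by (simp add: algebra_simps)
    also have "\<dots> \<le> cmod c * B1 + B2" by (intro add_mono mult_left_mono B1 B2) simp
    finally show ?thesis .
  qed
  then show ?case by blast
qed

lemma packet_schwartz:
  assumes a: "a > 0"
  shows "packet c a \<omega> \<in> schwartz"
proof -
  define D where "D n x = poly (packet_poly c a \<omega> n) (of_real x) * exp (\<i> * of_real (\<omega> * x) - of_real ((a * x)\<^sup>2 / 2))" for n x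
  have cE: "cmod (exp (\<i> * of_real (\<omega> * x) - of_real ((a * x)\<^sup>2 / 2))) = gauss (a * x)" for x
    by (simp add: norm_exp_eq_Re gauss_def)
  have "(D n has_vector_derivative D (Suc n) x) (at x)" for n x
  proof -
    have "((\<lambda>z. poly (packet_poly c a \<omega> n) z * exp (\<i> * (of_real \<omega> * z) - (of_real a * z)\<^sup>2 / 2)) has_field_derivative
       poly (packet_poly c a \<omega> (Suc n)) (of_real x) * exp (\<i> * (of_real \<omega> * of_real x) - (of_real a * of_real x)\<^sup>2 / 2)) (at (of_real x))"
    proof -
      define E where "E z = exp (\<i> * (of_real \<omega> * z) - (of_real a * z)\<^sup>2 / 2)" for z
      have E: "(E has_field_derivative E z * (\<i> * of_real \<omega> - (of_real a)\<^sup>2 * z)) (at z)" for z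
        unfolding E_def[abs_def] by (auto intro!: derivative_eq_intros simp: power2_eq_square)
      show ?thesis
        using DERIV_mult[OF poly_DERIV[of "packet_poly c a \<omega> n"] E, of "of_real x"]
        unfolding E_def by (simp add: distrib_left distrib_right right_diff_distrib left_diff_distrib mult_ac add_ac)
    qed
    from has_vector_derivative_real_field[OF this] show ?thesis unfolding D_def[abs_def] by simp
  qed
  moreover have "bounded (range (\<lambda>x. x ^ k *\<^sub>R D n x))" for n k
  proof -
    obtain B where "\<And>x. \<bar>x\<bar> ^ k * cmod (poly (packet_poly c a \<omega> n) (of_real x)) * gauss (a * x) \<le> B"
      using poly_packet_bounded[OF a] by blast
    then have "norm (x ^ k *\<^sub>R D n x) \<le> B" for x
      by (simp only: D_def norm_scaleR norm_mult cE power_abs mult.assoc)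
    then show ?thesis unfolding bounded_iff by blast
  qed
  moreover have "D 0 = packet c a \<omega>"
  proof
    fix x
    have "exp (\<i> * of_real (\<omega> * x) - of_real ((a * x)\<^sup>2 / 2)) = exp (\<i> * of_real (\<omega> * x)) * of_real (gauss (a * x))"
      unfolding gauss_def exp_of_real[symmetric] exp_add[symmetric] by (simp add: algebra_simps)
    then show "D 0 x = packet c a \<omega> x" by (simp add: D_def packet_def)
  qed
  ultimately show ?thesis unfolding schwartz_def by blast
qed

abbreviation wave :: "real \<Rightarrow> complex" where "wave \<equiv> packet 1 1 0"

lemma wave_eq: "wave x = of_real (gauss x)"
  by (simp add: packet_def)

lemma wave_schwartz: "wave \<in> schwartz"
  by (rule packet_schwartz) simp

lemma wave_le_1: "cmod (wave x) \<le> 1"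
  using gauss_le_1[of x] gauss_pos[of x] by (simp add: wave_eq)

lemma zero_schwartz: "(\<lambda>x. 0) \<in> schwartz"
  using schwartz_combination[OF wave_schwartz wave_schwartz, of 0 0] by simp

section \<open>Initial data with Schwartz components\<close>

lemma norm_smult_combination_le:
  "norm e = 1 \<Longrightarrow> norm f = 1 \<Longrightarrow> norm (c *s e + d *s (f :: spinor)) \<le> cmod c + cmod d"
  using norm_triangle_ineq[of "c *s e" "d *s f"] by (simp add: norm_vector_smult)

lemma square_sum_le: "(x + y)\<^sup>2 \<le> 2 * x\<^sup>2 + 2 * (y::real)\<^sup>2"
  using sum_squares_bound[of x y] by (simp add: power2_sum)

context chiral_basis begin

definition datum :: "(real \<Rightarrow> complex) \<Rightarrow> (real \<Rightarrow> complex) \<Rightarrow> field" where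
  "datum p q x = p x *s e + q x *s f"

lemma cinner_datum: "cinner e (datum p q x) = p x" "cinner f (datum p q x) = q x"
  by (simp_all add: datum_def cinner_simps ee ef fe ff)

lemma datum_measurable:
  assumes [measurable]: "p \<in> borel_measurable borel" "q \<in> borel_measurable borel"
  shows "datum p q \<in> borel_measurable borel"
  unfolding datum_def[abs_def] by measurable

lemma datum_norm: "norm (datum p q x) \<le> cmod (p x) + cmod (q x)"
  unfolding datum_def by (rule norm_smult_combination_le[OF norm_e norm_f])

lemma datum_Lp_2:
  assumes m: "p \<in> borel_measurable borel" "q \<in> borel_measurable borel"
    and i: "integrable lborel (\<lambda>x. (cmod (p x))\<^sup>2)" "integrable lborel (\<lambda>x. (cmod (q x))\<^sup>2)"
  shows "datum p q \<in> Lp_space 2"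
proof -
  have [measurable]: "datum p q \<in> borel_measurable borel" by (rule datum_measurable[OF m])
  have "integrable lborel (\<lambda>x. (norm (datum p q x))\<^sup>2)"
  proof (rule Bochner_Integration.integrable_bound)
    show "integrable lborel (\<lambda>x. 2 * (cmod (p x))\<^sup>2 + 2 * (cmod (q x))\<^sup>2)" using i by simp
    show "AE x in lborel. norm ((norm (datum p q x))\<^sup>2) \<le> norm (2 * (cmod (p x))\<^sup>2 + 2 * (cmod (q x))\<^sup>2)"
    proof (rule AE_I2)
      fix x
      have "(norm (datum p q x))\<^sup>2 \<le> (cmod (p x) + cmod (q x))\<^sup>2" by (rule power_mono[OF datum_norm]) simp
      also have "\<dots> \<le> 2 * (cmod (p x))\<^sup>2 + 2 * (cmod (q x))\<^sup>2" by (rule square_sum_le)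
      finally show "norm ((norm (datum p q x))\<^sup>2) \<le> norm (2 * (cmod (p x))\<^sup>2 + 2 * (cmod (q x))\<^sup>2)" by simp
    qed
  qed measurable
  then show ?thesis by (simp add: Lp_space_2)
qed

lemma integral_datum:
  assumes "integrable lborel (\<lambda>x. \<phi> x * p x)" "integrable lborel (\<lambda>x. \<phi> x * q x)"
  shows "regular (datum p q) \<phi> = (LINT x|lborel. \<phi> x * p x) *s e + (LINT x|lborel. \<phi> x * q x) *s f"
proof -
  have eq: "\<phi> x *s datum p q x = (\<phi> x * p x) *s e + (\<phi> x * q x) *s f" for x
    by (simp add: datum_def vec.scale_right_distrib)
  show ?thesis
    unfolding regular_def eq
    by (subst Bochner_Integration.integral_add)
       (use assms in \<open>auto intro: integrable_bounded_linear[OF bounded_linear_smult_left]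
          simp: integral_bounded_linear[OF bounded_linear_smult_left]\<close>)
qed

lemma datum_Hs_rep:
  assumes p: "p \<in> schwartz" and q: "q \<in> schwartz"
  shows "Hs_rep s (regular (datum p q)) (datum (bessel_op s p) (bessel_op s q))"
  unfolding Hs_rep_def
proof (intro conjI ballI)
  show "datum (bessel_op s p) (bessel_op s q) \<in> Lp_space 2"
    using p q by (intro datum_Lp_2 bessel_op_measurable bessel_op_square_integrable)
  fix \<phi> assume phi: "\<phi> \<in> schwartz"
  have i: "integrable lborel (\<lambda>x. \<phi> x * r x)" if "r \<in> schwartz" for r
    by (intro integrable_mult_of_squares schwartz_measurable schwartz_square_integrable phi that)
  have j: "integrable lborel (\<lambda>x. bessel_op (- s) \<phi> x * bessel_op s r x)" if "r \<in> schwartz" for r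
    by (intro integrable_mult_of_squares bessel_op_measurable bessel_op_square_integrable phi that)
  show "regular (datum p q) \<phi> = regular (datum (bessel_op s p) (bessel_op s q)) (bessel_op (- s) \<phi>)"
    by (simp only: integral_datum i j p q bessel_op_duality[OF phi])
qed

lemma datum_schwartz_Lp_2: "p \<in> schwartz \<Longrightarrow> q \<in> schwartz \<Longrightarrow> datum p q \<in> Lp_space 2"
  by (intro datum_Lp_2 schwartz_measurable schwartz_square_integrable)

lemma bessel_op_zero: "bessel_op s (\<lambda>x. 0) = (\<lambda>x. 0)"
  by (simp add: bessel_op_def fourier_def fun_eq_iff)

text \<open>Schwartz data lie in \<open>H\<^sup>1\<close>, so the solution is one for which the characteristic equations hold; its
  initial values agree with the data everywhere because both are continuous.\<close>

theorem scattered_wave: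
  assumes \<Phi>: "L2_data_to_solution \<gamma> m \<Phi>" and m: "m \<ge> 0" and t: "t > 0" and mt: "m * t \<le> 1"
    and p: "p \<in> schwartz" and q: "q \<in> schwartz"
    and U: "\<And>x. cmod (p x) \<le> U"
    and k: "\<And>x. cmod (q x) = k x"
    and K: "\<And>x. (K has_real_derivative k x) (at x)" "\<And>a b. K b - K a \<le> \<kappa>"
    and J: "\<And>x. (J has_real_derivative (k x)\<^sup>2) (at x)"
  shows "AE x in lborel. cmod (cinner e (\<Phi> (datum p q) t x) - exp (\<i> * of_real (J (x + t) - J (x - t))) * p (x - t))
     \<le> scattering_error m t U \<kappa>"
proof -
  have L2: "datum p q \<in> Lp_space 2" by (rule datum_schwartz_Lp_2[OF p q])
  have "regular (datum p q) \<in> Hs_space 1" using datum_Hs_rep[OF p q] unfolding Hs_space_def by blast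
  with \<Phi> L2 have sol: "H1_solution \<gamma> m (datum p q) (\<Phi> (datum p q))"
    unfolding L2_data_to_solution_def by blast
  obtain u v where uv: "characteristic_solution m u v"
    and ae: "\<And>t. AE x in lborel. cinner e (\<Phi> (datum p q) t x) = u t x \<and> cinner f (\<Phi> (datum p q) t x) = v t x"
    and bdd: "\<And>T. \<exists>B. \<forall>t x. \<bar>t\<bar> \<le> T \<longrightarrow> cmod (u t x) \<le> B"
    using H1_solution_characteristic[OF sol] by blast
  have cu: "continuous_on UNIV (u 0)" and cv: "continuous_on UNIV (v 0)"
    using uv continuous_on_compose_2[of _ UNIV "\<lambda>_. 0" "\<lambda>x. x"]
    by (auto simp: characteristic_solution_def)
  have init: "AE x in lborel. \<Phi> (datum p q) 0 x = datum p q x"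
    using sol by (simp add: H1_solution_def ae_equal_def)
  have eq: "g x = h x" if "continuous_on UNIV g" "continuous_on UNIV h" "AE x in lborel. g x = h x" for g h :: "real \<Rightarrow> complex" and x
  proof -
    have "cmod (g x - h x) \<le> 0"
      using that by (intro continuous_AE_le) (auto intro!: continuous_intros elim: AE_mp)
    then show ?thesis by simp
  qed
  have u0: "u 0 x = p x" for x
  proof (rule eq[OF cu schwartz_continuous[OF p]])
    show "AE x in lborel. u 0 x = p x"
      using ae[of 0] init by eventually_elim (metis cinner_datum(1))
  qed
  have v0: "v 0 x = q x" for x
  proof (rule eq[OF cv schwartz_continuous[OF q]])
    show "AE x in lborel. v 0 x = q x"
      using ae[of 0] init by eventually_elim (metis cinner_datum(2))
  qed
  obtain B where B: "\<And>s x. \<bar>s\<bar> \<le> t \<Longrightarrow> cmod (u s x) \<le> B" using bdd by blast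
  have bound: "cmod (u t x - exp (\<i> * of_real (J (x + t) - J (x - t))) * p (x - t)) \<le> scattering_error m t U \<kappa>" for x
    unfolding u0[symmetric]
    by (rule scattering_phase[OF uv m t mt, where B = B and k = k and K = K]) (use B U k K J in \<open>auto simp: u0 v0\<close>)
  show ?thesis using ae[of t] by eventually_elim (metis bound)
qed

end

section \<open>Antiderivatives and Gaussian integrals\<close>

lemma antiderivative_of_integrable:
  fixes h :: "real \<Rightarrow> real"
  assumes c: "continuous_on UNIV h" and nn: "\<And>x. h x \<ge> 0" and i: "integrable lborel h"
  shows "\<exists>H. (\<forall>x. (H has_real_derivative h x) (at x)) \<and> (\<forall>a b. H b - H a \<le> (LINT x|lborel. h x)) \<and>
     (\<forall>c>0. (\<lambda>n. H (c * real n) - H (- (c * real n))) \<longlonglongrightarrow> (LINT x|lborel. h x))"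
proof -
  obtain H where H: "\<And>x. (H has_vector_derivative h x) (at x)"
    using continuous_has_antiderivative[OF c] by blast
  have ftc: "H b - H a = (LINT x|lborel. indicat_real {a..b} x * h x)" if "a \<le> b" for a b
  proof -
    have "(h has_integral (H b - H a)) {a..b}"
      by (rule fundamental_theorem_of_calculus[OF that]) (use H in \<open>blast intro: has_vector_derivative_at_within\<close>)
    moreover have "set_integrable lborel {a..b} h"
      unfolding set_integrable_def by (rule integrable_mult_indicator[OF _ i]) simp
    ultimately show ?thesis
      using set_borel_integral_eq_integral(2)[of "{a..b}" h] by (simp add: integral_unique set_lebesgue_integral_def)
  qed
  have le: "H b - H a \<le> (LINT x|lborel. h x)" for a b
  proof (cases "a \<le> b")
    case True
    show ?thesis unfolding ftc[OF True] by (rule integral_mono'[OF i]) (auto simp: indicator_def nn)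
  next
    case False
    have "H a - H b = (LINT x|lborel. indicat_real {b..a} x * h x)" using ftc[of b a] False by simp
    also have "\<dots> \<ge> 0" by (rule integral_nonneg_AE) (simp add: nn)
    finally have "H b - H a \<le> 0" by simp
    also have "0 \<le> (LINT x|lborel. h x)" by (rule integral_nonneg_AE) (simp add: nn)
    finally show ?thesis .
  qed
  have lim: "(\<lambda>n. H (c * real n) - H (- (c * real n))) \<longlonglongrightarrow> (LINT x|lborel. h x)" if c0: "c > 0" for c
  proof -
    have "(\<lambda>n. LINT x|lborel. indicat_real {- (c * real n)..c * real n} x * h x) \<longlonglongrightarrow> (LINT x|lborel. h x)"
    proof (rule integral_dominated_convergence[where w = h])
      show "AE x in lborel. (\<lambda>n. indicat_real {- (c * real n)..c * real n} x * h x) \<longlonglongrightarrow> h x"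
      proof (rule AE_I2, rule tendsto_eventually)
        fix x
        obtain N where N: "\<bar>x\<bar> / c \<le> real N" using real_arch_simple by blast
        show "\<forall>\<^sub>F n in sequentially. indicat_real {- (c * real n)..c * real n} x * h x = h x"
          using eventually_ge_at_top[of N]
        proof eventually_elim
          case (elim n)
          have "\<bar>x\<bar> / c \<le> real n" using N elim by (meson of_nat_le_iff order_trans)
          then have "\<bar>x\<bar> \<le> c * real n" using c0 by (simp add: field_simps)
          then have "x \<in> {- (c * real n)..c * real n}" by auto
          then show ?case by simp
        qed
      qed
      show "AE x in lborel. norm (indicat_real {- (c * real n)..c * real n} x * h x) \<le> h x" for n
        by (rule AE_I2) (use nn in \<open>auto simp: indicator_def\<close>)
    qed (use i c in \<open>auto intro: borel_measurable_continuous_onI\<close>)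
    moreover have "H (c * real n) - H (- (c * real n)) = (LINT x|lborel. indicat_real {- (c * real n)..c * real n} x * h x)" for n
      by (rule ftc) (use c0 in \<open>simp add: order_trans[of _ 0]\<close>)
    ultimately show ?thesis by simp
  qed
  show ?thesis using H le lim by (auto simp: has_real_derivative_iff_has_vector_derivative)
qed

lemma continuous_on_gauss [continuous_intros]: "continuous_on S f \<Longrightarrow> continuous_on S (\<lambda>x. gauss (f x))"
  unfolding gauss_def by (intro continuous_intros) auto

lemma gauss_square: "(gauss x)\<^sup>2 = gauss (sqrt 2 * x)"
  by (simp add: gauss_def power_mult_distrib power2_eq_square[of "exp _"] exp_add[symmetric])

lemma integrable_gauss_scaled: "a > 0 \<Longrightarrow> integrable lborel (\<lambda>x. gauss (a * x))"
  using lborel_integrable_real_affine[OF integrable_gauss, of a 0] by simp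

lemma integral_gauss_scaled: "a > 0 \<Longrightarrow> (LINT x|lborel. gauss (a * x)) = sqrt (2 * pi) / a"
  using lborel_integral_real_affine[of a gauss 0] by (simp add: integral_gauss field_simps)

lemma scattering_error_massless: "scattering_error 0 t U \<kappa> = 0"
  by (simp add: scattering_error_def)

section \<open>Ill-posedness in \<open>L\<^sup>p\<close>\<close>

lemma Lp_norm_ge:
  assumes p: "p \<ge> 1" and w: "w \<in> Lp_space p" and r: "r > 0"
    and ge: "AE x in lborel. \<bar>x\<bar> \<le> r \<longrightarrow> 1 \<le> norm (w x)"
  shows "(2 * r) powr (1 / p) \<le> Lp_norm p w"
proof -
  have "2 * r = (LINT x|lborel. indicat_real {-r..r} x)" using r by simp
  also have "\<dots> \<le> (LINT x|lborel. norm (w x) powr p)"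
  proof (rule integral_mono_AE)
    show "integrable lborel (\<lambda>x. norm (w x) powr p)" using w by (simp add: Lp_space_def)
    show "AE x in lborel. indicat_real {-r..r} x \<le> norm (w x) powr p"
      using ge
    proof eventually_elim
      case (elim x)
      show ?case
      proof (cases "x \<in> {-r..r}")
        case True
        then have "1 \<le> norm (w x)" using elim by auto
        then have "1 powr p \<le> norm (w x) powr p" using p by (intro powr_mono2) auto
        then show ?thesis using True by simp
      qed simp
    qed
  qed simp
  finally show ?thesis unfolding Lp_norm_def using r p by (intro powr_mono2) auto
qed

context chiral_basis begin

lemma datum_Lp:
  assumes p: "p \<ge> 1" and a: "a \<in> schwartz" and b: "b \<in> schwartz"
  shows "datum a b \<in> Lp_space p"
proof -
  have [measurable]: "datum a b \<in> borel_measurable borel"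
    using a b by (intro datum_measurable schwartz_measurable)
  obtain C where C: "C \<ge> 0" "\<And>x. cmod (a x) \<le> C / (1 + x\<^sup>2)" using schwartz_decay[OF a] by blast
  obtain D where D: "D \<ge> 0" "\<And>x. cmod (b x) \<le> D / (1 + x\<^sup>2)" using schwartz_decay[OF b] by blast
  have "integrable lborel (\<lambda>x. norm (datum a b x) powr p)"
  proof (rule integrable_of_quadratic_decay)
    fix x :: real
    have pos: "1 + x\<^sup>2 \<ge> 1" by simp
    have "norm (datum a b x) \<le> (C + D) / (1 + x\<^sup>2)"
      using datum_norm[of a b x] C(2)[of x] D(2)[of x] by (simp add: add_divide_distrib)
    then have "norm (datum a b x) powr p \<le> ((C + D) / (1 + x\<^sup>2)) powr p"
      using p by (intro powr_mono2) auto
    also have "\<dots> = (C + D) powr p / (1 + x\<^sup>2) powr p"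
      by (rule powr_divide)
    also have "\<dots> \<le> (C + D) powr p / (1 + x\<^sup>2)"
    proof (rule divide_left_mono)
      show "1 + x\<^sup>2 \<le> (1 + x\<^sup>2) powr p" using powr_mono[OF p pos] pos by simp
      have "0 < (1 + x\<^sup>2) powr p" using one_plus_square_neq_0[of x] by simp
      then show "0 < (1 + x\<^sup>2) powr p * (1 + x\<^sup>2)" using pos by (intro mult_pos_pos) linarith+
    qed simp
    finally show "norm (norm (datum a b x) powr p) \<le> (C + D) powr p / (1 + x\<^sup>2)" by simp
  qed measurable
  then show ?thesis by (simp add: Lp_space_def)
qed

text \<open>With this amplitude all pulses have charge \<open>\<integral>\<bar>pulse n\<bar>\<^sup>2 = \<pi>\<close>, the phase shift that changes the sign of
  a wave.\<close>

definition pulse_amplitude :: real where "pulse_amplitude = sqrt (sqrt pi)"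

definition pulse :: "nat \<Rightarrow> real \<Rightarrow> complex" where
  "pulse n = packet (sqrt (real (Suc n)) * pulse_amplitude) (real (Suc n)) 0"

lemma pulse_amplitude_pos: "pulse_amplitude > 0"
  by (simp add: pulse_amplitude_def)

lemma pulse_schwartz: "pulse n \<in> schwartz"
  unfolding pulse_def by (rule packet_schwartz) simp

lemma cmod_pulse: "cmod (pulse n x) = sqrt (real (Suc n)) * pulse_amplitude * gauss (real (Suc n) * x)"
  using pulse_amplitude_pos by (simp add: pulse_def cmod_packet abs_mult)

text \<open>By scaling, the \<open>p\<close>-th power of the norm is proportional to \<open>n powr (p / 2 - 1)\<close>.\<close>

lemma pulse_Lp_tendsto_0:
  assumes p: "1 \<le> p" "p < 2"
  shows "(\<lambda>n. Lp_dist p (datum a (\<lambda>x. 0)) (datum a (pulse n))) \<longlonglongrightarrow> 0"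
proof -
  define C where "C = (LINT x|lborel. gauss x powr p)"
  have C: "C \<ge> 0" unfolding C_def by (rule integral_nonneg_AE) simp
  have "Lp_dist p (datum a (\<lambda>x. 0)) (datum a (pulse n)) = (pulse_amplitude powr p * C * real (Suc n) powr (p / 2 - 1)) powr (1 / p)" for n
  proof -
    define N where "N = real (Suc n)"
    have N: "N > 0" by (simp add: N_def)
    have nrm: "norm (datum a (\<lambda>x. 0) x - datum a (pulse n) x) = sqrt N * pulse_amplitude * gauss (N * x)" for x
      unfolding N_def cmod_pulse[symmetric] by (simp add: datum_def norm_vector_smult norm_f)
    have "norm (datum a (\<lambda>x. 0) x - datum a (pulse n) x) powr p
       = (sqrt N * pulse_amplitude) powr p * (gauss (N * x) powr p)" for x
      unfolding nrm by (rule powr_mult)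
    then have "(LINT x|lborel. norm (datum a (\<lambda>x. 0) x - datum a (pulse n) x) powr p)
       = (sqrt N * pulse_amplitude) powr p * (LINT x|lborel. gauss (N * x) powr p)" by simp
    also have "(LINT x|lborel. gauss (N * x) powr p) = C / N"
      using lborel_integral_real_affine[of N "\<lambda>x. gauss x powr p" 0] N by (simp add: C_def)
    also have "(sqrt N * pulse_amplitude) powr p = N powr (p / 2) * pulse_amplitude powr p"
      using N pulse_amplitude_pos by (simp add: powr_mult powr_half_sqrt[symmetric] powr_powr)
    also have "N powr (p / 2) * pulse_amplitude powr p * (C / N) = pulse_amplitude powr p * C * N powr (p / 2 - 1)"
      using N by (simp add: powr_diff)
    finally show ?thesis by (simp add: Lp_dist_def Lp_norm_def N_def)
  qed
  moreover have "(\<lambda>n. (pulse_amplitude powr p * C * real (Suc n) powr (p / 2 - 1)) powr (1 / p)) \<longlonglongrightarrow> 0"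
  proof (rule tendsto_zero_powrI)
    have "filterlim (\<lambda>n. real (Suc n)) at_top sequentially"
      by (rule filterlim_compose[OF filterlim_real_sequentially filterlim_Suc])
    then have "(\<lambda>n. real (Suc n) powr (p / 2 - 1)) \<longlonglongrightarrow> 0"
      by (rule tendsto_neg_powr[rotated]) (use p in simp)
    then have "(\<lambda>n. pulse_amplitude powr p * C * real (Suc n) powr (p / 2 - 1)) \<longlonglongrightarrow> pulse_amplitude powr p * C * 0"
      by (intro tendsto_intros)
    then show "(\<lambda>n. pulse_amplitude powr p * C * real (Suc n) powr (p / 2 - 1)) \<longlonglongrightarrow> 0" by simp
    show "\<forall>\<^sub>F n in sequentially. 0 \<le> pulse_amplitude powr p * C * real (Suc n) powr (p / 2 - 1)"
      using C by (intro always_eventually allI) simp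
    show "(\<lambda>n. 1 / p) \<longlonglongrightarrow> 1 / p" "0 < 1 / p" using p by auto
  qed
  ultimately show ?thesis by simp
qed

text \<open>For \<open>\<bar>x\<bar> \<le> t / 2\<close> the interval \<open>[x - t, x + t]\<close> contains a fixed neighbourhood of the origin, so the
  phase shift tends to \<open>\<pi>\<close>, and the \<open>L\<^sup>1\<close> norm of the pulse tends to zero. The remaining error is the
  one of the wave without pulse, at most \<open>1 / 8\<close>. As the wave has size at least \<open>23 / 32\<close> there, its
  change of sign gives a distance of at least \<open>2 \<cdot> 23 / 32 - 1 / 8 - 3 / 16 - 1 / 16 \<ge> 1\<close>.\<close>

theorem pulse_scattering:
  assumes \<Phi>: "L2_data_to_solution \<gamma> m \<Phi>" and m: "m \<ge> 0" and t: "0 < t" "t \<le> 1 / 2" and mt: "m * t \<le> 1 / 7"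
  shows "\<forall>\<^sub>F n in sequentially. AE x in lborel. \<bar>x\<bar> \<le> t / 2 \<longrightarrow>
     1 \<le> norm (\<Phi> (datum (wave) (\<lambda>x. 0)) t x - \<Phi> (datum (wave) (pulse n)) t x)"
proof -
  have m1: "m * t \<le> 1" using mt by simp
  define err0 where "err0 = scattering_error m t 1 0"
  have err0: "err0 \<le> 1 / 8"
  proof -
    have "m\<^sup>2 * t\<^sup>2 = (m * t)\<^sup>2" by (simp add: power_mult_distrib)
    also have "\<dots> \<le> (1 / 7)\<^sup>2" using mt m t by (intro power_mono) auto
    finally have q: "m\<^sup>2 * t\<^sup>2 \<le> 1 / 49" by (simp add: power2_eq_square)
    have "m\<^sup>2 * t ^ 3 = (m\<^sup>2 * t\<^sup>2) * t" by (simp add: power2_eq_square power3_eq_cube)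
    also have "\<dots> \<le> (1 / 49) * (1 / 2)" using q t by (intro mult_mono) auto
    finally have "m\<^sup>2 * t ^ 3 \<le> 1 / 98" by simp
    moreover have "err0 = m\<^sup>2 * t\<^sup>2 + 8 * (m\<^sup>2 * t ^ 3)" by (simp add: err0_def scattering_error_def)
    ultimately show ?thesis using q by linarith
  qed
  have w0: "AE x in lborel. cmod (cinner e (\<Phi> (datum (wave) (\<lambda>x. 0)) t x) - wave (x - t)) \<le> err0"
    using scattered_wave[OF \<Phi> m t(1) m1 wave_schwartz zero_schwartz wave_le_1, where k = "\<lambda>x. 0" and K = "\<lambda>x. 0" and J = "\<lambda>x. 0" and \<kappa> = 0]
    by (simp add: err0_def)
  \<comment> \<open>The primitives for all pulses arise by rescaling those for the first.\<close>
  define k0 where "k0 x = pulse_amplitude * gauss x" for x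
  have k0: "continuous_on UNIV k0" "\<And>x. k0 x \<ge> 0" "integrable lborel k0"
    using pulse_amplitude_pos gauss_pos integrable_gauss
    unfolding k0_def[abs_def] by (auto simp: less_imp_le intro!: continuous_intros)
  obtain K0 where K0: "\<And>x. (K0 has_real_derivative k0 x) (at x)" "\<And>a b. K0 b - K0 a \<le> (LINT x|lborel. k0 x)"
    using antiderivative_of_integrable[OF k0] by blast
  have "(k0 x)\<^sup>2 = sqrt pi * gauss (sqrt 2 * x)" for x
    by (simp add: k0_def power_mult_distrib gauss_square pulse_amplitude_def)
  then have k0sq: "(\<lambda>x. (k0 x)\<^sup>2) = (\<lambda>x. sqrt pi * gauss (sqrt 2 * x))" by auto
  have mass: "(LINT x|lborel. (k0 x)\<^sup>2) = pi"
    by (simp add: k0sq integral_gauss_scaled real_sqrt_mult)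
  have "integrable lborel (\<lambda>x. (k0 x)\<^sup>2)" unfolding k0sq by (intro integrable_mult_right integrable_gauss_scaled) simp
  moreover have "continuous_on UNIV (\<lambda>x. (k0 x)\<^sup>2)" using k0(1) by (intro continuous_intros)
  ultimately have "\<exists>H. (\<forall>x. (H has_real_derivative (k0 x)\<^sup>2) (at x)) \<and> (\<forall>a b. H b - H a \<le> pi) \<and>
     (\<forall>c>0. (\<lambda>n. H (c * real n) - H (- (c * real n))) \<longlonglongrightarrow> pi)"
    using antiderivative_of_integrable[of "\<lambda>x. (k0 x)\<^sup>2"] unfolding mass by simp
  then obtain J0 where J0: "\<And>x. (J0 has_real_derivative (k0 x)\<^sup>2) (at x)" "\<And>a b. J0 b - J0 a \<le> pi"
    and J0lim: "\<And>c. c > 0 \<Longrightarrow> (\<lambda>n. J0 (c * real n) - J0 (- (c * real n))) \<longlonglongrightarrow> pi"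
    by blast
  have J0mono: "J0 a \<le> J0 b" if "a \<le> b" for a b
    by (rule DERIV_nonneg_imp_nondecreasing[OF that]) (use J0(1) in force)
  define N where "N n = real (Suc n)" for n
  have N: "N n > 0" for n by (simp add: N_def)
  define \<kappa> where "\<kappa> n = (LINT x|lborel. k0 x) / sqrt (N n)" for n
  define err where "err n = scattering_error m t 1 (\<kappa> n)" for n
  have wn: "AE x in lborel. cmod (cinner e (\<Phi> (datum (wave) (pulse n)) t x)
      - exp (\<i> * of_real (J0 (N n * (x + t)) - J0 (N n * (x - t)))) * wave (x - t)) \<le> err n" for n
    unfolding err_def
  proof (rule scattered_wave[OF \<Phi> m t(1) m1 wave_schwartz pulse_schwartz wave_le_1, where k = "\<lambda>x. sqrt (N n) * k0 (N n * x)" and K = "\<lambda>x. K0 (N n * x) / sqrt (N n)" and J = "\<lambda>x. J0 (N n * x)"])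
    have scale: "((\<lambda>x. F (N n * x)) has_real_derivative N n * F' (N n * x)) (at x)"
      if F: "\<And>x. (F has_real_derivative F' x) (at x)" for F F' :: "real \<Rightarrow> real" and x
    proof -
      have "((\<lambda>x. N n * x) has_real_derivative N n) (at x)" by (auto intro!: derivative_eq_intros)
      from DERIV_chain'[OF this F] show ?thesis by (simp add: mult.commute)
    qed
    show "cmod (pulse n x) = sqrt (N n) * k0 (N n * x)" for x
      by (simp add: cmod_pulse k0_def N_def mult.assoc)
    show "((\<lambda>x. K0 (N n * x) / sqrt (N n)) has_real_derivative sqrt (N n) * k0 (N n * x)) (at x)" for x
    proof -
      have "N n / sqrt (N n) = sqrt (N n)" using N[of n] by (simp add: real_div_sqrt)
      then have "N n * c / sqrt (N n) = sqrt (N n) * c" for c by (metis times_divide_eq_left)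
      with DERIV_cdivide[OF scale[OF K0(1), of x], of "sqrt (N n)"] show ?thesis by (simp only:)
    qed
    show "K0 (N n * b) / sqrt (N n) - K0 (N n * a) / sqrt (N n) \<le> \<kappa> n" for a b
      using K0(2) N[of n] unfolding \<kappa>_def diff_divide_distrib[symmetric] by (intro divide_right_mono) auto
    show "((\<lambda>x. J0 (N n * x)) has_real_derivative (sqrt (N n) * k0 (N n * x))\<^sup>2) (at x)" for x
      using scale[OF J0(1), of x] N[of n] by (simp add: power_mult_distrib)
  qed
  have "filterlim N at_top sequentially"
    unfolding N_def[abs_def] by (rule filterlim_compose[OF filterlim_real_sequentially filterlim_Suc])
  then have "filterlim (\<lambda>n. sqrt (N n)) at_top sequentially" by (rule filterlim_compose[OF sqrt_at_top])
  then have "\<kappa> \<longlonglongrightarrow> 0" unfolding \<kappa>_def[abs_def] by (intro tendsto_divide_0[OF tendsto_const] filterlim_at_top_imp_at_infinity)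
  then have "err \<longlonglongrightarrow> scattering_error m t 1 0"
    unfolding err_def[abs_def] scattering_error_def Let_def by (intro tendsto_intros) simp_all
  then have e1: "\<forall>\<^sub>F n in sequentially. err n < 3 / 16"
    using err0 by (intro order_tendstoD(2)[of err err0]) (auto simp: err0_def)
  have "(\<lambda>n. J0 (t / 2 * real (Suc n)) - J0 (- (t / 2 * real (Suc n)))) \<longlonglongrightarrow> pi"
    using LIMSEQ_Suc[OF J0lim[of "t / 2"]] t by simp
  then have e2: "\<forall>\<^sub>F n in sequentially. pi - 1 / 16 < J0 (t / 2 * N n) - J0 (- (t / 2 * N n))"
    unfolding N_def[symmetric] by (intro order_tendstoD(1)) auto
  show ?thesis
    using e1 e2
  proof eventually_elim
    case (elim n)
    show "AE x in lborel. \<bar>x\<bar> \<le> t / 2 \<longrightarrow>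
       1 \<le> norm (\<Phi> (datum (wave) (\<lambda>x. 0)) t x - \<Phi> (datum (wave) (pulse n)) t x)"
      using w0 wn[of n]
    proof eventually_elim
      case (elim x)
      define a where "a = cinner e (\<Phi> (datum (wave) (\<lambda>x. 0)) t x)"
      define b where "b = cinner e (\<Phi> (datum (wave) (pulse n)) t x)"
      define g where "g = gauss (x - t)"
      define \<theta> where "\<theta> = J0 (N n * (x + t)) - J0 (N n * (x - t))"
      have a: "cmod (a - of_real g) \<le> err0" and b: "cmod (b - exp (\<i> * of_real \<theta>) * of_real g) \<le> err n"
        using elim by (simp_all add: a_def b_def g_def \<theta>_def wave_eq)
      show ?case
      proof
        assume x: "\<bar>x\<bar> \<le> t / 2"
        have th: "pi - 1 / 16 < \<theta>" "\<theta> \<le> pi"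
        proof -
          have h: "t / 2 \<le> x + t" "x - t \<le> - (t / 2)" using x by linarith+
          have "t / 2 * N n \<le> N n * (x + t)" "N n * (x - t) \<le> - (t / 2 * N n)"
            unfolding mult.commute[of "t / 2" "N n"] mult_minus_right[symmetric]
            by (rule mult_left_mono[OF h(1) less_imp_le[OF N]], rule mult_left_mono[OF h(2) less_imp_le[OF N]])
          then have "J0 (t / 2 * N n) \<le> J0 (N n * (x + t))" "J0 (N n * (x - t)) \<le> J0 (- (t / 2 * N n))"
            by (auto intro: J0mono)
          then show "pi - 1 / 16 < \<theta>" using \<open>pi - 1 / 16 < J0 (t / 2 * N n) - J0 (- (t / 2 * N n))\<close> by (simp add: \<theta>_def)
          show "\<theta> \<le> pi" unfolding \<theta>_def by (rule J0(2))
        qed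
        have g: "23 / 32 \<le> g" "g \<le> 1"
        proof -
          have "\<bar>x - t\<bar> \<le> 3 / 4" using x t by linarith
          then have "(x - t)\<^sup>2 \<le> (3 / 4)\<^sup>2" using power_mono[of "\<bar>x - t\<bar>" "3/4" 2] by simp
          moreover have "1 + (- (x - t)\<^sup>2 / 2) \<le> exp (- (x - t)\<^sup>2 / 2)" by (rule exp_ge_add_one_self)
          ultimately show "23 / 32 \<le> g" by (simp add: g_def gauss_def power2_eq_square)
          show "g \<le> 1" by (simp add: g_def gauss_le_1)
        qed
        have "cmod (exp (\<i> * of_real \<theta>) - exp (\<i> * of_real pi)) \<le> 1 / 16"
          using cmod_exp_i_diff_le[of \<theta> pi] th by linarith
        then have d: "cmod ((exp (\<i> * of_real \<theta>) + 1) * of_real g) \<le> 1 / 16"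
          using g mult_mono[of "cmod (exp (\<i> * of_real \<theta>) + 1)" "1 / 16" g 1] by (simp add: norm_mult exp_pi_i)
        have "2 * g = cmod (of_real (2 * g))" using g by simp
        also have "of_real (2 * g) = (a - b) - (a - of_real g) + (b - exp (\<i> * of_real \<theta>) * of_real g) + (exp (\<i> * of_real \<theta>) + 1) * of_real g"
          by (simp add: algebra_simps)
        also have "cmod \<dots> \<le> cmod (a - b) + cmod (a - of_real g) + cmod (b - exp (\<i> * of_real \<theta>) * of_real g) + cmod ((exp (\<i> * of_real \<theta>) + 1) * of_real g)"
          by (intro order_trans[OF norm_triangle_ineq] add_mono order_trans[OF norm_triangle_ineq] norm_triangle_ineq4 order_refl)
        finally have "1 \<le> cmod (a - b)" using a b d g err0 \<open>err n < 3 / 16\<close> by linarith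
        also have "a - b = cinner e (\<Phi> (datum (wave) (\<lambda>x. 0)) t x - \<Phi> (datum (wave) (pulse n)) t x)"
          by (simp add: a_def b_def cinner_diff_right)
        also have "cmod \<dots> \<le> norm (\<Phi> (datum (wave) (\<lambda>x. 0)) t x - \<Phi> (datum (wave) (pulse n)) t x)"
          using norm_cinner_le[of e] by (simp add: norm_e)
        finally show "1 \<le> norm (\<Phi> (datum (wave) (\<lambda>x. 0)) t x - \<Phi> (datum (wave) (pulse n)) t x)" .
      qed
    qed
  qed
qed

text \<open>The discontinuity occurs at the datum that consists of the wave alone, at every sufficiently small
  positive time.\<close>

theorem not_well_posed_Lp:
  assumes \<Phi>: "L2_data_to_solution \<gamma> m \<Phi>" and m: "m \<ge> 0" and p: "1 \<le> p" "p < 2"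
  shows "\<not> locally_well_posed \<Phi> (Lp_space p) (Lp_dist p) ae_equal"
proof
  assume wp: "locally_well_posed \<Phi> (Lp_space p) (Lp_dist p) ae_equal"
  define a where "a = datum (wave) (\<lambda>x. 0)"
  define b where "b n = datum (wave) (pulse n)" for n
  have aX: "a \<in> Lp_space p" and bX: "b n \<in> Lp_space p" and a2: "a \<in> Lp_space 2" and b2: "b n \<in> Lp_space 2" for n
    unfolding a_def b_def by (auto intro!: datum_Lp datum_schwartz_Lp_2 wave_schwartz zero_schwartz pulse_schwartz p(1))
  obtain \<Omega> T S where nb: "nbhd_in (Lp_space p) (Lp_dist p) a \<Omega>" and T: "T > 0"
    and cont: "continuous_to_curves \<Omega> (Lp_space p) (Lp_dist p) {0..T} S"
    and ext: "\<And>a f t. a \<in> \<Omega> \<Longrightarrow> f \<in> Lp_space 2 \<Longrightarrow> ae_equal f a \<Longrightarrow> t \<in> {0..T} \<Longrightarrow> ae_equal (\<Phi> f t) (S a t)"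
    using wp aX unfolding locally_well_posed_def by blast
  obtain r where r: "r > 0" "\<And>c. c \<in> Lp_space p \<Longrightarrow> Lp_dist p a c < r \<Longrightarrow> c \<in> \<Omega>"
    using nb unfolding nbhd_in_def by blast
  have "Lp_dist p a a = 0" using p by (simp add: Lp_dist_def Lp_norm_def)
  then have a\<Omega>: "a \<in> \<Omega>" using r aX by simp
  \<comment> \<open>The last bound on \<open>t\<close> makes \<open>mt \<le> 1 / 7\<close>, also for \<open>m = 0\<close>.\<close>
  define t where "t = min T (min (1 / 2) (1 / (7 * (m + 1))))"
  have t: "0 < t" "t \<in> {0..T}" using T m by (auto simp: t_def)
  have t2: "t \<le> 1 / 2" unfolding t_def by (intro min.coboundedI2 min.cobounded1)
  have "m * t \<le> m * (1 / (7 * (m + 1)))" using m by (intro mult_left_mono) (auto simp: t_def)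
  also have "\<dots> \<le> 1 / 7" using m by (simp add: field_simps)
  finally have mt: "m * t \<le> 1 / 7" .
  have refl: "ae_equal c c" for c by (simp add: ae_equal_def)
  \<comment> \<open>The \<open>L\<^sup>p\<close> norm of a field of modulus at least \<open>1\<close> on \<open>[- t / 2, t / 2]\<close> is at least \<open>\<epsilon>\<close>.\<close>
  define \<epsilon> where "\<epsilon> = t powr (1 / p)"
  have "\<epsilon> > 0" using t by (simp add: \<epsilon>_def)
  then obtain \<delta> where d: "\<delta> > 0" "\<And>c s. c \<in> \<Omega> \<Longrightarrow> Lp_dist p a c < \<delta> \<Longrightarrow> s \<in> {0..T} \<Longrightarrow> Lp_dist p (S a s) (S c s) < \<epsilon>"
    using cont a\<Omega> unfolding continuous_to_curves_def by blast
  have lim: "(\<lambda>n. Lp_dist p a (b n)) \<longlonglongrightarrow> 0" unfolding a_def b_def by (rule pulse_Lp_tendsto_0[OF p])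
  have "\<forall>\<^sub>F n in sequentially. Lp_dist p a (b n) < min r \<delta> \<and>
     (AE x in lborel. \<bar>x\<bar> \<le> t / 2 \<longrightarrow> 1 \<le> norm (\<Phi> a t x - \<Phi> (b n) t x))"
  proof (rule eventually_conj)
    show "\<forall>\<^sub>F n in sequentially. Lp_dist p a (b n) < min r \<delta>"
      by (rule order_tendstoD(2)[OF lim]) (use r(1) d(1) in simp)
    show "\<forall>\<^sub>F n in sequentially. AE x in lborel. \<bar>x\<bar> \<le> t / 2 \<longrightarrow> 1 \<le> norm (\<Phi> a t x - \<Phi> (b n) t x)"
      unfolding a_def b_def by (rule pulse_scattering[OF \<Phi> m t(1) t2 mt])
  qed
  then obtain n where n: "Lp_dist p a (b n) < min r \<delta>" and far: "AE x in lborel. \<bar>x\<bar> \<le> t / 2 \<longrightarrow> 1 \<le> norm (\<Phi> a t x - \<Phi> (b n) t x)"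
    by (auto dest: eventually_happens'[OF sequentially_bot])
  have b\<Omega>: "b n \<in> \<Omega>" using r(2)[OF bX] n by simp
  have SX: "S a t \<in> Lp_space p" "S (b n) t \<in> Lp_space p"
    using cont a\<Omega> b\<Omega> t(2) unfolding continuous_to_curves_def curves_def by auto
  have "AE x in lborel. \<bar>x\<bar> \<le> t / 2 \<longrightarrow> 1 \<le> norm (S a t x - S (b n) t x)"
    using far ext[OF a\<Omega> a2 refl t(2)] ext[OF b\<Omega> b2 refl t(2)]
    unfolding ae_equal_def by eventually_elim simp
  then have "(2 * (t / 2)) powr (1 / p) \<le> Lp_norm p (\<lambda>x. S a t x - S (b n) t x)"
    using t by (intro Lp_norm_ge[OF p(1) Lp_space_diff[OF p(1) SX]]) auto
  moreover have "Lp_dist p (S a t) (S (b n) t) < \<epsilon>" using d(2)[OF b\<Omega> _ t(2)] n by simp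
  ultimately show False by (simp add: \<epsilon>_def Lp_dist_def)
qed

end

section \<open>Ill-posedness in \<open>H\<^sup>s\<close> for the massless model\<close>

lemma fourier_packet: "fourier (packet 1 1 \<omega>) \<xi> = of_real (sqrt (2 * pi) * gauss (\<xi> - \<omega>))"
proof -
  have "packet 1 1 \<omega> = (\<lambda>x. exp (- \<i> * of_real (x * (- \<omega>))) * of_real (gauss x))"
    by (simp add: packet_def fun_eq_iff mult.commute)
  then show ?thesis by (simp only: fourier_modulation fourier_gauss diff_conv_add_uminus)
qed

text \<open>Modulation translates the transform to high frequencies, where the weight is small.\<close>

lemma weighted_fourier_packet_tendsto_0:
  assumes s: "s < 0"
  shows "(\<lambda>n. LINT \<xi>|lborel. (cmod (weighted_fourier s (packet 1 1 (real n)) \<xi>))\<^sup>2) \<longlonglongrightarrow> 0"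
proof -
  have eq: "(LINT \<xi>|lborel. (cmod (weighted_fourier s (packet 1 1 (real n)) \<xi>))\<^sup>2)
      = (LINT \<xi>|lborel. (1 + (\<xi> + real n)\<^sup>2) powr s * (2 * pi * (gauss \<xi>)\<^sup>2))" for n
  proof -
    have "(cmod (weighted_fourier s (packet 1 1 (real n)) \<xi>))\<^sup>2 = (1 + \<xi>\<^sup>2) powr s * (2 * pi * (gauss (\<xi> - real n))\<^sup>2)" for \<xi>
      by (simp add: weighted_fourier_def fourier_packet norm_mult power_mult_distrib weight_sq)
    then show ?thesis
      using lborel_integral_real_affine[of 1 "\<lambda>\<xi>. (1 + \<xi>\<^sup>2) powr s * (2 * pi * (gauss (\<xi> - real n))\<^sup>2)" "real n"]
      by (simp add: add.commute)
  qed
  have "(\<lambda>n. LINT \<xi>|lborel. (1 + (\<xi> + real n)\<^sup>2) powr s * (2 * pi * (gauss \<xi>)\<^sup>2)) \<longlonglongrightarrow> (LINT \<xi>|(lborel :: real measure). 0)"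
  proof (rule integral_dominated_convergence[where w = "\<lambda>\<xi>. 2 * pi * (gauss \<xi>)\<^sup>2"])
    show "integrable lborel (\<lambda>\<xi>. 2 * pi * (gauss \<xi>)\<^sup>2)"
      unfolding gauss_square by (intro integrable_mult_right integrable_gauss_scaled) simp
    show "AE \<xi> in lborel. (\<lambda>n. (1 + (\<xi> + real n)\<^sup>2) powr s * (2 * pi * (gauss \<xi>)\<^sup>2)) \<longlonglongrightarrow> 0"
    proof (rule AE_I2)
      fix \<xi> :: real
      have "filterlim (\<lambda>n. \<xi> + real n) at_top sequentially"
        by (rule filterlim_tendsto_add_at_top[OF tendsto_const filterlim_real_sequentially])
      then have "filterlim (\<lambda>n. (\<xi> + real n)\<^sup>2) at_top sequentially" by (rule filterlim_pow_at_top[rotated]) simp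
      then have "filterlim (\<lambda>n. 1 + (\<xi> + real n)\<^sup>2) at_top sequentially"
        by (rule filterlim_tendsto_add_at_top[OF tendsto_const])
      then have "(\<lambda>n. (1 + (\<xi> + real n)\<^sup>2) powr s) \<longlonglongrightarrow> 0" by (rule tendsto_neg_powr[OF s])
      then have "(\<lambda>n. (1 + (\<xi> + real n)\<^sup>2) powr s * (2 * pi * (gauss \<xi>)\<^sup>2)) \<longlonglongrightarrow> 0 * (2 * pi * (gauss \<xi>)\<^sup>2)"
        by (intro tendsto_intros)
      then show "(\<lambda>n. (1 + (\<xi> + real n)\<^sup>2) powr s * (2 * pi * (gauss \<xi>)\<^sup>2)) \<longlonglongrightarrow> 0" by simp
    qed
    show "AE \<xi> in lborel. norm ((1 + (\<xi> + real n)\<^sup>2) powr s * (2 * pi * (gauss \<xi>)\<^sup>2)) \<le> 2 * pi * (gauss \<xi>)\<^sup>2" for n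
    proof (rule AE_I2)
      fix \<xi> :: real
      have "(1 + (\<xi> + real n)\<^sup>2) powr s \<le> (1 + (\<xi> + real n)\<^sup>2) powr 0"
        by (rule powr_mono) (use s in auto)
      also have "\<dots> = 1" using one_plus_square_neq_0 by simp
      finally have "(1 + (\<xi> + real n)\<^sup>2) powr s * (2 * pi * (gauss \<xi>)\<^sup>2) \<le> 1 * (2 * pi * (gauss \<xi>)\<^sup>2)"
        by (rule mult_right_mono) simp
      then show "norm ((1 + (\<xi> + real n)\<^sup>2) powr s * (2 * pi * (gauss \<xi>)\<^sup>2)) \<le> 2 * pi * (gauss \<xi>)\<^sup>2" by simp
    qed
  qed measurable
  then show ?thesis by (simp add: eq)
qed

context chiral_basis begin

lemma Hs_dist_packet_tendsto_0:
  assumes s: "s < 0" and a: "a \<in> schwartz"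
  shows "(\<lambda>n. Hs_dist s (regular (datum a (\<lambda>x. 0))) (regular (datum a (packet 1 1 (real n))))) \<longlonglongrightarrow> 0"
proof -
  define d where "d n = Hs_dist s (regular (datum a (\<lambda>x. 0))) (regular (datum a (packet 1 1 (real n))))" for n
  define B where "B n = sqrt (1 / (2 * pi) * (LINT \<xi>|lborel. (cmod (weighted_fourier s (packet 1 1 (real n)) \<xi>))\<^sup>2))" for n
  note z = zero_schwartz
  have g: "packet 1 1 \<omega> \<in> schwartz" for \<omega> by (rule packet_schwartz) simp
  have rep: "Hs_rep s (\<lambda>\<phi>. regular (datum a (\<lambda>x. 0)) \<phi> - regular (datum a (packet 1 1 (real n))) \<phi>)
      (\<lambda>x. datum (bessel_op s a) (bessel_op s (\<lambda>x. 0)) x - datum (bessel_op s a) (bessel_op s (packet 1 1 (real n))) x)" for n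
    by (intro Hs_rep_diff datum_Hs_rep a z g)
  have up: "d n \<le> B n" for n
  proof -
    have nrm: "norm (datum (bessel_op s a) (bessel_op s (\<lambda>x. 0)) x - datum (bessel_op s a) (bessel_op s (packet 1 1 (real n))) x)
        = cmod (bessel_op s (packet 1 1 (real n)) x)" for x
      by (simp add: datum_def bessel_op_zero norm_vector_smult norm_f)
    have "d n \<le> sqrt (LINT x|lborel. (cmod (bessel_op s (packet 1 1 (real n)) x))\<^sup>2)"
      using Hs_norm_le[OF rep[of n]] unfolding Lp_norm_2 nrm d_def Hs_dist_def .
    also have "\<dots> \<le> B n"
      unfolding B_def by (intro real_sqrt_le_mono bessel_op_square_integrable(2) g)
    finally show ?thesis .
  qed
  have low: "0 \<le> d n" for n
    unfolding d_def Hs_dist_def Hs_norm_def 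
    by (rule cInf_greatest) (use rep[of n] in blast, use Lp_norm_nonneg in auto)
  have "B \<longlonglongrightarrow> sqrt (1 / (2 * pi) * 0)"
    unfolding B_def[abs_def] by (intro tendsto_intros weighted_fourier_packet_tendsto_0 s)
  then have "B \<longlonglongrightarrow> 0" by simp
  then have "d \<longlonglongrightarrow> 0"
    using tendsto_sandwich[of "\<lambda>_. 0" d sequentially B 0] low up by simp
  then show ?thesis by (simp only: d_def[abs_def])
qed

lemma cinner_regular:
  assumes w: "w \<in> Lp_space 2" and p: "\<phi> \<in> schwartz"
  shows "cinner e (regular w \<phi>) = (LINT x|lborel. \<phi> x * cinner e (w x))"
    and "integrable lborel (\<lambda>x. \<phi> x * cinner e (w x))"
proof -
  note i = regular_schwartz_integrable[OF w p]
  show "integrable lborel (\<lambda>x. \<phi> x * cinner e (w x))"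
    using integrable_bounded_linear[OF bounded_linear_cinner[of e] i] by (simp add: cinner_smult_right)
  show "cinner e (regular w \<phi>) = (LINT x|lborel. \<phi> x * cinner e (w x))"
    unfolding regular_def
    using integral_bounded_linear[OF bounded_linear_cinner[of e] i] by (simp add: cinner_smult_right)
qed

text \<open>The phase \<open>\<theta>\<close> depends on \<open>\<bar>packet 1 1 \<omega>\<bar> = gauss\<close> only, hence not on \<open>\<omega>\<close>. The pairing of the difference
  with a Gaussian does not vanish because \<open>0 < \<theta> < \<pi>\<close> gives the imaginary part of \<open>1 - exp (\<i>\<theta>)\<close> a
  fixed sign; the upper bound holds since the charge \<open>\<surd>\<pi>\<close> of the pulse is less than \<open>\<pi>\<close>.\<close>

lemma packet_scattering_gap:
  assumes \<Phi>: "L2_data_to_solution \<gamma> 0 \<Phi>" and t: "t > 0"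
  shows "\<exists>Z. Z \<noteq> 0 \<and> (\<forall>\<omega>. cinner e (regular (\<Phi> (datum (wave) (\<lambda>x. 0)) t) (wave)
      - regular (\<Phi> (datum (wave) (packet 1 1 \<omega>)) t) (wave)) = Z)"
proof -
  note z = zero_schwartz
  have g: "packet 1 1 \<omega> \<in> schwartz" for \<omega> by (rule packet_schwartz) simp
  have \<Phi>_L2: "\<Phi> (datum (wave) q) t \<in> Lp_space 2" if "q \<in> schwartz" for q
    using \<Phi> datum_schwartz_Lp_2[OF g that] unfolding L2_data_to_solution_def curves_def by blast
  obtain K where K: "\<And>x. (K has_real_derivative gauss x) (at x)" "\<And>a b. K b - K a \<le> (LINT x|lborel. gauss x)"
    using antiderivative_of_integrable[of gauss] integrable_gauss gauss_pos continuous_on_gauss[of UNIV "\<lambda>x. x"]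
    by (auto simp: less_imp_le)
  have mass: "(LINT x|lborel. (gauss x)\<^sup>2) = sqrt pi"
    by (simp add: gauss_square integral_gauss_scaled real_sqrt_mult)
  have isq: "integrable lborel (\<lambda>x. (gauss x)\<^sup>2)" unfolding gauss_square by (rule integrable_gauss_scaled) simp
  have csq: "continuous_on UNIV (\<lambda>x. (gauss x)\<^sup>2)" by (intro continuous_intros)
  obtain J where J: "\<And>x. (J has_real_derivative (gauss x)\<^sup>2) (at x)" "\<And>a b. J b - J a \<le> sqrt pi"
    using antiderivative_of_integrable[OF csq _ isq] unfolding mass by auto
  define \<theta> where "\<theta> x = J (x + t) - J (x - t)" for x
  have \<theta>: "0 < \<theta> x" "\<theta> x < pi" for x
  proof -
    have "J (x - t) < J (x + t)"
      by (rule DERIV_pos_imp_increasing) (use t J(1) gauss_pos in \<open>auto intro!: exI zero_less_power\<close>)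
    then show "0 < \<theta> x" by (simp add: \<theta>_def)
    have "sqrt pi < sqrt (pi * pi)" using pi_gt3 by (intro real_sqrt_less_mono) simp
    then have "sqrt pi < pi" by simp
    then show "\<theta> x < pi" using J(2)[of "x + t" "x - t"] by (simp add: \<theta>_def)
  qed
  have cJ: "continuous_on UNIV J" using J(1) by (auto intro!: continuous_at_imp_continuous_on DERIV_isCont)
  have c\<theta>: "continuous_on UNIV \<theta>"
    unfolding \<theta>_def[abs_def] by (intro continuous_intros continuous_on_compose2[OF cJ]) auto
  define G where "G x = gauss x * gauss (x - t)" for x
  have G: "G x > 0" for x by (simp add: G_def gauss_pos)
  define H where "H x = of_real (G x) * (1 - exp (\<i> * of_real (\<theta> x)))" for x
  define Z where "Z = (LINT x|lborel. H x)"
  have cH: "continuous_on UNIV H"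
    unfolding H_def[abs_def] G_def by (intro continuous_intros c\<theta>)
  have w0: "AE x in lborel. cinner e (\<Phi> (datum (wave) (\<lambda>x. 0)) t x) = wave (x - t)"
    using scattered_wave[OF \<Phi> order_refl t _ wave_schwartz z wave_le_1, where k = "\<lambda>x. 0" and K = "\<lambda>x. 0" and J = "\<lambda>x. 0" and \<kappa> = 0]
    by (simp add: scattering_error_massless)
  have w1: "AE x in lborel. cinner e (\<Phi> (datum (wave) (packet 1 1 \<omega>)) t x) = exp (\<i> * of_real (\<theta> x)) * wave (x - t)" for \<omega>
    using scattered_wave[OF \<Phi> order_refl t _ wave_schwartz g wave_le_1, where k = gauss and K = K and J = J and \<kappa> = "LINT x|lborel. gauss x"] K J
    by (simp add: scattering_error_massless cmod_packet \<theta>_def)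
  have diff: "integrable lborel H \<and> cinner e (regular (\<Phi> (datum (wave) (\<lambda>x. 0)) t) (wave)
      - regular (\<Phi> (datum (wave) (packet 1 1 \<omega>)) t) (wave)) = Z" for \<omega>
  proof -
    define D where "D x = wave x * cinner e (\<Phi> (datum (wave) (\<lambda>x. 0)) t x)
       - wave x * cinner e (\<Phi> (datum (wave) (packet 1 1 \<omega>)) t x)" for x
    have iD: "integrable lborel D"
      unfolding D_def[abs_def] by (intro Bochner_Integration.integrable_diff cinner_regular(2) \<Phi>_L2 z g)
    have ae: "AE x in lborel. D x = H x"
      using w0 w1[of \<omega>] by eventually_elim (simp add: D_def H_def G_def wave_eq algebra_simps)
    have mH: "H \<in> borel_measurable lborel" using cH by (simp add: borel_measurable_continuous_onI)
    have "integrable lborel H" 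
      using integrable_cong_AE[OF borel_measurable_integrable[OF iD] mH ae] iD by simp
    moreover have "(LINT x|lborel. D x) = Z"
      unfolding Z_def by (rule integral_cong_AE[OF borel_measurable_integrable[OF iD] mH ae])
    moreover have "(LINT x|lborel. D x) = cinner e (regular (\<Phi> (datum (wave) (\<lambda>x. 0)) t) (wave)
      - regular (\<Phi> (datum (wave) (packet 1 1 \<omega>)) t) (wave))"
      unfolding D_def cinner_diff_right cinner_regular(1)[OF \<Phi>_L2[OF z] g] cinner_regular(1)[OF \<Phi>_L2[OF g] g]
      by (rule Bochner_Integration.integral_diff) (rule cinner_regular(2)[OF \<Phi>_L2[OF z] g] cinner_regular(2)[OF \<Phi>_L2[OF g] g])+
    ultimately show ?thesis by simp
  qed
  then have iH: "integrable lborel H" by blast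
  have "Z \<noteq> 0"
  proof
    assume "Z = 0"
    have "Im (H x) = - (G x * sin (\<theta> x))" for x
      by (simp add: H_def Im_exp)
    then have "(LINT x|lborel. G x * sin (\<theta> x)) = - Im Z"
      using integral_bounded_linear[OF bounded_linear_Im iH] by (simp add: Z_def)
    then have "(LINT x|lborel. G x * sin (\<theta> x)) = 0" using \<open>Z = 0\<close> by simp
    moreover have "integrable lborel (\<lambda>x. G x * sin (\<theta> x))"
      using integrable_bounded_linear[OF bounded_linear_Im iH] \<open>\<And>x. Im (H x) = - (G x * sin (\<theta> x))\<close> by simp
    moreover have pos: "G x * sin (\<theta> x) > 0" for x
      using G[of x] sin_gt_zero[OF \<theta>] by simp
    ultimately have "AE x in lborel. G x * sin (\<theta> x) = 0"
      by (subst integral_nonneg_eq_0_iff_AE[symmetric]) (auto intro: less_imp_le)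
    then have "AE x in (lborel :: real measure). False"
      by eventually_elim (metis pos less_irrefl)
    then show False using AE_iff_measurable[of UNIV "lborel :: real measure" "\<lambda>x. False"] by simp
  qed
  then show ?thesis using diff by blast
qed

text \<open>Continuity at the wave alone would make the gap of the preceding lemma, as a distribution tested
  against one Schwartz function, arbitrarily small.\<close>

theorem not_well_posed_Hs:
  assumes \<Phi>: "L2_data_to_solution \<gamma> 0 \<Phi>" and s: "s < 0"
  shows "\<not> locally_well_posed \<Phi> (Hs_space s) (Hs_dist s) represents"
proof
  assume wp: "locally_well_posed \<Phi> (Hs_space s) (Hs_dist s) represents"
  define f where "f = datum (wave) (\<lambda>x. 0)"
  define h where "h n = datum (wave) (packet 1 1 (real n))" for n :: nat
  note z = zero_schwartz
  have g: "packet 1 1 \<omega> \<in> schwartz" for \<omega> by (rule packet_schwartz) simp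
  have fX: "regular f \<in> Hs_space s" and hX: "regular (h n) \<in> Hs_space s" for n
    unfolding f_def h_def Hs_space_def using datum_Hs_rep z g by blast+
  have f2: "f \<in> Lp_space 2" and h2: "h n \<in> Lp_space 2" for n
    unfolding f_def h_def by (intro datum_schwartz_Lp_2 z g)+
  obtain \<Omega> T S where nb: "nbhd_in (Hs_space s) (Hs_dist s) (regular f) \<Omega>" and T: "T > 0"
    and cont: "continuous_to_curves \<Omega> (Hs_space s) (Hs_dist s) {0..T} S"
    and ext: "\<And>a f t. a \<in> \<Omega> \<Longrightarrow> f \<in> Lp_space 2 \<Longrightarrow> represents f a \<Longrightarrow> t \<in> {0..T} \<Longrightarrow> represents (\<Phi> f t) (S a t)"
    using wp fX unfolding locally_well_posed_def by blast
  obtain r where r: "r > 0" "\<And>c. c \<in> Hs_space s \<Longrightarrow> Hs_dist s (regular f) c < r \<Longrightarrow> c \<in> \<Omega>"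
    using nb unfolding nbhd_in_def by blast
  have lim: "(\<lambda>n. Hs_dist s (regular f) (regular (h n))) \<longlonglongrightarrow> 0"
    unfolding f_def h_def by (rule Hs_dist_packet_tendsto_0[OF s g])
  have rep: "represents c (regular c)" for c by (simp add: represents_def)
  have "Hs_dist s (regular f) (regular f) \<le> Lp_norm 2 (\<lambda>x. 0)"
    unfolding Hs_dist_def by (rule Hs_norm_le) (simp add: Hs_rep_def Lp_space_2 regular_def)
  then have f\<Omega>: "regular f \<in> \<Omega>" using r fX by (simp add: Lp_norm_2)
  obtain Z where Z: "Z \<noteq> 0" "\<And>n. cinner e (regular (\<Phi> f T) (wave) - regular (\<Phi> (h n) T) (wave)) = Z"
    using packet_scattering_gap[OF \<Phi> T] unfolding f_def h_def by blast
  define C where "C = sqrt (LINT x|lborel. (cmod (bessel_op (- s) (wave) x))\<^sup>2)"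
  have C: "C \<ge> 0" by (simp add: C_def)
  define \<epsilon> where "\<epsilon> = cmod Z / (C + 1)"
  have \<epsilon>: "\<epsilon> > 0" using Z(1) C by (simp add: \<epsilon>_def)
  have TT: "T \<in> {0..T}" using T by simp
  obtain \<delta> where d: "\<delta> > 0" "\<And>c t. c \<in> \<Omega> \<Longrightarrow> Hs_dist s (regular f) c < \<delta> \<Longrightarrow> t \<in> {0..T} \<Longrightarrow> Hs_dist s (S (regular f) t) (S c t) < \<epsilon>"
    using cont f\<Omega> \<epsilon> unfolding continuous_to_curves_def by blast
  have "\<forall>\<^sub>F n in sequentially. Hs_dist s (regular f) (regular (h n)) < min r \<delta>"
    by (rule order_tendstoD(2)[OF lim]) (use r(1) d(1) in simp)
  then obtain n where n: "Hs_dist s (regular f) (regular (h n)) < min r \<delta>"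
    by (auto dest: eventually_happens'[OF sequentially_bot])
  have h\<Omega>: "regular (h n) \<in> \<Omega>" using r(2)[OF hX] n by simp
  have SX: "S (regular f) T \<in> Hs_space s" "S (regular (h n)) T \<in> Hs_space s"
    using cont f\<Omega> h\<Omega> TT unfolding continuous_to_curves_def curves_def by auto
  obtain F where F: "Hs_rep s (\<lambda>\<phi>. S (regular f) T \<phi> - S (regular (h n)) T \<phi>) F" "Lp_norm 2 F < \<epsilon>"
    using Hs_dist_less[OF SX d(2)[OF h\<Omega> _ TT]] n by auto
  have "regular (\<Phi> f T) (wave) - regular (\<Phi> (h n) T) (wave) = regular F (bessel_op (- s) (wave))"
    using F(1) ext[OF f\<Omega> f2 rep TT] ext[OF h\<Omega> h2 rep TT] g unfolding Hs_rep_def represents_def by simp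
  then have "cmod Z \<le> norm (regular F (bessel_op (- s) (wave)))"
    using Z(2)[of n] norm_cinner_le[of e] by (metis mult_1 norm_e)
  also have "\<dots> \<le> Lp_norm 2 F * C"
    unfolding C_def using F(1) by (intro regular_estimate(2) bessel_op_measurable bessel_op_square_integrable g) (simp add: Hs_rep_def)
  also have "\<dots> \<le> \<epsilon> * C" using F(2) C by (intro mult_right_mono) auto
  also have "\<dots> < \<epsilon> * (C + 1)" using \<epsilon> by simp
  also have "\<dots> = cmod Z" using C by (simp add: \<epsilon>_def)
  finally show False by simp
qed

end

theorem theorem2:
  fixes \<gamma> :: "nat \<Rightarrow> complex ^ 2 ^ 2" and m :: real and \<Phi> :: "field \<Rightarrow> real \<Rightarrow> field"
  assumes "dirac_matrices \<gamma>" and "m \<ge> 0" and "L2_data_to_solution \<gamma> m \<Phi>"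
  shows "(\<forall>p::real. 1 \<le> p \<and> p < 2 \<longrightarrow>
            \<not> locally_well_posed \<Phi> (Lp_space p) (Lp_dist p) ae_equal) \<and>
         (m = 0 \<longrightarrow> (\<forall>s::real. s < 0 \<longrightarrow>
            \<not> locally_well_posed \<Phi> (Hs_space s) (Hs_dist s) represents))"
proof -
  obtain e f where "chiral_basis \<gamma> e f" using exists_chiral_basis[OF assms(1)] by blast
  then interpret chiral_basis \<gamma> e f .
  show ?thesis
    using not_well_posed_Lp[OF assms(3,2)] not_well_posed_Hs assms(3) by blast
qed

end
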